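(* Let $\mathcal{M}=TQ\times\mathbb{R}$. The solutions of the closed-loop system $(\mathrm{CL}_\omega)$ in the variables $\tilde x=\phi^\omega_t(x)$ approximate the solutions of the averaged system $(\mathrm{AV})$ (all defined in the context). That is: for every compact subset $C$ of $\mathcal{M}$ and all $\nu,\Delta>0$, there exists $\omega_0>0$ such that, for every $t_0\in\mathbb{R}$ and every $\bar x_0\in C$, the following implication holds. If the maximal solution $\bar x$ of $(\mathrm{AV})$ with initial condition $\bar x(t_0)=\bar x_0$ satisfies $\bar x(t)\in C$ for every $t\in[t_0,t_0+\Delta]$, then, for every $\omega\geq\omega_0$, the maximal solution $x$ of $(\mathrm{CL}_\omega)$ with initial condition $x(t_0)=(\phi^\omega_{t_0})^{-1}(\bar x_0)$ satisfies $|\phi^\omega_t(x(t))-\bar x(t)|\leq\nu$ for every $t\in[t_0,t_0+\Delta]$.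
   Context: Setting. $Q$ is a properly embedded (hence closed) smooth submanifold of some Euclidean space $\mathbb{R}^N$; $T_qQ$ is regarded as a subspace of $\mathbb{R}^N$ and $TQ=\{(q,v):q\in Q,\,v\in T_qQ\}\subset\mathbb{R}^N\times\mathbb{R}^N$. Thus $\mathcal{M}=TQ\times\mathbb{R}$ is a submanifold of $\mathbb{R}^{2N+1}$, and $|\cdot|$ is the Euclidean norm there. $\nabla$ is a (smooth) affine connection on $Q$; $Y_0,Y_1,\ldots,Y_n$ are smooth vector fields on $Q$; $R$ is a smooth bundle map over $Q$, i.e. it assigns smoothly to each $q\in Q$ a linear map $R(q)\colon T_qQ\to T_qQ$; $\psi\colon Q\to\mathbb{R}$ is smooth. For a curve $q$ in $Q$, $\nabla_{\dot q}\dot q$ denotes its geometric acceleration (covariant derivative of $\dot q$ along $q$ with respect to $\nabla$). $Y_i\psi$ is the Lie derivative of $\psi$ along $Y_i$. The symmetric product of vector fields is $\langle X\colon\! Y\rangle:=\nabla_YX+\nabla_XY$. Control data. $\alpha\colon\mathbb{R}\to\mathbb{R}$ is smooth and such that the product $\alpha\alpha'$ of $\alpha$ with its derivative is positive and strictly increasing. $u=(u^1,\ldots,u^n)\colon\mathbb{R}\to\mathbb{R}^n$ is measurable, bounded, $T$-periodic and zero-mean for some $T>0$; $U=(U^1,\ldots,U^n)$ is its zero-mean antiderivative, and $\frac1T\int_0^TU^i(\tau)U^j(\tau)\,d\tau=1$ if $i=j$ and $=0$ if $i\neq j$. $\lambda=(\lambda^1,\ldots,\lambda^n)$ and $\mu=(\mu^1,\ldots,\mu^n)$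 are constant vectors in $\mathbb{R}^n$, and $h>0$. Closed-loop system $(\mathrm{CL}_\omega)$, for a parameter $\omega>0$: $$\nabla_{\dot q}\dot q=Y_0(q)-R(q)\dot q+\sum_{i=1}^n\mu^i\alpha^2(\psi(q)-\eta)Y_i(q)+\sum_{i=1}^n\omega\,u^i(\omega t)\,\lambda^i\,\alpha(\psi(q)-\eta)\,Y_i(q),\qquad \dot\eta=-h\eta+h\psi(q).$$ Averaged system $(\mathrm{AV})$: $$\nabla_{\dot{\bar q}}\dot{\bar q}=Y_0(\bar q)-R(\bar q)\dot{\bar q}+\alpha^2(\psi(\bar q)-\bar\eta)\sum_{i=1}^n\mu^iY_i(\bar q)-\tfrac12\alpha^2(\psi(\bar q)-\bar\eta)\sum_{i=1}^n(\lambda^i)^2\langle Y_i\colon\! Y_i\rangle(\bar q)-(\alpha\alpha')(\psi(\bar q)-\bar\eta)\sum_{i=1}^n(\lambda^i)^2(Y_i\psi)(\bar q)\,Y_i(\bar q),$$ $$\dot{\bar\eta}=-h\bar\eta+h\psi(\bar q).$$ Both are regarded as first-order differential equations on $\mathcal{M}$ for the state $x=((q,v),\eta)$ with $v=\dot q$ (respectively $\bar x=((\bar q,\bar v),\bar\eta)$ with $\bar v=\dot{\bar q}$). Since $u$ is only measurable and bounded, solutions of $(\mathrm{CL}_\omega)$ are understood in the Carathéodory sense. Change of variables. For $\omega>0$ and $t\in\mathbb{R}$, the bijection $\phi^\omega_t\colon\mathcal{M}\to\mathcal{M}$ is given by $\phi^\omega_t((q,v),\eta)=((q,\tilde v),\eta)$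 with $$\tilde v=v-\sum_{i=1}^nU^i(\omega t)\,\lambda^i\,\alpha(\psi(q)-\eta)\,Y_i(q).$$ *)

theory Defs
  imports "HOL-Analysis.Analysis"
begin

section \<open>Smooth maps and embedded submanifolds of a Euclidean space\<close>

text \<open>Meant for open sets: \<open>f\<close> has continuous partial derivatives up to order \<open>k\<close>.\<close>

primrec C_k_on :: "nat \<Rightarrow> 'a::real_normed_vector set \<Rightarrow> ('a \<Rightarrow> 'b::real_normed_vector) \<Rightarrow> bool" where
  "C_k_on 0 W f \<longleftrightarrow> continuous_on W f"
| "C_k_on (Suc k) W f \<longleftrightarrow>
     (\<forall>x\<in>W. f differentiable (at x)) \<and>
     (\<forall>v. C_k_on k W (\<lambda>x. frechet_derivative f (at x) v))"

text \<open>On an arbitrary set, smoothness means local extendability to a smooth map on an open set;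
  on an embedded submanifold this is smoothness in charts.\<close>

definition smooth_on :: "'a::euclidean_space set \<Rightarrow> ('a \<Rightarrow> 'b::euclidean_space) \<Rightarrow> bool" where
  "smooth_on A f \<longleftrightarrow>
     (\<forall>p\<in>A. \<exists>W g. open W \<and> p \<in> W \<and> (\<forall>k. C_k_on k W g) \<and> (\<forall>x\<in>A \<inter> W. g x = f x))"

definition embedded_submanifold :: "'a::euclidean_space set \<Rightarrow> bool" where
  "embedded_submanifold Q \<longleftrightarrow>
     (\<exists>k. \<forall>p\<in>Q. \<exists>W W' \<Phi> \<Psi> (S :: 'a set).
        open W \<and> p \<in> W \<and> open W' \<and> homeomorphism W W' \<Phi> \<Psi> \<and>
        smooth_on W \<Phi> \<and> smooth_on W' \<Psi> \<and>
        subspace S \<and> dim S = k \<and> \<Phi> ` (Q \<inter> W) = S \<inter> W')"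

definition tangent_space :: "'a::euclidean_space set \<Rightarrow> 'a \<Rightarrow> 'a set" where
  "tangent_space Q q =
     {v. \<exists>e \<gamma>. e > 0 \<and> smooth_on {-e<..<e::real} \<gamma> \<and> \<gamma> ` {-e<..<e} \<subseteq> Q \<and>
           \<gamma> 0 = q \<and> (\<gamma> has_vector_derivative v) (at 0)}"

definition tangent_bundle :: "'a::euclidean_space set \<Rightarrow> ('a \<times> 'a) set" where
  "tangent_bundle Q = (SIGMA q:Q. tangent_space Q q)"

text \<open>Objects on \<open>Q\<close> are represented by functions on the ambient space of which only the
  values at points of \<open>Q\<close> matter.\<close>

definition vector_field :: "'a::euclidean_space set \<Rightarrow> ('a \<Rightarrow> 'a) \<Rightarrow> bool" where
  "vector_field Q X \<longleftrightarrow> smooth_on Q X \<and> (\<forall>q\<in>Q. X q \<in> tangent_space Q q)"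

definition smooth_bundle_map :: "'a::euclidean_space set \<Rightarrow> ('a \<Rightarrow> 'a \<Rightarrow> 'a) \<Rightarrow> bool" where
  "smooth_bundle_map Q R \<longleftrightarrow>
     smooth_on (tangent_bundle Q) (\<lambda>(q, v). R q v) \<and>
     (\<forall>q\<in>Q. \<forall>v\<in>tangent_space Q q.
        R q v \<in> tangent_space Q q \<and>
        (\<forall>w\<in>tangent_space Q q. R q (v + w) = R q v + R q w) \<and>
        (\<forall>c. R q (c *\<^sub>R v) = c *\<^sub>R R q v))"

text \<open>A derivative of \<open>f\<close> within \<open>Q\<close> is determined on \<open>tangent_space Q q\<close> only. Since
  \<open>X q\<close> lies in that space for a vector field \<open>X\<close>, the value below does not depend
  on the choice made by \<open>frechet_derivative\<close>.\<close>

definition lie_derivative ::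
    "'a::euclidean_space set \<Rightarrow> ('a \<Rightarrow> 'a) \<Rightarrow> ('a \<Rightarrow> real) \<Rightarrow> 'a \<Rightarrow> real" where
  "lie_derivative Q X f q = frechet_derivative f (at q within Q) (X q)"

section \<open>Affine connections\<close>

text \<open>\<open>nabla X Y\<close> is the covariant derivative of \<open>Y\<close> along \<open>X\<close>. The second conjunct says that
  \<open>nabla\<close> is well defined on fields on \<open>Q\<close>, the others are the usual axioms.\<close>

definition affine_connection ::
    "'a::euclidean_space set \<Rightarrow> (('a \<Rightarrow> 'a) \<Rightarrow> ('a \<Rightarrow> 'a) \<Rightarrow> 'a \<Rightarrow> 'a) \<Rightarrow> bool" where
  "affine_connection Q nabla \<longleftrightarrow>
     (\<forall>X Y. vector_field Q X \<longrightarrow> vector_field Q Y \<longrightarrow> vector_field Q (nabla X Y)) \<and>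
     (\<forall>X X' Y Y'. vector_field Q X \<longrightarrow> vector_field Q X' \<longrightarrow> vector_field Q Y \<longrightarrow> vector_field Q Y' \<longrightarrow>
        (\<forall>q\<in>Q. X q = X' q \<and> Y q = Y' q) \<longrightarrow> (\<forall>q\<in>Q. nabla X Y q = nabla X' Y' q)) \<and>
     (\<forall>X X' Y. vector_field Q X \<longrightarrow> vector_field Q X' \<longrightarrow> vector_field Q Y \<longrightarrow>
        (\<forall>q\<in>Q. nabla (\<lambda>p. X p + X' p) Y q = nabla X Y q + nabla X' Y q)) \<and>
     (\<forall>f X Y. smooth_on Q f \<longrightarrow> vector_field Q X \<longrightarrow> vector_field Q Y \<longrightarrow>
        (\<forall>q\<in>Q. nabla (\<lambda>p. f p *\<^sub>R X p) Y q = f q *\<^sub>R nabla X Y q)) \<and>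
     (\<forall>X Y Y'. vector_field Q X \<longrightarrow> vector_field Q Y \<longrightarrow> vector_field Q Y' \<longrightarrow>
        (\<forall>q\<in>Q. nabla X (\<lambda>p. Y p + Y' p) q = nabla X Y q + nabla X Y' q)) \<and>
     (\<forall>f X Y. smooth_on Q f \<longrightarrow> vector_field Q X \<longrightarrow> vector_field Q Y \<longrightarrow>
        (\<forall>q\<in>Q. nabla X (\<lambda>p. f p *\<^sub>R Y p) q = lie_derivative Q X f q *\<^sub>R Y q + f q *\<^sub>R nabla X Y q))"

definition symmetric_product ::
    "(('a \<Rightarrow> 'a) \<Rightarrow> ('a \<Rightarrow> 'a) \<Rightarrow> 'a \<Rightarrow> 'a) \<Rightarrow> ('a \<Rightarrow> 'a) \<Rightarrow> ('a \<Rightarrow> 'a) \<Rightarrow> 'a \<Rightarrow> 'a::euclidean_space" where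
  "symmetric_product nabla X Y q = nabla Y X q + nabla X Y q"

text \<open>Covariant derivative at time \<open>t\<close> of a field \<open>V\<close> along the curve \<open>c\<close>, obtained from its
  defining properties (additivity, product rule, and agreement with \<open>nabla\<close> for fields
  \<open>E \<circ> c\<close> along \<open>c\<close>): if \<open>V = (\<Sum>i<m. a i (E i \<circ> c))\<close> near \<open>t\<close>, then its
  covariant derivative at \<open>t\<close> is \<open>(\<Sum>i<m. a i' E i + a i (nabla c' (E i)))\<close>. This
  does not depend on the representation of \<open>V\<close>. The field \<open>X\<close> extends the velocity of \<open>c\<close>
  at time \<open>t\<close>; only its value at \<open>c t\<close> matters.\<close>

definition has_covariant_derivative ::
    "'a::euclidean_space set \<Rightarrow> (('a \<Rightarrow> 'a) \<Rightarrow> ('a \<Rightarrow> 'a) \<Rightarrow> 'a \<Rightarrow> 'a) \<Rightarrow>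
     (real \<Rightarrow> 'a) \<Rightarrow> (real \<Rightarrow> 'a) \<Rightarrow> 'a \<Rightarrow> real \<Rightarrow> bool" where
  "has_covariant_derivative Q nabla c V w t \<longleftrightarrow>
     (\<exists>X (m::nat) E a a'.
        vector_field Q X \<and> (c has_vector_derivative X (c t)) (at t) \<and>
        (\<forall>i<m. vector_field Q (E i)) \<and>
        (\<forall>i<m. (a i has_real_derivative a' i) (at t)) \<and>
        (\<forall>\<^sub>F s in nhds t. V s = (\<Sum>i<m. a i s *\<^sub>R E i (c s))) \<and>
        w = (\<Sum>i<m. a' i *\<^sub>R E i (c t) + a i t *\<^sub>R nabla X (E i) (c t)))"

section \<open>Solutions of differential equations on a set\<close>

definition absolutely_continuous_on_interval ::
    "real \<Rightarrow> real \<Rightarrow> (real \<Rightarrow> 'a::real_normed_vector) \<Rightarrow> bool" where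
  "absolutely_continuous_on_interval a b f \<longleftrightarrow>
     (\<forall>\<epsilon>>0. \<exists>\<delta>>0. \<forall>D S. D division_of S \<and> S \<subseteq> {a..b} \<and> (\<Sum>K\<in>D. Sup K - Inf K) < \<delta> \<longrightarrow>
        (\<Sum>K\<in>D. norm (f (Sup K) - f (Inf K))) < \<epsilon>)"

text \<open>\<open>P x t\<close> says that the curve \<open>x\<close> satisfies the equation at time \<open>t\<close>, and \<open>M\<close> is
  the state space. Solutions are defined on open intervals; the values of \<open>x\<close> outside
  the interval are irrelevant.\<close>

definition classical_solution ::
    "'s::euclidean_space set \<Rightarrow> ((real \<Rightarrow> 's) \<Rightarrow> real \<Rightarrow> bool) \<Rightarrow> real set \<Rightarrow> (real \<Rightarrow> 's) \<Rightarrow> bool" where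
  "classical_solution M P I x \<longleftrightarrow>
     open I \<and> is_interval I \<and> (\<forall>t\<in>I. x t \<in> M) \<and> (\<forall>t\<in>I. P x t)"

definition caratheodory_solution ::
    "'s::euclidean_space set \<Rightarrow> ((real \<Rightarrow> 's) \<Rightarrow> real \<Rightarrow> bool) \<Rightarrow> real set \<Rightarrow> (real \<Rightarrow> 's) \<Rightarrow> bool" where
  "caratheodory_solution M P I x \<longleftrightarrow>
     open I \<and> is_interval I \<and> (\<forall>t\<in>I. x t \<in> M) \<and>
     (\<forall>a b. {a..b} \<subseteq> I \<longrightarrow> absolutely_continuous_on_interval a b x) \<and>
     (AE t in lebesgue. t \<in> I \<longrightarrow> P x t)"

definition maximal_solution ::
    "(real set \<Rightarrow> (real \<Rightarrow> 's) \<Rightarrow> bool) \<Rightarrow> real \<Rightarrow> 's \<Rightarrow> real set \<Rightarrow> (real \<Rightarrow> 's) \<Rightarrow> bool" where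
  "maximal_solution sol t0 x0 I x \<longleftrightarrow>
     sol I x \<and> t0 \<in> I \<and> x t0 = x0 \<and>
     (\<forall>J y. sol J y \<and> I \<subseteq> J \<and> (\<forall>t\<in>I. y t = x t) \<longrightarrow> J = I)"

section \<open>The closed-loop and the averaged system\<close>

text \<open>\<open>U\<close> is the antiderivative of \<open>w\<close>, \<open>U' = w\<close> almost everywhere, with mean \<open>0\<close> over \<open>[0,T]\<close>.\<close>

definition zero_mean_antiderivative :: "real \<Rightarrow> (real \<Rightarrow> real) \<Rightarrow> (real \<Rightarrow> real) \<Rightarrow> bool" where
  "zero_mean_antiderivative T w U \<longleftrightarrow>
     (\<forall>s t. s \<le> t \<longrightarrow> (w has_integral (U t - U s)) {s..t}) \<and> (U has_integral 0) {0..T}"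

definition state_space :: "'a::euclidean_space set \<Rightarrow> (('a \<times> 'a) \<times> real) set" where
  "state_space Q = tangent_bundle Q \<times> UNIV"

text \<open>The curve \<open>x = ((q, v), \<eta>)\<close> satisfies at time \<open>t\<close> the first-order form of the second-order
  equation with right-hand side \<open>F\<close> together with the filter equation for \<open>\<eta>\<close>.\<close>

definition satisfies_system ::
    "'a::euclidean_space set \<Rightarrow> (('a \<Rightarrow> 'a) \<Rightarrow> ('a \<Rightarrow> 'a) \<Rightarrow> 'a \<Rightarrow> 'a) \<Rightarrow> ('a \<Rightarrow> real) \<Rightarrow> real \<Rightarrow>
     (real \<Rightarrow> ('a \<times> 'a) \<times> real \<Rightarrow> 'a) \<Rightarrow> (real \<Rightarrow> ('a \<times> 'a) \<times> real) \<Rightarrow> real \<Rightarrow> bool" where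
  "satisfies_system Q nabla \<psi> h F x t \<longleftrightarrow>
     (let q = \<lambda>s. fst (fst (x s)); v = \<lambda>s. snd (fst (x s)); \<eta> = \<lambda>s. snd (x s) in
        (q has_vector_derivative v t) (at t) \<and>
        has_covariant_derivative Q nabla q v (F t (x t)) t \<and>
        (\<eta> has_real_derivative (- h * \<eta> t + h * \<psi> (q t))) (at t))"

definition closed_loop_rhs ::
    "nat \<Rightarrow> (nat \<Rightarrow> 'a::euclidean_space \<Rightarrow> 'a) \<Rightarrow> ('a \<Rightarrow> 'a \<Rightarrow> 'a) \<Rightarrow> ('a \<Rightarrow> real) \<Rightarrow> (real \<Rightarrow> real) \<Rightarrow>
     (nat \<Rightarrow> real \<Rightarrow> real) \<Rightarrow> (nat \<Rightarrow> real) \<Rightarrow> (nat \<Rightarrow> real) \<Rightarrow> real \<Rightarrow>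
     real \<Rightarrow> ('a \<times> 'a) \<times> real \<Rightarrow> 'a" where
  "closed_loop_rhs n Y R \<psi> \<alpha> u lam mu \<omega> t = (\<lambda>((q, v), \<eta>).
     Y 0 q - R q v
     + (\<Sum>i=1..n. (mu i * (\<alpha> (\<psi> q - \<eta>))\<^sup>2) *\<^sub>R Y i q)
     + (\<Sum>i=1..n. (\<omega> * u i (\<omega> * t) * lam i * \<alpha> (\<psi> q - \<eta>)) *\<^sub>R Y i q))"

definition averaged_rhs ::
    "'a::euclidean_space set \<Rightarrow> (('a \<Rightarrow> 'a) \<Rightarrow> ('a \<Rightarrow> 'a) \<Rightarrow> 'a \<Rightarrow> 'a) \<Rightarrow>
     nat \<Rightarrow> (nat \<Rightarrow> 'a \<Rightarrow> 'a) \<Rightarrow> ('a \<Rightarrow> 'a \<Rightarrow> 'a) \<Rightarrow> ('a \<Rightarrow> real) \<Rightarrow> (real \<Rightarrow> real) \<Rightarrow>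
     (nat \<Rightarrow> real) \<Rightarrow> (nat \<Rightarrow> real) \<Rightarrow> ('a \<times> 'a) \<times> real \<Rightarrow> 'a" where
  "averaged_rhs Q nabla n Y R \<psi> \<alpha> lam mu = (\<lambda>((q, v), \<eta>).
     Y 0 q - R q v
     + (\<alpha> (\<psi> q - \<eta>))\<^sup>2 *\<^sub>R (\<Sum>i=1..n. mu i *\<^sub>R Y i q)
     - (1/2 * (\<alpha> (\<psi> q - \<eta>))\<^sup>2) *\<^sub>R (\<Sum>i=1..n. (lam i)\<^sup>2 *\<^sub>R symmetric_product nabla (Y i) (Y i) q)
     - (\<alpha> (\<psi> q - \<eta>) * deriv \<alpha> (\<psi> q - \<eta>)) *\<^sub>R
         (\<Sum>i=1..n. ((lam i)\<^sup>2 * lie_derivative Q (Y i) \<psi> q) *\<^sub>R Y i q))"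

definition closed_loop_solution where
  "closed_loop_solution Q nabla n Y R \<psi> \<alpha> u lam mu h \<omega> =
     caratheodory_solution (state_space Q)
       (satisfies_system Q nabla \<psi> h (closed_loop_rhs n Y R \<psi> \<alpha> u lam mu \<omega>))"

definition averaged_solution where
  "averaged_solution Q nabla n Y R \<psi> \<alpha> lam mu h =
     classical_solution (state_space Q)
       (satisfies_system Q nabla \<psi> h (\<lambda>t. averaged_rhs Q nabla n Y R \<psi> \<alpha> lam mu))"

definition change_of_variables ::
    "nat \<Rightarrow> (nat \<Rightarrow> 'a::euclidean_space \<Rightarrow> 'a) \<Rightarrow> ('a \<Rightarrow> real) \<Rightarrow> (real \<Rightarrow> real) \<Rightarrow>
     (nat \<Rightarrow> real \<Rightarrow> real) \<Rightarrow> (nat \<Rightarrow> real) \<Rightarrow> real \<Rightarrow> real \<Rightarrow>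
     ('a \<times> 'a) \<times> real \<Rightarrow> ('a \<times> 'a) \<times> real" where
  "change_of_variables n Y \<psi> \<alpha> U lam \<omega> t = (\<lambda>((q, v), \<eta>).
     ((q, v - (\<Sum>i=1..n. (U i (\<omega> * t) * lam i * \<alpha> (\<psi> q - \<eta>)) *\<^sub>R Y i q)), \<eta>))"

end

theory Submission
  imports Defs "HOL-Library.Periodic_Fun"
begin

text \<open>In the variables \<open>(q, p, \<eta>)\<close> with \<open>p = v - (\<Sum>i. U\<^sub>i(\<omega> t) \<lambda>\<^sub>i \<alpha>(\<psi>(q) - \<eta>) Y\<^sub>i(q))\<close>
  the measurable forcing of order \<open>\<omega>\<close> disappears: \<open>\<omega> u(\<omega> t)\<close> is the derivative
  of \<open>U(\<omega> t)\<close> and cancels, and the closed-loop system becomes a classical equation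
  \<open>z' = (\<Sum>i j. U\<^sub>i(\<omega> t) U\<^sub>j(\<omega> t) k\<^sub>i\<^sub>j(z))\<close> with \<open>U\<^sub>0 = 1\<close>. Zero mean and orthonormality of the \<open>U\<^sub>i\<close> make
  its average over a period \<open>(\<Sum>i. k\<^sub>i\<^sub>i(z))\<close>, which is the averaged system, and a near-identity transformation
  followed by Gronwall's inequality bounds the distance of the solutions by a multiple of \<open>1/\<omega>\<close> as long as they
  stay in a compact set.

  The connection is made computable by a global frame: the orthogonal projections \<open>E\<^sub>b(q)\<close> of the standard basis vectors
  onto \<open>T\<^sub>qQ\<close> span \<open>T\<^sub>qQ\<close>, and \<open>v = (\<Sum>b. (v \<bullet> b) E\<^sub>b(q))\<close> for tangent \<open>v\<close>, so that the covariant derivative of \<open>V\<close> along a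
  curve is \<open>V'\<close> corrected by a bilinear expression in the velocity and \<open>V\<close>. Solutions starting in the state space remain there because
  a local retraction onto it is compatible with the tangent right-hand side.\<close>

section \<open>Smooth maps\<close>

text \<open>The correction terms of the averaged system come from the state dependence of the shear:
  its derivative along the motion contains products of two signals, and the squares do not average
  out. The change of variables is a bijection between solutions of the two forms of the closed-loop
  system, so existence and maximality are carried across it, and the estimate is proved for every
  maximal solution. Measure theory enters in making this precise: \<open>u\<close> is the derivative
  of \<open>U\<close> only almost everywhere, and the integral equation of an absolutely continuous
  curve yields an equation valid at every time because the transformed right-hand side is
  continuous. The threshold must not depend on the initial time or point. All constants are
  therefore taken on a single compact set, the points of the state space within distance \<nu> of C.
  The error estimate holds only while the solution has not left this set; since it yields a bound
  strictly below \<nu>, the solution can neither leave nor cease to exist before \<Delta> has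
  elapsed.\<close>

lemma frechet_derivative_cong_open:
  assumes "open W" "x \<in> W" "\<And>y. y \<in> W \<Longrightarrow> f y = g y"
  shows "frechet_derivative f (at x) = frechet_derivative g (at x)"
proof -
  have "(f has_derivative D) (at x) \<longleftrightarrow> (g has_derivative D) (at x)" for D
    using assms has_derivative_transform_within_open[of _ D x UNIV W] by metis
  then show ?thesis
    unfolding frechet_derivative_def by presburger
qed

lemma C_k_on_cong:
  assumes "open W" "\<And>y. y \<in> W \<Longrightarrow> f y = g y" "C_k_on k W f"
  shows "C_k_on k W g"
  using assms(2,3)
proof (induction k arbitrary: f g)
  case 0
  then show ?case
    using continuous_on_cong by (metis C_k_on.simps(1))
next
  case (Suc k)
  have "g differentiable (at x)" if "x \<in> W" for x
  proof -
    have "f differentiable (at x)" using Suc.prems(2) that by simp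
    then obtain D where "(f has_derivative D) (at x)"
      unfolding differentiable_def by (elim exE)
    then have "(g has_derivative D) (at x)"
      using has_derivative_transform_within_open[OF _ \<open>open W\<close> that] Suc(2) by blast
    then show ?thesis by (auto simp: differentiable_def)
  qed
  moreover have "C_k_on k W (\<lambda>x. frechet_derivative g (at x) v)" for v
    using Suc.IH[of "\<lambda>x. frechet_derivative f (at x) v"] Suc.prems
      frechet_derivative_cong_open[OF \<open>open W\<close> _ Suc.prems(1)] by auto
  ultimately show ?case by simp
qed

lemma C_k_on_subset:
  assumes "C_k_on k W f" "V \<subseteq> W"
  shows "C_k_on k V f"
  using assms
  by (induction k arbitrary: f) (auto intro: continuous_on_subset)

lemma C_k_on_imp_continuous_on: "C_k_on k W f \<Longrightarrow> continuous_on W f"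
  by (cases k) (auto intro!: continuous_at_imp_continuous_on differentiable_imp_continuous_within)

lemma C_k_on_SucD: "C_k_on (Suc k) W f \<Longrightarrow> C_k_on k W f"
proof (induction k arbitrary: f)
  case 0
  then show ?case using C_k_on_imp_continuous_on by (metis C_k_on.simps(1))
next
  case (Suc k)
  then show ?case
    by (metis C_k_on.simps(2))
qed

text \<open>Derivatives depend on germs only, so a local representative may first be replaced by
  \<open>f\<close> itself on a smaller open set and then differentiated; the induction is on the
  order. This is what identifies \<open>smooth_on\<close> with ordinary smoothness on an open
  set.\<close>

lemma C_k_on_local:
  assumes "open W" "\<And>p. p \<in> W \<Longrightarrow> \<exists>V g. open V \<and> p \<in> V \<and> C_k_on k V g \<and> (\<forall>x\<in>V \<inter> W. g x = f x)"
  shows "C_k_on k W f"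
  using assms(2)
proof (induction k arbitrary: f)
  case 0
  have "isCont f p" if "p \<in> W" for p
  proof -
    obtain V g where V: "open V" "p \<in> V" "continuous_on V g" "\<forall>x\<in>V \<inter> W. g x = f x"
      using 0[OF \<open>p \<in> W\<close>] by auto
    then have "continuous_on (V \<inter> W) f"
      by (metis continuous_on_cong continuous_on_subset inf_le1)
    then show ?thesis
      using V \<open>open W\<close> that by (simp add: continuous_on_eq_continuous_at open_Int)
  qed
  then show ?case by (simp add: continuous_at_imp_continuous_on)
next
  case (Suc k)
  have *: "\<exists>V g. open V \<and> V \<subseteq> W \<and> p \<in> V \<and> C_k_on (Suc k) V g \<and> (\<forall>x\<in>V. g x = f x)" if "p \<in> W" for p
  proof -
    obtain V g where V: "open V" "p \<in> V" "C_k_on (Suc k) V g" "\<forall>x\<in>V \<inter> W. g x = f x"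
      using Suc.prems[OF \<open>p \<in> W\<close>] by auto
    then show ?thesis
      using C_k_on_subset[OF V(3), of "V \<inter> W"] \<open>open W\<close> that
      by (intro exI[of _ "V \<inter> W"] exI[of _ g]) (auto simp del: C_k_on.simps)
  qed
  have f: "\<exists>V. open V \<and> V \<subseteq> W \<and> p \<in> V \<and> C_k_on (Suc k) V f" if "p \<in> W" for p
    using *[OF that] C_k_on_cong by blast
  show ?case
  proof (simp, intro conjI allI ballI)
    fix p assume "p \<in> W"
    then show "f differentiable (at p)" using f by auto
  next
    fix v
    show "C_k_on k W (\<lambda>x. frechet_derivative f (at x) v)"
      by (rule Suc.IH) (metis (no_types, lifting) f C_k_on.simps(2))
  qed
qed

lemma C_k_on_const: "C_k_on k W (\<lambda>x. c)"
  by (induction k arbitrary: c) auto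

text \<open>Any explicit formula for the derivative will do, since at an interior point the value
  chosen by \<open>frechet_derivative\<close> is forced.\<close>

lemma C_k_on_SucI:
  assumes "open W" "\<And>x. x \<in> W \<Longrightarrow> (f has_derivative D x) (at x)" "\<And>v. C_k_on k W (\<lambda>x. D x v)"
  shows "C_k_on (Suc k) W f"
proof (simp, intro conjI ballI allI)
  fix x assume "x \<in> W"
  then show "f differentiable (at x)" using assms(2) by (auto simp: differentiable_def)
next
  fix v
  have "frechet_derivative f (at x) v = D x v" if "x \<in> W" for x
    using frechet_derivative_at[OF assms(2)[OF that]] by simp
  then show "C_k_on k W (\<lambda>x. frechet_derivative f (at x) v)"
    using C_k_on_cong[OF \<open>open W\<close> _ assms(3)[of v]] by simp
qed

lemma C_k_on_Suc_derivative:
  assumes "C_k_on (Suc k) W f" "x \<in> W"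
  shows "(f has_derivative frechet_derivative f (at x)) (at x)"
  using assms by (auto simp: frechet_derivative_works[symmetric])

lemma C_k_on_bounded_linear: "open W \<Longrightarrow> bounded_linear f \<Longrightarrow> C_k_on k W f"
proof (cases k)
  case 0
  assume "bounded_linear f"
  then show ?thesis using 0 by (simp add: linear_continuous_on)
next
  case (Suc l)
  assume "open W" "bounded_linear f"
  then show ?thesis unfolding Suc
    by (intro C_k_on_SucI[where D="\<lambda>x. f"] C_k_on_const) (auto intro: bounded_linear_imp_has_derivative)
qed

lemma C_k_on_add:
  assumes "open W" "C_k_on k W f" "C_k_on k W g"
  shows "C_k_on k W (\<lambda>x. f x + g x)"
  using assms(2,3)
proof (induction k arbitrary: f g)
  case 0 then show ?case by (auto intro: continuous_on_add)
next
  case (Suc k)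
  show ?case
    by (rule C_k_on_SucI[OF \<open>open W\<close>, where D="\<lambda>x v. frechet_derivative f (at x) v + frechet_derivative g (at x) v"])
      (use Suc in \<open>auto intro!: has_derivative_add simp: frechet_derivative_works[symmetric]\<close>)
qed

text \<open>Leibniz rule: both summands of the derivative are again products of maps of order
  \<open>k\<close>. Scalings, inner products and real products are all instances.\<close>

lemma (in bounded_bilinear) C_k_on:
  assumes "open W" "C_k_on k W f" "C_k_on k W g"
  shows "C_k_on k W (\<lambda>x. prod (f x) (g x))"
  using assms(2,3)
proof (induction k arbitrary: f g)
  case 0 then show ?case by (auto intro: continuous_on)
next
  case (Suc k)
  have fg: "C_k_on k W f" "C_k_on k W g" using Suc C_k_on_SucD by blast+
  show ?case
    by (rule C_k_on_SucI[OF \<open>open W\<close>, where D="\<lambda>x v. prod (f x) (frechet_derivative g (at x) v) + prod (frechet_derivative f (at x) v) (g x)"])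
      (use Suc fg in \<open>auto intro!: FDERIV C_k_on_add \<open>open W\<close> simp: frechet_derivative_works[symmetric]\<close>)
qed

lemma C_k_on_sum:
  assumes "open W" "\<And>i. i \<in> I \<Longrightarrow> C_k_on k W (f i)"
  shows "C_k_on k W (\<lambda>x. \<Sum>i\<in>I. f i x)"
  using assms(2)
proof (induction I rule: infinite_finite_induct)
  case (insert a F)
  then show ?case by (simp add: C_k_on_add[OF \<open>open W\<close>])
qed (auto simp: C_k_on_const)

text \<open>Directional derivatives are controlled for fixed directions only. This expansion reduces
  a derivative in a moving direction to finitely many fixed ones.\<close>

lemma linear_Basis_expansion:
  fixes f :: "'a::euclidean_space \<Rightarrow> 'b::real_vector"
  assumes "linear f"
  shows "f v = (\<Sum>b\<in>Basis. (v \<bullet> b) *\<^sub>R f b)"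
  by (subst euclidean_representation[symmetric, of v])
    (simp add: linear_sum[OF assms] linear_scale[OF assms] del: euclidean_representation)

text \<open>The chain rule differentiates \<open>f\<close> in the moving direction given by the
  derivative of \<open>g\<close>. Expanding that direction in the basis of the middle space leaves
  coefficients that depend on \<open>g\<close>, and compositions of fixed directional derivatives of
  \<open>f\<close>, to which the induction hypothesis applies.\<close>

lemma C_k_on_compose:
  fixes f :: "'b::euclidean_space \<Rightarrow> 'c::real_normed_vector" and g :: "'a::real_normed_vector \<Rightarrow> 'b"
  assumes "open W" "open V" "C_k_on k V f" "C_k_on k W g" "g ` W \<subseteq> V"
  shows "C_k_on k W (\<lambda>x. f (g x))"
  using assms(3,4)
proof (induction k arbitrary: f)
  case 0
  then show ?case using assms(5) by (auto intro: continuous_on_compose2)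
next
  case (Suc k)
  let ?D = "\<lambda>x v. \<Sum>b\<in>Basis. (frechet_derivative g (at x) v \<bullet> b) *\<^sub>R frechet_derivative f (at (g x)) b"
  show ?case
  proof (rule C_k_on_SucI[OF \<open>open W\<close>, where D = ?D])
    fix x assume x: "x \<in> W"
    then have gx: "g x \<in> V" using assms(5) by auto
    have "((f \<circ> g) has_derivative (frechet_derivative f (at (g x)) \<circ> frechet_derivative g (at x))) (at x)"
      using C_k_on_Suc_derivative[OF Suc.prems(2) x] C_k_on_Suc_derivative[OF Suc.prems(1) gx]
      by (rule diff_chain_at)
    moreover have "frechet_derivative f (at (g x)) (frechet_derivative g (at x) v) = ?D x v" for v
      by (rule linear_Basis_expansion[OF has_derivative_linear[OF C_k_on_Suc_derivative[OF Suc.prems(1) gx]]])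
    ultimately show "((\<lambda>x. f (g x)) has_derivative ?D x) (at x)"
      by (simp add: o_def)
  next
    fix v
    show "C_k_on k W (\<lambda>x. ?D x v)"
    proof (rule C_k_on_sum[OF \<open>open W\<close>], rule bounded_bilinear.C_k_on[OF bounded_bilinear_scaleR \<open>open W\<close>])
      fix b :: 'b assume "b \<in> Basis"
      show "C_k_on k W (\<lambda>x. frechet_derivative g (at x) v \<bullet> b)"
        using Suc.prems(2) by (intro bounded_bilinear.C_k_on[OF bounded_bilinear_inner \<open>open W\<close>] C_k_on_const) auto
      show "C_k_on k W (\<lambda>x. frechet_derivative f (at (g x)) b)"
        using Suc C_k_on_SucD[OF Suc.prems(2)] by auto
    qed
  qed
qed

lemma C_k_on_Pair:
  assumes "open W" "C_k_on k W f" "C_k_on k W g"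
  shows "C_k_on k W (\<lambda>x. (f x, g x))"
  using assms(2,3)
proof (induction k arbitrary: f g)
  case 0 then show ?case by (auto intro: continuous_on_Pair)
next
  case (Suc k)
  show ?case
    by (rule C_k_on_SucI[OF \<open>open W\<close>, where D="\<lambda>x v. (frechet_derivative f (at x) v, frechet_derivative g (at x) v)"])
      (use Suc in \<open>auto intro!: has_derivative_Pair simp: frechet_derivative_works[symmetric]\<close>)
qed

lemma C_k_on_inverse:
  fixes f :: "'a::real_normed_vector \<Rightarrow> real"
  assumes "open W" "C_k_on k W f" "\<And>x. x \<in> W \<Longrightarrow> f x \<noteq> 0"
  shows "C_k_on k W (\<lambda>x. inverse (f x))"
  using assms(2)
proof (induction k)
  case 0 then show ?case using assms(3) by (auto intro!: continuous_intros)
next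
  case (Suc k)
  note k = Suc.IH[OF C_k_on_SucD[OF Suc.prems]]
  show ?case
  \<comment> \<open>The derivative is written with \<open>inverse (f x)\<close> itself, so that the
    induction hypothesis at the lower order covers both of these factors.\<close>
  proof (rule C_k_on_SucI[OF \<open>open W\<close>, where D="\<lambda>x v. (- 1) * (inverse (f x) * frechet_derivative f (at x) v * inverse (f x))"])
    fix x assume "x \<in> W"
    then show "((\<lambda>x. inverse (f x)) has_derivative (\<lambda>v. (- 1) * (inverse (f x) * frechet_derivative f (at x) v * inverse (f x)))) (at x)"
      using Deriv.has_derivative_inverse[OF assms(3) C_k_on_Suc_derivative[OF Suc.prems]] by simp
  next
    fix v
    show "C_k_on k W (\<lambda>x. (- 1) * (inverse (f x) * frechet_derivative f (at x) v * inverse (f x)))"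
      using Suc.prems by (intro bounded_bilinear.C_k_on[OF bounded_bilinear_mult \<open>open W\<close>] k C_k_on_const) auto
  qed
qed

section \<open>Smooth maps on arbitrary sets, through local extensions\<close>

definition C_inf_on :: "'a::real_normed_vector set \<Rightarrow> ('a \<Rightarrow> 'b::real_normed_vector) \<Rightarrow> bool" where
  "C_inf_on W f \<longleftrightarrow> (\<forall>k. C_k_on k W f)"

lemma C_inf_on_derivative:
  assumes "C_inf_on W f" "x \<in> W"
  shows "(f has_derivative frechet_derivative f (at x)) (at x)"
  using assms C_k_on_Suc_derivative unfolding C_inf_on_def by blast

lemma C_inf_on_directional:
  assumes "C_inf_on W f"
  shows "C_inf_on W (\<lambda>x. frechet_derivative f (at x) v)"
  using assms unfolding C_inf_on_def by (metis C_k_on.simps(2))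

lemma C_inf_on_continuous: "C_inf_on W f \<Longrightarrow> continuous_on W f"
  unfolding C_inf_on_def using C_k_on_imp_continuous_on by blast

lemma smooth_on_open_iff: "open W \<Longrightarrow> smooth_on W f \<longleftrightarrow> C_inf_on W f"
proof
  assume "open W" "smooth_on W f"
  show "C_inf_on W f"
    unfolding C_inf_on_def
  proof (intro allI C_k_on_local[OF \<open>open W\<close>])
    fix k p assume "p \<in> W"
    then obtain V g where "open V" "p \<in> V" "\<forall>k. C_k_on k V g" "\<forall>x\<in>W \<inter> V. g x = f x"
      using \<open>smooth_on W f\<close> unfolding smooth_on_def by blast
    then show "\<exists>V g. open V \<and> p \<in> V \<and> C_k_on k V g \<and> (\<forall>x\<in>V \<inter> W. g x = f x)"
      by blast
  qed
next
  assume "open W" "C_inf_on W f"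
  then show "smooth_on W f"
    unfolding smooth_on_def C_inf_on_def by blast
qed

lemma smooth_onI:
  assumes "\<And>p. p \<in> A \<Longrightarrow> \<exists>W g. open W \<and> p \<in> W \<and> C_inf_on W g \<and> (\<forall>x\<in>A \<inter> W. g x = f x)"
  shows "smooth_on A f"
  using assms unfolding smooth_on_def C_inf_on_def by blast

lemma smooth_onE:
  assumes "smooth_on A f" "p \<in> A"
  obtains W g where "open W" "p \<in> W" "C_inf_on W g" "\<And>x. x \<in> A \<Longrightarrow> x \<in> W \<Longrightarrow> g x = f x"
proof -
  have "\<exists>W g. open W \<and> p \<in> W \<and> C_inf_on W g \<and> (\<forall>x\<in>A \<inter> W. g x = f x)"
    using assms(1)[unfolded smooth_on_def, THEN bspec, OF assms(2)] by (simp only: C_inf_on_def)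
  then obtain W g where "open W" "p \<in> W" "C_inf_on W g" "\<forall>x\<in>A \<inter> W. g x = f x"
    by (elim exE conjE)
  then show ?thesis by (intro that[of W g]) auto
qed

lemma C_inf_on_imp_smooth_on: "open W \<Longrightarrow> C_inf_on W f \<Longrightarrow> smooth_on W f"
  by (simp add: smooth_on_open_iff)

lemma smooth_on_subset:
  assumes "smooth_on A f" "B \<subseteq> A"
  shows "smooth_on B f"
proof (rule smooth_onI)
  fix p assume "p \<in> B"
  then have "p \<in> A" using assms(2) by auto
  then obtain W g where "open W" "p \<in> W" "C_inf_on W g" "\<And>x. x \<in> A \<Longrightarrow> x \<in> W \<Longrightarrow> g x = f x"
    using smooth_onE[OF assms(1)] by metis
  then show "\<exists>W g. open W \<and> p \<in> W \<and> C_inf_on W g \<and> (\<forall>x\<in>B \<inter> W. g x = f x)"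
    using assms(2) by (intro exI[of _ W] exI[of _ g]) auto
qed

lemma smooth_on_cong: "smooth_on A f \<Longrightarrow> (\<And>x. x \<in> A \<Longrightarrow> f x = g x) \<Longrightarrow> smooth_on A g"
  unfolding smooth_on_def by (metis IntD1)

lemma smooth_on_const: "smooth_on A (\<lambda>x. c)"
  by (rule smooth_on_subset[OF C_inf_on_imp_smooth_on[OF open_UNIV] subset_UNIV])
    (simp add: C_inf_on_def C_k_on_const)

lemma smooth_on_bounded_linear: "bounded_linear f \<Longrightarrow> smooth_on A f"
  by (rule smooth_on_subset[OF C_inf_on_imp_smooth_on[OF open_UNIV] subset_UNIV])
    (simp add: C_inf_on_def C_k_on_bounded_linear)

lemma smooth_on_compose:
  assumes "smooth_on B f" "smooth_on A g" "g ` A \<subseteq> B"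
  shows "smooth_on A (\<lambda>x. f (g x))"
proof (rule smooth_onI)
  fix p assume p: "p \<in> A"
  obtain W g' where W: "open W" "p \<in> W" "C_inf_on W g'" "\<And>x. x \<in> A \<Longrightarrow> x \<in> W \<Longrightarrow> g' x = g x"
    using smooth_onE[OF assms(2) p] by blast
  obtain V f' where V: "open V" "g p \<in> V" "C_inf_on V f'" "\<And>x. x \<in> B \<Longrightarrow> x \<in> V \<Longrightarrow> f' x = f x"
    using smooth_onE[OF assms(1), of "g p"] p assms(3) by blast
  \<comment> \<open>Away from \<open>A\<close> the extension \<open>g'\<close> may leave
    \<open>V\<close>; the extensions are composed on the open preimage.\<close>
  let ?W = "W \<inter> g' -` V"
  have op: "open ?W"
    using C_inf_on_continuous[OF W(3)] W(1) V(1) continuous_open_preimage by blast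
  show "\<exists>W h. open W \<and> p \<in> W \<and> C_inf_on W h \<and> (\<forall>x\<in>A \<inter> W. h x = f (g x))"
  proof (intro exI conjI)
    show "C_inf_on ?W (\<lambda>x. f' (g' x))"
      unfolding C_inf_on_def
    proof
      fix k
      show "C_k_on k ?W (\<lambda>x. f' (g' x))"
        using C_k_on_compose[OF op V(1), of k f' g'] V(3) W(3) C_k_on_subset[of k W g' ?W]
        unfolding C_inf_on_def by blast
    qed
  qed (use op W V p assms(3) in auto)
qed

lemma smooth_on_Pair:
  assumes "smooth_on A f" "smooth_on A g"
  shows "smooth_on A (\<lambda>x. (f x, g x))"
proof (rule smooth_onI)
  fix p assume p: "p \<in> A"
  obtain W g' where W: "open W" "p \<in> W" "C_inf_on W g'" "\<And>x. x \<in> A \<Longrightarrow> x \<in> W \<Longrightarrow> g' x = g x"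
    using smooth_onE[OF assms(2) p] by blast
  obtain V f' where V: "open V" "p \<in> V" "C_inf_on V f'" "\<And>x. x \<in> A \<Longrightarrow> x \<in> V \<Longrightarrow> f' x = f x"
    using smooth_onE[OF assms(1) p] by blast
  show "\<exists>W h. open W \<and> p \<in> W \<and> C_inf_on W h \<and> (\<forall>x\<in>A \<inter> W. h x = (f x, g x))"
  proof (intro exI conjI)
    show "C_inf_on (W \<inter> V) (\<lambda>x. (f' x, g' x))"
      unfolding C_inf_on_def
    proof
      fix k
      have "C_k_on k (W \<inter> V) f'" "C_k_on k (W \<inter> V) g'"
        using V(3) W(3) C_k_on_subset[of k W g' "W \<inter> V"] C_k_on_subset[of k V f' "W \<inter> V"]
        unfolding C_inf_on_def by auto
      then show "C_k_on k (W \<inter> V) (\<lambda>x. (f' x, g' x))"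
        using W(1) V(1) by (intro C_k_on_Pair) auto
    qed
  qed (use W V in auto)
qed

lemma smooth_on_bilinear:
  fixes prod :: "'b::euclidean_space \<Rightarrow> 'c::euclidean_space \<Rightarrow> 'd::euclidean_space"
  assumes "bounded_bilinear prod" "smooth_on A f" "smooth_on A g"
  shows "smooth_on A (\<lambda>x. prod (f x) (g x))"
proof -
  have "smooth_on UNIV (\<lambda>x. prod (fst x) (snd x))"
    unfolding smooth_on_open_iff[OF open_UNIV] C_inf_on_def
    by (intro allI bounded_bilinear.C_k_on[OF assms(1) open_UNIV]
        C_k_on_bounded_linear[OF open_UNIV bounded_linear_fst] C_k_on_bounded_linear[OF open_UNIV bounded_linear_snd])
  from smooth_on_compose[OF this smooth_on_Pair[OF assms(2,3)]] show ?thesis by simp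
qed

lemmas smooth_on_scaleR = smooth_on_bilinear[OF bounded_bilinear_scaleR]
lemmas smooth_on_inner = smooth_on_bilinear[OF bounded_bilinear_inner]

lemma smooth_on_mult:
  fixes f g :: "'a::euclidean_space \<Rightarrow> real"
  shows "smooth_on A f \<Longrightarrow> smooth_on A g \<Longrightarrow> smooth_on A (\<lambda>x. f x * g x)"
  by (rule smooth_on_bilinear[OF bounded_bilinear_mult])

lemma smooth_on_compose_linear: "bounded_linear f \<Longrightarrow> smooth_on A g \<Longrightarrow> smooth_on A (\<lambda>x. f (g x))"
  by (rule smooth_on_compose[OF smooth_on_bounded_linear[of f UNIV]]) auto

lemma smooth_on_add: "smooth_on A f \<Longrightarrow> smooth_on A g \<Longrightarrow> smooth_on A (\<lambda>x. f x + g x)"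
  using smooth_on_compose_linear[OF _ smooth_on_Pair, of "\<lambda>x. fst x + snd x" A f g]
  by (simp add: bounded_linear_add bounded_linear_fst bounded_linear_snd)

lemma smooth_on_minus: "smooth_on A f \<Longrightarrow> smooth_on A (\<lambda>x. - f x)"
  using smooth_on_compose_linear[of uminus] by (simp add: bounded_linear_minus)

lemma smooth_on_diff: "smooth_on A f \<Longrightarrow> smooth_on A g \<Longrightarrow> smooth_on A (\<lambda>x. f x - g x)"
  using smooth_on_add[OF _ smooth_on_minus, of A f g] by simp

lemma smooth_on_sum: "(\<And>i. i \<in> I \<Longrightarrow> smooth_on A (f i)) \<Longrightarrow> smooth_on A (\<lambda>x. \<Sum>i\<in>I. f i x)"
  by (induction I rule: infinite_finite_induct) (auto intro: smooth_on_add smooth_on_const)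

lemma smooth_on_fst: "smooth_on A f \<Longrightarrow> smooth_on A (\<lambda>x. fst (f x))"
  using smooth_on_compose_linear[OF bounded_linear_fst] .

lemma smooth_on_snd: "smooth_on A f \<Longrightarrow> smooth_on A (\<lambda>x. snd (f x))"
  using smooth_on_compose_linear[OF bounded_linear_snd] .

lemma smooth_on_id: "smooth_on A (\<lambda>x. x)"
  by (rule smooth_on_bounded_linear) simp

lemma smooth_on_if: "smooth_on A f \<Longrightarrow> smooth_on A g \<Longrightarrow> smooth_on A (\<lambda>x. if c then f x else g x)"
  by (cases c) simp_all

named_theorems smooth_intros
lemmas [smooth_intros] = smooth_on_const smooth_on_id smooth_on_Pair smooth_on_scaleR smooth_on_inner
  smooth_on_mult smooth_on_add smooth_on_minus smooth_on_diff smooth_on_sum smooth_on_fst smooth_on_snd smooth_on_if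

section \<open>Continuity, derivatives within a set, and Lipschitz bounds\<close>

lemma smooth_on_continuous: assumes "smooth_on A f" shows "continuous_on A f"
  unfolding continuous_on_eq_continuous_within
proof
  fix p assume p: "p \<in> A"
  obtain W g where W: "open W" "p \<in> W" "C_inf_on W g" "\<And>x. x \<in> A \<Longrightarrow> x \<in> W \<Longrightarrow> g x = f x"
    using smooth_onE[OF assms p] by blast
  have "continuous_on (A \<inter> W) f"
    using continuous_on_subset[OF C_inf_on_continuous[OF W(3)], of "A \<inter> W"] W(4)
    by (metis (no_types, lifting) IntD1 IntD2 continuous_on_cong inf_le2)
  then have "continuous (at p within A \<inter> W) f"
    using p W(2) continuous_on_eq_continuous_within by blast
  then show "continuous (at p within A) f"
    using W(1,2) by (metis Int_assoc Int_absorb at_within_nhd continuous_within)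
qed

text \<open>A derivative within a thin set need not be unique, so \<open>frechet_derivative\<close>
  makes an arbitrary choice. The derivative of a local extension shows that there is something to
  choose, hence the choice is a derivative.\<close>

lemma smooth_on_derivative_within:
  assumes "smooth_on A f" "p \<in> A"
  shows "(f has_derivative frechet_derivative f (at p within A)) (at p within A)"
proof -
  obtain W g where W: "open W" "p \<in> W" "C_inf_on W g" "\<And>x. x \<in> A \<Longrightarrow> x \<in> W \<Longrightarrow> g x = f x"
    using smooth_onE[OF assms] by blast
  have g: "(g has_derivative frechet_derivative g (at p)) (at p within A)"
    using C_inf_on_derivative[OF W(3,2)] has_derivative_at_withinI by blast
  obtain d where d: "d > 0" "ball p d \<subseteq> W" using W(1,2) openE by blast
  have "(f has_derivative frechet_derivative g (at p)) (at p within A)"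
    by (rule has_derivative_transform_within[OF g d(1) assms(2)])
      (use d(2) W(4) in \<open>auto simp: dist_commute subset_iff\<close>)
  then show ?thesis
    using frechet_derivative_works differentiable_def by blast
qed

text \<open>Mean value inequality for a smooth extension on a ball around \<open>p\<close>: the ball
  is convex even though \<open>A\<close> may not be. The operator norm of the derivative is bounded
  by the sum of the bounds in the basis directions.\<close>

lemma smooth_on_locally_lipschitz:
  assumes "smooth_on A f" "p \<in> A"
  shows "\<exists>d>0. \<exists>L\<ge>0. \<forall>x\<in>A \<inter> ball p d. \<forall>y\<in>A \<inter> ball p d. norm (f x - f y) \<le> L * norm (x - y)"
proof -
  obtain W g where W: "open W" "p \<in> W" "C_inf_on W g" "\<And>x. x \<in> A \<Longrightarrow> x \<in> W \<Longrightarrow> g x = f x"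
    using smooth_onE[OF assms] by blast
  obtain d where d: "d > 0" "cball p d \<subseteq> W" using W(1,2) open_contains_cball by blast
  have "\<exists>C\<ge>0. \<forall>x\<in>cball p d. norm (frechet_derivative g (at x) b) \<le> C" for b
  proof -
    have "compact ((\<lambda>x. frechet_derivative g (at x) b) ` cball p d)"
      using C_inf_on_continuous[OF C_inf_on_directional[OF W(3)]] d(2)
      by (intro compact_continuous_image) (auto intro: continuous_on_subset)
    then have "bounded ((\<lambda>x. frechet_derivative g (at x) b) ` cball p d)"
      by (rule compact_imp_bounded)
    then obtain C where "C > 0" "\<And>y. y \<in> (\<lambda>x. frechet_derivative g (at x) b) ` cball p d \<Longrightarrow> norm y \<le> C"
      unfolding bounded_pos by metis
    then show ?thesis
      by (intro exI[of _ C] conjI ballI) (simp, blast)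
  qed
  then obtain C where C: "\<And>b. C b \<ge> 0" "\<And>b x. x \<in> cball p d \<Longrightarrow> norm (frechet_derivative g (at x) b) \<le> C b"
    by metis
  define L where "L = (\<Sum>b\<in>Basis. C b)"
  have L: "onorm (frechet_derivative g (at x)) \<le> L" if x: "x \<in> cball p d" for x
  proof (rule onorm_bound)
    show "0 \<le> L" unfolding L_def by (simp add: C sum_nonneg)
    fix v
    have "linear (frechet_derivative g (at x))"
      using C_inf_on_derivative[OF W(3)] x d has_derivative_linear by blast
    then have "frechet_derivative g (at x) v = (\<Sum>b\<in>Basis. (v \<bullet> b) *\<^sub>R frechet_derivative g (at x) b)"
      by (rule linear_Basis_expansion)
    also have "norm \<dots> \<le> (\<Sum>b\<in>Basis. norm v * C b)"
      using C x by (intro sum_norm_le) (auto intro!: mult_mono simp: Basis_le_norm)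
    finally show "norm (frechet_derivative g (at x) v) \<le> L * norm v"
      by (simp add: L_def sum_distrib_left mult.commute)
  qed
  have "norm (g x - g y) \<le> L * norm (x - y)" if xy: "x \<in> ball p d" "y \<in> ball p d" for x y
  proof (rule differentiable_bound[of "ball p d" g "\<lambda>x. frechet_derivative g (at x)"])
    fix z assume "z \<in> ball p d"
    then have "z \<in> cball p d" "z \<in> W" using d by auto
    then show "(g has_derivative frechet_derivative g (at z)) (at z within ball p d)"
      "onorm (frechet_derivative g (at z)) \<le> L"
      using L C_inf_on_derivative[OF W(3)] has_derivative_at_withinI by blast+
  qed (use xy in auto)
  moreover have "L \<ge> 0" unfolding L_def by (simp add: C sum_nonneg)
  moreover have "g x = f x" if "x \<in> A \<inter> ball p d" for x
    using that d(2) ball_subset_cball[of p d] by (intro W(4)) auto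
  ultimately show ?thesis
    using d(1) by (intro exI[of _ d] conjI exI[of _ L] ballI) (simp, simp, metis IntD2)
qed

text \<open>Pairs closer than a Lebesgue number \<open>e\<close> of the cover lie in one ball and
  use its local constant. For the remaining pairs a bound on distances in the image, divided by
  \<open>e\<close>, is a Lipschitz constant. This replaces convexity, which a piece of a submanifold
  lacks.\<close>

lemma compact_locally_lipschitz:
  fixes f :: "'a::metric_space \<Rightarrow> 'b::metric_space"
  assumes "compact K" "continuous_on K f"
    and "\<And>p. p \<in> K \<Longrightarrow> \<exists>d>0. \<exists>L\<ge>0. \<forall>x\<in>K \<inter> ball p d. \<forall>y\<in>K \<inter> ball p d. dist (f x) (f y) \<le> L * dist x y"
  shows "\<exists>L\<ge>0. \<forall>x\<in>K. \<forall>y\<in>K. dist (f x) (f y) \<le> L * dist x y"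
proof -
  obtain d L where dL: "\<And>p. p \<in> K \<Longrightarrow> d p > 0" "\<And>p. p \<in> K \<Longrightarrow> L p \<ge> 0"
    "\<And>p x y. p \<in> K \<Longrightarrow> x \<in> K \<inter> ball p (d p) \<Longrightarrow> y \<in> K \<inter> ball p (d p) \<Longrightarrow> dist (f x) (f y) \<le> L p * dist x y"
    using assms(3) by metis
  have "K \<subseteq> (\<Union>p\<in>K. ball p (d p))" using dL(1) by force
  then obtain F where F: "F \<subseteq> K" "finite F" "K \<subseteq> (\<Union>p\<in>F. ball p (d p))"
    by (rule compactE_image[OF assms(1), rotated]) auto
  obtain M where M: "\<And>x y. x \<in> K \<Longrightarrow> y \<in> K \<Longrightarrow> dist (f x) (f y) \<le> M"
  proof -
    have "bounded (f ` K)"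
      using assms compact_continuous_image compact_imp_bounded by blast
    then obtain M where "\<forall>y\<in>f ` K. \<forall>z\<in>f ` K. dist y z \<le> M"
      unfolding bounded_two_points by (elim exE)
    then show ?thesis
      by (intro that[of M]) blast
  qed
  have "K \<subseteq> \<Union>((\<lambda>p. ball p (d p)) ` F)" using F by auto
  then obtain e where e: "e > 0" "\<And>x. x \<in> K \<Longrightarrow> \<exists>G\<in>(\<lambda>p. ball p (d p)) ` F. ball x e \<subseteq> G"
    by (rule Heine_Borel_lemma[OF assms(1)]) auto
  define L' where "L' = (\<Sum>p\<in>F. L p) + \<bar>M\<bar> / e"
  have s: "(\<Sum>p\<in>F. L p) \<ge> 0" using F dL(2) by (auto intro: sum_nonneg)
  have "dist (f x) (f y) \<le> L' * dist x y" if xy: "x \<in> K" "y \<in> K" for x y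
  proof (cases "dist x y < e")
    case True
    obtain p where p: "p \<in> F" "ball x e \<subseteq> ball p (d p)" using e(2)[OF xy(1)] by auto
    have "x \<in> ball p (d p)" "y \<in> ball p (d p)" using p e(1) True by (auto simp: subset_iff)
    then have "dist (f x) (f y) \<le> L p * dist x y" using dL(3) p F xy by blast
    moreover have "L p \<le> (\<Sum>p\<in>F. L p)" using p F dL(2) by (intro member_le_sum) auto
    moreover have "\<bar>M\<bar> / e \<ge> 0" using e by simp
    ultimately show ?thesis unfolding L'_def
      by (smt (verit) mult_right_mono zero_le_dist)
  next
    case False
    have "dist (f x) (f y) \<le> \<bar>M\<bar> / e * e" using M[OF xy] e by simp
    also have "\<dots> \<le> \<bar>M\<bar> / e * dist x y" using False e by (intro mult_left_mono) auto
    also have "\<dots> \<le> L' * dist x y" unfolding L'_def using s by (intro mult_right_mono) auto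
    finally show ?thesis .
  qed
  moreover have "L' \<ge> 0" unfolding L'_def using s e by auto
  ultimately show ?thesis by blast
qed

lemma smooth_on_compact_lipschitz:
  assumes "smooth_on A f" "compact K" "K \<subseteq> A"
  shows "\<exists>L\<ge>0. \<forall>x\<in>K. \<forall>y\<in>K. norm (f x - f y) \<le> L * norm (x - y)"
proof -
  have "\<exists>L\<ge>0. \<forall>x\<in>K. \<forall>y\<in>K. dist (f x) (f y) \<le> L * dist x y"
    using assms smooth_on_locally_lipschitz[OF smooth_on_subset[OF assms(1,3)]]
    by (intro compact_locally_lipschitz smooth_on_continuous smooth_on_subset[OF assms(1,3)]) (auto simp: dist_norm)
  then show ?thesis by (simp add: dist_norm)
qed

lemma smooth_on_compact_bounded:
  assumes "smooth_on A f" "compact K" "K \<subseteq> A"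
  shows "\<exists>B\<ge>0. \<forall>x\<in>K. norm (f x) \<le> B"
proof -
  have "bounded (f ` K)"
    using assms by (intro compact_imp_bounded compact_continuous_image smooth_on_continuous smooth_on_subset[OF assms(1)])
  then show ?thesis
    unfolding bounded_iff by (metis abs_ge_zero abs_ge_self image_eqI order_trans)
qed

text \<open>The curve maps an open set of times into \<open>A\<close>, so the derivative within
  \<open>A\<close> suffices for the chain rule. Since the derivative of a curve is unique, this pins
  down the arbitrary choice in \<open>frechet_derivative\<close> on velocities of curves in
  \<open>A\<close>.\<close>

lemma smooth_on_vector_derivative_compose:
  assumes "smooth_on A f" "c t \<in> A" "(c has_vector_derivative v) (at t)" "\<forall>\<^sub>F s in nhds t. c s \<in> A"
  shows "((\<lambda>s. f (c s)) has_vector_derivative frechet_derivative f (at (c t) within A) v) (at t)"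
proof -
  obtain S where S: "open S" "t \<in> S" "\<And>s. s \<in> S \<Longrightarrow> c s \<in> A"
    using assms(4) unfolding eventually_nhds by blast
  have "(f has_derivative frechet_derivative f (at (c t) within A)) (at (c t) within c ` S)"
    using smooth_on_derivative_within[OF assms(1,2)] S(3) by (auto intro: has_derivative_subset)
  moreover have "(c has_vector_derivative v) (at t within S)"
    using assms(3) has_vector_derivative_at_within by blast
  ultimately have "((f \<circ> c) has_vector_derivative frechet_derivative f (at (c t) within A) v) (at t within S)"
    by (intro vector_derivative_diff_chain_within)
  then show ?thesis
    using at_within_open[OF S(2,1)] by (simp add: o_def)
qed

section \<open>Differential inequalities and averaging\<close>

text \<open>The norm is not differentiable at 0, so it is replaced by s = sqrt(|f|^2 +
  \<epsilon>^2), whose derivative is at most |f'|. With the integrating factor, s exp(-L(t-a)) -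
  \<delta>(t-a) does not increase; then \<epsilon> is made arbitrarily small.\<close>

lemma gronwall_derivative_bound:
  fixes f :: "real \<Rightarrow> 'a::real_inner"
  assumes "a \<le> b" "continuous_on {a..b} f"
    and f': "\<And>t. a < t \<Longrightarrow> t < b \<Longrightarrow> (f has_vector_derivative f' t) (at t)"
    and le: "\<And>t. a < t \<Longrightarrow> t < b \<Longrightarrow> norm (f' t) \<le> L * norm (f t) + \<delta>"
    and "L \<ge> 0" "\<delta> \<ge> 0" "f a = 0"
  shows "norm (f b) \<le> \<delta> * (b - a) * exp (L * (b - a))"
proof (rule field_le_epsilon)
  fix e :: real assume "e > 0"
  define E where "E = exp (L * (b - a))"
  \<comment> \<open>The regularisation costs \<open>\<epsilon> * E\<close> at time \<open>b\<close>,
    which is exactly \<open>e\<close>.\<close>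
  define \<epsilon> where "\<epsilon> = e / E"
  have E: "E > 0" unfolding E_def by simp
  have \<epsilon>: "\<epsilon> > 0" using \<open>e > 0\<close> E by (simp add: \<epsilon>_def)
  define s where "s t = sqrt (f t \<bullet> f t + \<epsilon>\<^sup>2)" for t
  have pos: "f t \<bullet> f t + \<epsilon>\<^sup>2 > 0" for t
    using \<epsilon> by (intro add_nonneg_pos) auto
  have s: "norm (f t) \<le> s t" "s t > 0" for t
    using pos[of t] unfolding s_def norm_eq_sqrt_inner by simp_all
  define g where "g t = s t * exp (- (L * (t - a))) - \<delta> * (t - a)" for t
  have "g b \<le> g a"
  proof (rule DERIV_nonpos_imp_decreasing_open[OF \<open>a \<le> b\<close>])
    show "continuous_on {a..b} g"
      unfolding g_def s_def using assms(2) by (intro continuous_intros)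
    fix t assume t: "a < t" "t < b"
    let ?X = "exp (- (L * (t - a)))"
    have d1: "((\<lambda>t. f t \<bullet> f t + \<epsilon>\<^sup>2) has_real_derivative 2 * (f t \<bullet> f' t)) (at t)"
    proof -
      have "((\<lambda>t. f t \<bullet> f t) has_real_derivative (f t \<bullet> f' t + f' t \<bullet> f t)) (at t)"
        unfolding has_real_derivative_iff_has_vector_derivative
        by (rule bounded_bilinear.has_vector_derivative[OF bounded_bilinear_inner f'[OF t] f'[OF t]])
      from DERIV_add[OF this DERIV_const[of "\<epsilon>\<^sup>2"]] show ?thesis
        by (simp add: inner_commute)
    qed
    have "s = (\<lambda>t. sqrt (f t \<bullet> f t + \<epsilon>\<^sup>2))" unfolding s_def ..
    then have "(s has_real_derivative inverse (s t) / 2 * (2 * (f t \<bullet> f' t))) (at t)"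
      using DERIV_chain2[OF DERIV_real_sqrt[OF pos[of t]] d1] by simp
    moreover have "inverse (s t) / 2 * (2 * (f t \<bullet> f' t)) = (f t \<bullet> f' t) / s t"
      by (simp add: field_simps)
    ultimately have s': "(s has_real_derivative (f t \<bullet> f' t) / s t) (at t)" by metis
    have X': "((\<lambda>t. exp (- (L * (t - a)))) has_real_derivative - L * ?X) (at t)"
      by (auto intro!: derivative_eq_intros)
    have \<delta>': "((\<lambda>t. \<delta> * (t - a)) has_real_derivative \<delta>) (at t)"
      by (auto intro!: derivative_eq_intros)
    have "(g has_real_derivative (((f t \<bullet> f' t) / s t) * ?X + - L * ?X * s t) - \<delta>) (at t)"
      unfolding g_def by (rule DERIV_diff[OF DERIV_mult[OF s' X'] \<delta>'])
    then have "(g has_real_derivative ((f t \<bullet> f' t) / s t) * ?X - s t * (L * ?X) - \<delta>) (at t)"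
      by (simp add: algebra_simps)
    moreover have "((f t \<bullet> f' t) / s t) * ?X - s t * (L * ?X) - \<delta> \<le> 0"
    proof -
      have "f t \<bullet> f' t \<le> norm (f t) * norm (f' t)" by (rule norm_cauchy_schwarz)
      also have "\<dots> \<le> s t * norm (f' t)" using s by (intro mult_right_mono) auto
      finally have "(f t \<bullet> f' t) / s t \<le> norm (f' t)" using s(2)[of t] by (simp add: field_simps)
      also have "\<dots> \<le> L * s t + \<delta>"
        using le[OF t] mult_left_mono[OF s(1)[of t] \<open>L \<ge> 0\<close>] by linarith
      finally have "((f t \<bullet> f' t) / s t - L * s t) * ?X \<le> \<delta> * ?X"
        by (intro mult_right_mono) auto
      also have "\<dots> \<le> \<delta> * 1"
        using t \<open>L \<ge> 0\<close> \<open>\<delta> \<ge> 0\<close> by (intro mult_left_mono) auto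
      finally show ?thesis by (simp add: algebra_simps)
    qed
    ultimately show "\<exists>y. (g has_real_derivative y) (at t) \<and> y \<le> 0" by blast
  qed
  then have "s b * exp (- (L * (b - a))) \<le> \<epsilon> + \<delta> * (b - a)"
    using \<open>f a = 0\<close> \<epsilon> by (simp add: g_def s_def)
  then have "s b \<le> (\<epsilon> + \<delta> * (b - a)) * E"
    unfolding E_def exp_minus by (simp only: divide_inverse[symmetric] pos_divide_le_eq[OF exp_gt_zero])
  also have "\<dots> = \<delta> * (b - a) * E + e" using E by (simp add: \<epsilon>_def field_simps)
  finally show "norm (f b) \<le> \<delta> * (b - a) * exp (L * (b - a)) + e"
    using s(1)[of b] unfolding E_def by simp
qed

text \<open>Gronwall with zero forcing gives the claim to the right of \<open>t0\<close>; the
  reflected curve \<open>f (- s)\<close> gives it to the left.\<close>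

lemma gronwall_zero:
  fixes f :: "real \<Rightarrow> 'a::real_inner"
  assumes f': "\<And>t. t \<in> {c<..<d} \<Longrightarrow> (f has_vector_derivative f' t) (at t)"
    and le: "\<And>t. t \<in> {c<..<d} \<Longrightarrow> norm (f' t) \<le> L * norm (f t)"
    and "L \<ge> 0" "t0 \<in> {c<..<d}" "f t0 = 0" "t \<in> {c<..<d}"
  shows "f t = 0"
proof (cases "t0 \<le> t")
  case True
  have "norm (f t) \<le> 0 * (t - t0) * exp (L * (t - t0))"
  proof (rule gronwall_derivative_bound[OF True, where f' = f'])
    show "continuous_on {t0..t} f"
      using assms(4,6)
      by (intro continuous_at_imp_continuous_on ballI has_vector_derivative_continuous[OF f']) auto
  qed (use assms in auto)
  then show ?thesis by simp
next
  case False
  define g where "g s = f (- s)" for s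
  have g': "(g has_vector_derivative - f' (- s)) (at s)" if "- s \<in> {c<..<d}" for s
  proof -
    have "((uminus :: real \<Rightarrow> real) has_vector_derivative - 1) (at s)"
      using has_vector_derivative_minus[OF has_vector_derivative_id] by simp
    from vector_diff_chain_at[OF this f'[OF that]] show ?thesis
      unfolding g_def by (simp add: o_def)
  qed
  have "norm (g (- t)) \<le> 0 * (- t - - t0) * exp (L * (- t - - t0))"
  proof (rule gronwall_derivative_bound[of "- t0" "- t" g "\<lambda>s. - f' (- s)"])
    show "continuous_on {- t0..- t} g"
      using assms(4,6)
      by (intro continuous_at_imp_continuous_on ballI has_vector_derivative_continuous[OF g']) auto
  next
    fix s assume "- t0 < s" "s < - t"
    then have "- s \<in> {c<..<d}" using assms(4,6) by auto
    then show "(g has_vector_derivative - f' (- s)) (at s)" "norm (- f' (- s)) \<le> L * norm (g s) + 0"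
      using g' le unfolding g_def by auto
  qed (use False assms in \<open>auto simp: g_def\<close>)
  then show ?thesis by (simp add: g_def)
qed

section \<open>Comparison of derivatives and the averaging estimate\<close>

lemma has_vector_derivative_withinD:
  assumes "(F has_vector_derivative D) (at t within S)" "e > 0"
  shows "\<exists>d>0. \<forall>s\<in>S. \<bar>s - t\<bar> < d \<longrightarrow> norm (F s - F t - (s - t) *\<^sub>R D) \<le> e * \<bar>s - t\<bar>"
  using assms unfolding has_vector_derivative_def has_derivative_within_alt by simp

text \<open>Difference quotients inherit the bound on increments. This estimates the derivative of a
  composite \<open>f (z t)\<close> by a Lipschitz constant of \<open>f\<close> on a compact set that
  contains the curve.\<close>

lemma has_vector_derivative_norm_le:
  fixes F :: "real \<Rightarrow> 'a::real_normed_vector" and z :: "real \<Rightarrow> 'b::real_normed_vector"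
  assumes F: "(F has_vector_derivative D) (at t within S)" and z: "(z has_vector_derivative v) (at t within S)"
    and "t islimpt S" "K \<ge> 0" and le: "\<And>s. s \<in> S \<Longrightarrow> norm (F s - F t) \<le> K * norm (z s - z t)"
  shows "norm D \<le> K * norm v"
proof (rule field_le_epsilon)
  fix e' :: real assume "e' > 0"
  \<comment> \<open>One error term comes from \<open>F\<close> and one from \<open>z\<close>, the
    latter multiplied by \<open>K\<close>.\<close>
  define e where "e = e' / (K + 1)"
  have e: "e > 0" "(K + 1) * e = e'" using \<open>e' > 0\<close> \<open>K \<ge> 0\<close> by (auto simp: e_def)
  obtain d1 where d1: "d1 > 0" "\<And>s. s \<in> S \<Longrightarrow> \<bar>s - t\<bar> < d1 \<Longrightarrow> norm (F s - F t - (s - t) *\<^sub>R D) \<le> e * \<bar>s - t\<bar>"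
    using has_vector_derivative_withinD[OF F e(1)] by blast
  obtain d2 where d2: "d2 > 0" "\<And>s. s \<in> S \<Longrightarrow> \<bar>s - t\<bar> < d2 \<Longrightarrow> norm (z s - z t - (s - t) *\<^sub>R v) \<le> e * \<bar>s - t\<bar>"
    using has_vector_derivative_withinD[OF z e(1)] by blast
  obtain s where s: "s \<in> S" "s \<noteq> t" "dist s t < min d1 d2"
    using \<open>t islimpt S\<close> d1(1) d2(1) unfolding islimpt_approachable by (metis min_less_iff_conj)
  then have st: "\<bar>s - t\<bar> < d1" "\<bar>s - t\<bar> < d2" by (auto simp: dist_real_def)
  have "norm ((s - t) *\<^sub>R D) \<le> norm (F s - F t) + norm (F s - F t - (s - t) *\<^sub>R D)"
    using norm_triangle_ineq4[of "F s - F t" "F s - F t - (s - t) *\<^sub>R D"] by simp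
  also have "\<dots> \<le> K * norm (z s - z t) + e * \<bar>s - t\<bar>"
    using le[OF s(1)] d1(2)[OF s(1) st(1)] by simp
  finally have 1: "norm ((s - t) *\<^sub>R D) \<le> K * norm (z s - z t) + e * \<bar>s - t\<bar>" .
  have "norm (z s - z t) \<le> norm ((s - t) *\<^sub>R v) + norm (z s - z t - (s - t) *\<^sub>R v)"
    using norm_triangle_ineq[of "(s - t) *\<^sub>R v" "z s - z t - (s - t) *\<^sub>R v"] by simp
  also have "\<dots> \<le> \<bar>s - t\<bar> * norm v + e * \<bar>s - t\<bar>"
    using d2(2)[OF s(1) st(2)] by simp
  finally have "K * norm (z s - z t) \<le> K * (\<bar>s - t\<bar> * norm v + e * \<bar>s - t\<bar>)"
    using \<open>K \<ge> 0\<close> by (rule mult_left_mono)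
  with 1 have "\<bar>s - t\<bar> * norm D \<le> K * (\<bar>s - t\<bar> * norm v + e * \<bar>s - t\<bar>) + e * \<bar>s - t\<bar>"
    unfolding norm_scaleR by (simp only: real_norm_def)
  also have "\<dots> = \<bar>s - t\<bar> * (K * norm v + (K + 1) * e)" by (simp add: algebra_simps)
  finally have "\<bar>s - t\<bar> * norm D \<le> \<bar>s - t\<bar> * (K * norm v + (K + 1) * e)" .
  then show "norm D \<le> K * norm v + e'"
    using s(2) e(2) by simp
qed

text \<open>The near-identity transformation \<open>z - (\<Sum>l\<in>I. w l t *\<^sub>R f l (z t))\<close>, with \<open>w l\<close> the
  antiderivative of the oscillating coefficient \<open>g l\<close>, turns the equation for \<open>z\<close> into a small
  perturbation of the averaged equation.\<close>

lemma averaging_estimate: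
  fixes z x :: "real \<Rightarrow> 's::euclidean_space" and g :: "'l \<Rightarrow> real \<Rightarrow> real"
  assumes "finite I" "a \<le> b"
    and z': "\<And>t. t \<in> {a..b} \<Longrightarrow> (z has_vector_derivative (favg (z t) + (\<Sum>l\<in>I. g l t *\<^sub>R f l (z t)))) (at t within {a..b})"
    and x': "\<And>t. t \<in> {a..b} \<Longrightarrow> (x has_vector_derivative favg (x t)) (at t within {a..b})"
    and init: "z a = x a"
    and D: "\<And>l t. l \<in> I \<Longrightarrow> t \<in> {a..b} \<Longrightarrow> ((\<lambda>s. f l (z s)) has_vector_derivative D l t) (at t within {a..b})"
    and M: "\<And>l t. l \<in> I \<Longrightarrow> t \<in> {a..b} \<Longrightarrow> norm (D l t) \<le> M"
    and B: "\<And>l t. l \<in> I \<Longrightarrow> t \<in> {a..b} \<Longrightarrow> norm (f l (z t)) \<le> B"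
    and L: "\<And>t. t \<in> {a..b} \<Longrightarrow> norm (favg (z t) - favg (x t)) \<le> L * norm (z t - x t)"
    and g: "\<And>l. l \<in> I \<Longrightarrow> continuous_on {a..b} (g l)"
    and \<kappa>: "\<And>l t. l \<in> I \<Longrightarrow> t \<in> {a..b} \<Longrightarrow> \<bar>integral {a..t} (g l)\<bar> \<le> \<kappa>"
    and nonneg: "L \<ge> 0" "B \<ge> 0" "M \<ge> 0" "\<kappa> \<ge> 0"
  shows "norm (z b - x b) \<le> \<kappa> * (card I * (B + (L * B + M) * (b - a) * exp (L * (b - a))))"
proof -
  define w where "w l t = integral {a..t} (g l)" for l t
  have w': "(w l has_vector_derivative g l t) (at t within {a..b})" if "l \<in> I" "t \<in> {a..b}" for l t
    unfolding w_def using integral_has_vector_derivative[OF g[OF that(1)] that(2)] .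
  define e where "e t = z t - (\<Sum>l\<in>I. w l t *\<^sub>R f l (z t)) - x t" for t
  define e' where "e' t = favg (z t) - favg (x t) - (\<Sum>l\<in>I. w l t *\<^sub>R D l t)" for t
  have wf: "((\<lambda>t. w l t *\<^sub>R f l (z t)) has_vector_derivative w l t *\<^sub>R D l t + g l t *\<^sub>R f l (z t)) (at t within {a..b})"
    if "l \<in> I" "t \<in> {a..b}" for l t
    using bounded_bilinear.has_vector_derivative[OF bounded_bilinear_scaleR w'[OF that] D[OF that]] .
  have e: "(e has_vector_derivative e' t) (at t within {a..b})" if t: "t \<in> {a..b}" for t
  proof -
    have "(e has_vector_derivative (favg (z t) + (\<Sum>l\<in>I. g l t *\<^sub>R f l (z t)))
        - (\<Sum>l\<in>I. w l t *\<^sub>R D l t + g l t *\<^sub>R f l (z t)) - favg (x t)) (at t within {a..b})"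
      unfolding e_def using t
      by (intro has_vector_derivative_diff has_vector_derivative_sum z' x' wf) auto
    then show ?thesis unfolding e'_def by (simp add: sum.distrib algebra_simps)
  qed
  have small: "norm (\<Sum>l\<in>I. w l t *\<^sub>R h l t) \<le> \<kappa> * (card I * C)"
    if "t \<in> {a..b}" "\<And>l. l \<in> I \<Longrightarrow> norm (h l t) \<le> C" for t and C :: real and h :: "'l \<Rightarrow> real \<Rightarrow> 's"
  proof -
    have "norm (\<Sum>l\<in>I. w l t *\<^sub>R h l t) \<le> (\<Sum>l\<in>I. \<kappa> * C)"
      using that \<kappa> nonneg unfolding w_def by (intro sum_norm_le) (auto intro!: mult_mono)
    then show ?thesis by (simp add: mult_ac)
  qed
  have zx: "norm (z t - x t) \<le> norm (e t) + \<kappa> * (card I * B)" if "t \<in> {a..b}" for t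
  proof -
    have "z t - x t = e t + (\<Sum>l\<in>I. w l t *\<^sub>R f l (z t))" unfolding e_def by simp
    also have "norm \<dots> \<le> norm (e t) + norm (\<Sum>l\<in>I. w l t *\<^sub>R f l (z t))" by (rule norm_triangle_ineq)
    finally show ?thesis using small[OF that, where h = "\<lambda>l t. f l (z t)" and C = B] B that by fastforce
  qed
  \<comment> \<open>In the forcing, the part with \<open>M\<close> comes from differentiating
    \<open>f l (z t)\<close>, the part with \<open>L * B\<close> from replacing \<open>z - x\<close>
    by \<open>e\<close>.\<close>
  have "norm (e b) \<le> (\<kappa> * (card I * (L * B + M))) * (b - a) * exp (L * (b - a))"
  proof (rule gronwall_derivative_bound[OF \<open>a \<le> b\<close>, where f' = e'])
    show "continuous_on {a..b} e"
      unfolding continuous_on_eq_continuous_within using e has_vector_derivative_continuous by blast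
    show "e a = 0" unfolding e_def w_def using init by simp
    fix t assume t: "a < t" "t < b"
    then have t': "t \<in> {a..b}" by auto
    show "(e has_vector_derivative e' t) (at t)"
      using e[OF t'] t by (simp add: at_within_Icc_at)
    have "norm (e' t) \<le> norm (favg (z t) - favg (x t)) + norm (\<Sum>l\<in>I. w l t *\<^sub>R D l t)"
      unfolding e'_def by (rule norm_triangle_ineq4)
    also have "\<dots> \<le> L * norm (z t - x t) + \<kappa> * (card I * M)"
      using L[OF t'] small[OF t', where h = D and C = M] M[OF _ t'] by auto
    also have "\<dots> \<le> L * (norm (e t) + \<kappa> * (card I * B)) + \<kappa> * (card I * M)"
      using zx[OF t'] nonneg by (intro add_right_mono mult_left_mono) auto
    finally show "norm (e' t) \<le> L * norm (e t) + \<kappa> * (card I * (L * B + M))"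
      by (simp add: algebra_simps)
  qed (use nonneg in auto)
  then show ?thesis using zx[of b] \<open>a \<le> b\<close> by (simp add: algebra_simps)
qed

section \<open>Existence of solutions\<close>

text \<open>Picard iteration as a contraction of the bounded continuous functions on the whole line.
  Global bounds on \<open>H\<close> can be asked for because the lemma is applied to a field that
  has been cut off outside a ball.\<close>

lemma picard_lindelof_global:
  fixes H :: "real \<Rightarrow> 's::euclidean_space \<Rightarrow> 's"
  assumes cont: "continuous_on UNIV (\<lambda>(t, x). H t x)"
    and bd: "\<And>t x. norm (H t x) \<le> B"
    and lip: "\<And>t x y. norm (H t x - H t y) \<le> L * norm (x - y)"
    and "L \<ge> 0"
  shows "\<exists>\<epsilon>>0. \<exists>z. z t0 = z0 \<and> (\<forall>t\<in>{t0-\<epsilon><..<t0+\<epsilon>}. (z has_vector_derivative H t (z t)) (at t))"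
proof -
  \<comment> \<open>Each of the two integrals in \<open>F\<close> runs over a length of at most
    \<open>2 * \<epsilon>\<close>, so the contraction factor is \<open>4 * \<epsilon> * L\<close>,
    at most 1/2.\<close>
  define \<epsilon> where "\<epsilon> = 1 / (8 * (L + 1))"
  have \<epsilon>: "\<epsilon> > 0" "4 * \<epsilon> * L \<le> 1/2" using \<open>L \<ge> 0\<close> by (auto simp: \<epsilon>_def field_simps)
  define a b where "a = t0 - \<epsilon>" and "b = t0 + \<epsilon>"
  have ab: "a \<le> t0" "t0 \<le> b" "b - a = 2 * \<epsilon>" using \<epsilon> by (auto simp: a_def b_def)
  \<comment> \<open>Freezing time outside \<open>{a..b}\<close> makes the iterates bounded on the
    whole line, so that they live in a complete space of total functions.\<close>
  define cl where "cl t = max a (min b t)" for t :: real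
  have cl: "cl t \<in> {a..b}" for t using ab unfolding cl_def by auto
  have Hc: "continuous_on S (\<lambda>s. H s (x s))" if "continuous_on S x" for x :: "real \<Rightarrow> 's" and S
  proof -
    have "continuous_on S (\<lambda>s. (s, x s))" by (intro continuous_intros that)
    from continuous_on_compose2[OF cont this] show ?thesis by simp
  qed
  have int: "(\<lambda>s. H s (x s)) integrable_on {c..d}" if "continuous_on UNIV x" for x :: "real \<Rightarrow> 's" and c d
    by (rule integrable_continuous_real[OF Hc[OF continuous_on_subset[OF that]]]) auto
  \<comment> \<open>Both integrals start at \<open>a\<close>; their difference is the signed
    integral from \<open>t0\<close> to \<open>cl t\<close>, whichever comes first.\<close>
  define F where "F x t = z0 + (integral {a..cl t} (\<lambda>s. H s (x s)) - integral {a..t0} (\<lambda>s. H s (x s)))"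
    for x :: "real \<Rightarrow> 's" and t
  have intle: "norm (integral {a..c} h) \<le> C * (2 * \<epsilon>)"
    if "c \<in> {a..b}" "continuous_on UNIV h" "C \<ge> 0" "\<And>s. norm (h s) \<le> C" for c C and h :: "real \<Rightarrow> 's"
  proof -
    have "norm (integral {a..c} h) \<le> C * (c - a)"
      using that by (intro integral_bound) (auto intro: continuous_on_subset)
    also have "\<dots> \<le> C * (2 * \<epsilon>)" using that ab by (intro mult_left_mono) auto
    finally show ?thesis .
  qed
  have B0: "B \<ge> 0" using bd[of 0 0] norm_ge_zero order_trans by blast
  have Fb: "F x \<in> bcontfun" if "continuous_on UNIV x" for x
  proof (rule bcontfun_normI)
    have "continuous_on {a..b} (\<lambda>c. integral {a..c} (\<lambda>s. H s (x s)))"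
      by (rule indefinite_integral_continuous_1[OF int[OF that]])
    then have "continuous_on UNIV (\<lambda>t. integral {a..cl t} (\<lambda>s. H s (x s)))"
      by (rule continuous_on_compose2) (use cl in \<open>auto simp: cl_def intro!: continuous_intros\<close>)
    then show "continuous_on UNIV (F x)" unfolding F_def by (intro continuous_intros)
    fix t
    have "norm (integral {a..cl t} (\<lambda>s. H s (x s))) \<le> B * (2 * \<epsilon>)" "norm (integral {a..t0} (\<lambda>s. H s (x s))) \<le> B * (2 * \<epsilon>)"
      using intle[OF cl Hc[OF that] B0 bd] intle[OF _ Hc[OF that] B0 bd] ab by auto
    then show "norm (F x t) \<le> norm z0 + (B * (2 * \<epsilon>) + B * (2 * \<epsilon>))"
      unfolding F_def by (intro order_trans[OF norm_triangle_ineq] add_left_mono order_trans[OF norm_triangle_ineq4] add_mono)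
  qed
  define \<Phi> where "\<Phi> X = Bcontfun (F (apply_bcontfun X))" for X
  have \<Phi>: "apply_bcontfun (\<Phi> X) = F (apply_bcontfun X)" for X
    unfolding \<Phi>_def by (rule Bcontfun_inverse[OF Fb]) auto
  have "\<exists>!X. \<Phi> X = X"
  proof (rule banach_fix_type[of "1/2"]; (intro allI)?)
    fix X Y :: "real \<Rightarrow>\<^sub>C 's"
    show "dist (\<Phi> X) (\<Phi> Y) \<le> 1/2 * dist X Y"
    proof (rule dist_bound)
      fix t
      let ?h = "\<lambda>s. H s (X s) - H s (Y s)"
      have c: "continuous_on UNIV ?h" by (intro continuous_intros Hc) auto
      have le: "norm (?h s) \<le> L * dist X Y" for s
        using lip[of s "X s" "Y s"] mult_left_mono[OF dist_bounded[of X s Y] \<open>L \<ge> 0\<close>] by (simp add: dist_norm)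
      have LX: "L * dist X Y \<ge> 0" using \<open>L \<ge> 0\<close> by simp
      have t0: "t0 \<in> {a..b}" using ab by simp
      have 1: "norm (integral {a..cl t} ?h) \<le> L * dist X Y * (2 * \<epsilon>)" "norm (integral {a..t0} ?h) \<le> L * dist X Y * (2 * \<epsilon>)"
        using intle[OF cl c LX le] intle[OF t0 c LX le] by auto
      have eq: "\<Phi> X t - \<Phi> Y t = integral {a..cl t} ?h - integral {a..t0} ?h"
      proof -
        have i: "integral {a..c} ?h = integral {a..c} (\<lambda>s. H s (X s)) - integral {a..c} (\<lambda>s. H s (Y s))" for c
          by (intro integral_diff int continuous_on_apply_bcontfun)
        show ?thesis unfolding \<Phi> F_def i by (simp only: algebra_simps)
      qed
      have "dist (\<Phi> X t) (\<Phi> Y t) \<le> L * dist X Y * (2 * \<epsilon>) + L * dist X Y * (2 * \<epsilon>)"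
        unfolding dist_norm[of "\<Phi> X t"] eq by (rule order_trans[OF norm_triangle_ineq4 add_mono[OF 1]])
      also have "\<dots> = (4 * \<epsilon> * L) * dist X Y" by simp
      also have "\<dots> \<le> 1/2 * dist X Y" using \<epsilon> by (intro mult_right_mono) auto
      finally show "dist (\<Phi> X t) (\<Phi> Y t) \<le> 1/2 * dist X Y" .
    qed
  qed auto
  then obtain X where X: "\<Phi> X = X" by blast
  have Xt: "X t = F (apply_bcontfun X) t" for t using X \<Phi> by metis
  show ?thesis
  proof (intro exI[of _ \<epsilon>] exI[of _ "apply_bcontfun X"] conjI ballI)
    show "X t0 = z0" unfolding Xt[of t0] F_def cl_def using ab by (simp add: max_def min_def)
    fix t assume t: "t \<in> {t0-\<epsilon><..<t0+\<epsilon>}"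
    then have tab: "t \<in> {a..b}" "a < t" "t < b" by (auto simp: a_def b_def)
    have "((\<lambda>c. integral {a..c} (\<lambda>s. H s (X s))) has_vector_derivative H t (X t)) (at t within {a..b})"
      by (rule integral_has_vector_derivative[OF Hc tab(1)]) auto
    then have "((\<lambda>c. z0 + (integral {a..c} (\<lambda>s. H s (X s)) - integral {a..t0} (\<lambda>s. H s (X s)))) has_vector_derivative H t (X t)) (at t)"
      using tab by (auto simp: at_within_Icc_at intro!: derivative_eq_intros)
    then show "(apply_bcontfun X has_vector_derivative H t (X t)) (at t)"
    proof (rule has_vector_derivative_transform_within_open[of _ _ _ "{a<..<b}"])
      fix s assume "s \<in> {a<..<b}"
      then have "cl s = s" by (auto simp: cl_def)
      then show "z0 + (integral {a..s} (\<lambda>s. H s (X s)) - integral {a..t0} (\<lambda>s. H s (X s))) = X s"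
        unfolding Xt[of s] F_def by simp
    qed (use tab in auto)
  qed (use \<epsilon> in auto)
qed

lemma has_vector_derivative_lipschitz:
  fixes f :: "real \<Rightarrow> 'a::real_normed_vector"
  assumes "\<And>t. t \<in> S \<Longrightarrow> (f has_vector_derivative f' t) (at t within S)" "convex S"
    and "\<And>t. t \<in> S \<Longrightarrow> norm (f' t) \<le> B" "s \<in> S" "t \<in> S"
  shows "norm (f s - f t) \<le> B * \<bar>s - t\<bar>"
proof -
  have "norm (f s - f t) \<le> B * norm (s - t)"
  proof (rule differentiable_bound[OF assms(2), where f' = "\<lambda>x h. h *\<^sub>R f' x"])
    fix x assume "x \<in> S"
    then show "onorm (\<lambda>h. h *\<^sub>R f' x) \<le> B"
      using assms(3)[of x] order_trans[OF norm_ge_zero assms(3)[of x]]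
      by (intro onorm_bound) (auto simp: mult.commute[of B] intro!: mult_left_mono)
  qed (use assms in \<open>auto simp: has_vector_derivative_def\<close>)
  then show ?thesis by simp
qed

text \<open>If \<open>z' = G t (\<rho> z)\<close> for a retraction \<open>\<rho>\<close> onto \<open>M\<close> and \<open>G t\<close> is tangent to \<open>M\<close>,
  then \<open>d = z - \<rho> z\<close> satisfies \<open>d' = (D\<rho>(\<rho> z) - D\<rho>(z)) (G t (\<rho> z))\<close>, so \<open>\<parallel>d'\<parallel> \<le> K \<parallel>d\<parallel>\<close>
  and \<open>z\<close> stays in \<open>M\<close> if it starts there.\<close>

lemma local_solution_on_retract:
  fixes M :: "'s::euclidean_space set" and f :: "'l \<Rightarrow> 's \<Rightarrow> 's" and c :: "'l \<Rightarrow> real \<Rightarrow> real"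
  assumes "finite I"
    and f: "\<And>l. l \<in> I \<Longrightarrow> smooth_on M (f l)"
    and c: "\<And>l. l \<in> I \<Longrightarrow> continuous_on UNIV (c l)"
    and cb: "\<And>l t. l \<in> I \<Longrightarrow> \<bar>c l t\<bar> \<le> cb"
    and W: "open W" "z0 \<in> W" "z0 \<in> M" "C_inf_on W \<rho>" "\<rho> ` W \<subseteq> M" "\<And>x. x \<in> M \<Longrightarrow> x \<in> W \<Longrightarrow> \<rho> x = x"
    and tan: "\<And>l x. l \<in> I \<Longrightarrow> x \<in> M \<Longrightarrow> x \<in> W \<Longrightarrow> frechet_derivative \<rho> (at x) (f l x) = f l x"
  shows "\<exists>\<epsilon>>0. \<exists>z. z t0 = z0 \<and> (\<forall>t\<in>{t0-\<epsilon><..<t0+\<epsilon>}. z t \<in> M \<and>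
           (z has_vector_derivative (\<Sum>l\<in>I. c l t *\<^sub>R f l (z t))) (at t))"
proof -
  obtain R where R: "R > 0" "cball z0 R \<subseteq> W" using W(1,2) open_contains_cball by blast
  have \<rho>c: "continuous_on W \<rho>" by (rule C_inf_on_continuous[OF W(4)])
  have "isCont \<rho> z0" using \<rho>c W(1,2) continuous_on_eq_continuous_at by blast
  then obtain r0 where r0: "r0 > 0" "\<And>x. dist x z0 < r0 \<Longrightarrow> dist (\<rho> x) z0 < R"
    using R(1) W(6)[OF W(3,2)] unfolding continuous_at_eps_delta by metis
  \<comment> \<open>The smaller ball keeps \<open>\<rho> x\<close> in the ball of radius
    \<open>R\<close>, where the derivative of the retraction is compared at \<open>x\<close> and at
    \<open>\<rho> x\<close>. Halving \<open>r0\<close> passes from an open to a closed ball.\<close>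
  define r where "r = min R (r0 / 2)"
  have r: "r > 0" "cball z0 r \<subseteq> cball z0 R" "\<And>x. x \<in> cball z0 r \<Longrightarrow> \<rho> x \<in> cball z0 R"
  proof -
    show "r > 0" "cball z0 r \<subseteq> cball z0 R" using R(1) r0(1) unfolding r_def by auto
    fix x assume "x \<in> cball z0 r"
    then have "dist x z0 < r0" using r0(1) unfolding r_def by (auto simp: dist_commute)
    then show "\<rho> x \<in> cball z0 R" using r0(2)[of x] by (simp add: dist_commute less_imp_le)
  qed
  have rW: "cball z0 r \<subseteq> W" using r(2) R(2) by blast
  have \<rho>s: "smooth_on W \<rho>" using C_inf_on_imp_smooth_on[OF W(1,4)] .
  have fs: "smooth_on W (\<lambda>x. f l (\<rho> x))" if "l \<in> I" for l
    by (rule smooth_on_compose[OF f[OF that] \<rho>s W(5)])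
  have "\<forall>l\<in>I. \<exists>L\<ge>0. \<forall>x\<in>cball z0 r. \<forall>y\<in>cball z0 r. norm (f l (\<rho> x) - f l (\<rho> y)) \<le> L * norm (x - y)"
    using smooth_on_compact_lipschitz[OF fs compact_cball rW] by blast
  then obtain \<Lambda> where \<Lambda>: "\<And>l. l \<in> I \<Longrightarrow> \<Lambda> l \<ge> 0"
    "\<And>l x y. l \<in> I \<Longrightarrow> x \<in> cball z0 r \<Longrightarrow> y \<in> cball z0 r \<Longrightarrow> norm (f l (\<rho> x) - f l (\<rho> y)) \<le> \<Lambda> l * norm (x - y)"
    unfolding bchoice_iff by metis
  have "\<forall>l\<in>I. \<exists>B\<ge>0. \<forall>x\<in>cball z0 r. norm (f l (\<rho> x)) \<le> B"
    using smooth_on_compact_bounded[OF fs compact_cball rW] by blast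
  then obtain Bf where Bf: "\<And>l. l \<in> I \<Longrightarrow> Bf l \<ge> 0" "\<And>l x. l \<in> I \<Longrightarrow> x \<in> cball z0 r \<Longrightarrow> norm (f l (\<rho> x)) \<le> Bf l"
    unfolding bchoice_iff by metis
  \<comment> \<open>The closest point in the ball depends on the point with Lipschitz constant 1, so
    precomposing with it turns local bounds into global ones.\<close>
  define P where "P = closest_point (cball z0 r)"
  have P: "P x \<in> cball z0 r" "dist (P x) (P y) \<le> dist x y" for x y
    unfolding P_def using r(1) by (auto intro!: closest_point_in_set closest_point_lipschitz simp del: mem_cball)
  have P_self: "P x = x" if "x \<in> cball z0 r" for x
    unfolding P_def by (rule closest_point_self[OF that])
  have Pc: "continuous_on S P" for S
    unfolding P_def using r(1) by (intro continuous_on_closest_point) auto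
  define H where "H t x = (\<Sum>l\<in>I. c l t *\<^sub>R f l (\<rho> (P x)))" for t x
  define B where "B = (\<Sum>l\<in>I. \<bar>cb\<bar> * Bf l)"
  have B: "norm (H t x) \<le> B" for t x
    unfolding H_def B_def
  proof (rule sum_norm_le)
    fix l assume l: "l \<in> I"
    show "norm (c l t *\<^sub>R f l (\<rho> (P x))) \<le> \<bar>cb\<bar> * Bf l"
      using cb[OF l, of t] Bf(2)[OF l P(1)[of x]] by (auto intro!: mult_mono)
  qed
  have "B \<ge> 0" using order_trans[OF norm_ge_zero B] .
  define L where "L = (\<Sum>l\<in>I. \<bar>cb\<bar> * \<Lambda> l)"
  have L: "norm (H t x - H t y) \<le> L * norm (x - y)" for t x y
  proof -
    have "norm (H t x - H t y) = norm (\<Sum>l\<in>I. c l t *\<^sub>R (f l (\<rho> (P x)) - f l (\<rho> (P y))))"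
      unfolding H_def by (simp add: sum_subtractf scaleR_diff_right)
    also have "\<dots> \<le> (\<Sum>l\<in>I. \<bar>cb\<bar> * (\<Lambda> l * norm (x - y)))"
    proof (rule sum_norm_le)
      fix l assume l: "l \<in> I"
      have "norm (f l (\<rho> (P x)) - f l (\<rho> (P y))) \<le> \<Lambda> l * norm (P x - P y)"
        by (rule \<Lambda>(2)[OF l P(1) P(1)])
      also have "\<dots> \<le> \<Lambda> l * norm (x - y)"
        using P(2)[of x y] \<Lambda>(1)[OF l] by (intro mult_left_mono) (auto simp: dist_norm)
      finally show "norm (c l t *\<^sub>R (f l (\<rho> (P x)) - f l (\<rho> (P y)))) \<le> \<bar>cb\<bar> * (\<Lambda> l * norm (x - y))"
        using cb[OF l, of t] unfolding norm_scaleR by (intro mult_mono) auto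
    qed
    finally show ?thesis unfolding L_def by (simp add: sum_distrib_right mult.assoc)
  qed
  have "L \<ge> 0" unfolding L_def using \<Lambda>(1) by (intro sum_nonneg) auto
  have Hc: "continuous_on UNIV (\<lambda>(t, x). H t x)"
  proof -
    have "continuous_on UNIV (\<lambda>p. c l (fst p) *\<^sub>R f l (\<rho> (P (snd p))))" if l: "l \<in> I" for l
    proof (intro continuous_on_scaleR)
      show "continuous_on UNIV (\<lambda>p::real \<times> 's. c l (fst p))"
        by (rule continuous_on_compose2[OF c[OF l]]) (auto intro!: continuous_intros)
      have "continuous_on (cball z0 r) (\<lambda>x. f l (\<rho> x))"
        using smooth_on_continuous[OF fs[OF l]] rW continuous_on_subset by blast
      moreover have "continuous_on UNIV (\<lambda>p::real \<times> 's. P (snd p))"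
        by (rule continuous_on_compose2[OF Pc[of UNIV]]) (auto intro!: continuous_intros)
      ultimately show "continuous_on UNIV (\<lambda>p::real \<times> 's. f l (\<rho> (P (snd p))))"
        by (rule continuous_on_compose2) (use P in auto)
    qed
    then show ?thesis unfolding H_def case_prod_beta by (intro continuous_on_sum)
  qed
  obtain \<epsilon>1 z where \<epsilon>1: "\<epsilon>1 > 0" "z t0 = z0"
    and z': "\<And>t. t \<in> {t0-\<epsilon>1<..<t0+\<epsilon>1} \<Longrightarrow> (z has_vector_derivative H t (z t)) (at t)"
    using picard_lindelof_global[OF Hc B L \<open>L \<ge> 0\<close>, of t0 z0] by blast
  \<comment> \<open>At speed at most \<open>B\<close> the curve stays in the ball during this time,
    and there the cut-off \<open>P\<close> is the identity.\<close>
  define \<epsilon> where "\<epsilon> = min \<epsilon>1 (r / (B + 1))"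
  have \<epsilon>: "\<epsilon> > 0" "\<epsilon> \<le> \<epsilon>1" "B * \<epsilon> \<le> r"
  proof -
    show "\<epsilon> > 0" "\<epsilon> \<le> \<epsilon>1" unfolding \<epsilon>_def using \<epsilon>1 r \<open>B \<ge> 0\<close> by auto
    have "B * \<epsilon> \<le> B * (r / (B + 1))" unfolding \<epsilon>_def using \<open>B \<ge> 0\<close> by (intro mult_left_mono) auto
    also have "\<dots> \<le> r" using \<open>B \<ge> 0\<close> r(1) by (simp add: field_simps)
    finally show "B * \<epsilon> \<le> r" .
  qed
  let ?J = "{t0-\<epsilon><..<t0+\<epsilon>}"
  have zJ: "(z has_vector_derivative H t (z t)) (at t)" if "t \<in> ?J" for t
    using z' that \<epsilon>(2) by auto
  have zr: "z t \<in> cball z0 r" if t: "t \<in> ?J" for t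
  proof -
    have "norm (z t - z t0) \<le> B * \<bar>t - t0\<bar>"
      by (rule has_vector_derivative_lipschitz[of ?J z "\<lambda>t. H t (z t)"])
        (use zJ B t \<epsilon>(1) in \<open>auto intro: has_vector_derivative_at_within\<close>)
    also have "\<dots> \<le> B * \<epsilon>" using t \<open>B \<ge> 0\<close> by (intro mult_left_mono) auto
    finally show ?thesis using \<epsilon> \<epsilon>1(2) by (simp add: dist_norm norm_minus_commute)
  qed
  have D\<rho>: "(\<rho> has_derivative frechet_derivative \<rho> (at x)) (at x)" "linear (frechet_derivative \<rho> (at x))" if "x \<in> W" for x
    using C_inf_on_derivative[OF W(4) that] has_derivative_linear by blast+
  have "\<forall>b. \<exists>L\<ge>0. \<forall>x\<in>cball z0 R. \<forall>y\<in>cball z0 R. norm (frechet_derivative \<rho> (at x) b - frechet_derivative \<rho> (at y) b) \<le> L * norm (x - y)"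
    using smooth_on_compact_lipschitz[OF C_inf_on_imp_smooth_on[OF W(1) C_inf_on_directional[OF W(4)]] compact_cball R(2)] by blast
  then obtain Lb where Lb: "\<And>b. Lb b \<ge> 0"
    "\<And>b x y. x \<in> cball z0 R \<Longrightarrow> y \<in> cball z0 R \<Longrightarrow> norm (frechet_derivative \<rho> (at x) b - frechet_derivative \<rho> (at y) b) \<le> Lb b * norm (x - y)"
    by metis
  define d where "d t = z t - \<rho> (z t)" for t
  define d' where "d' t = H t (z t) - frechet_derivative \<rho> (at (z t)) (H t (z t))" for t
  have d0: "d t = 0" if t: "t \<in> ?J" for t
  proof (rule gronwall_zero[of "t0 - \<epsilon>" "t0 + \<epsilon>" d d' "B * (\<Sum>b\<in>Basis. Lb b)" t0])
    fix t assume t: "t \<in> ?J"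
    then have zW: "z t \<in> W" using zr rW by blast
    have "((\<rho> \<circ> z) has_vector_derivative frechet_derivative \<rho> (at (z t)) (H t (z t))) (at t)"
      using vector_derivative_diff_chain_within[OF zJ[OF t], of \<rho> "frechet_derivative \<rho> (at (z t))"]
        has_derivative_at_withinI[OF D\<rho>(1)[OF zW]] by blast
    then show "(d has_vector_derivative d' t) (at t)"
      unfolding d_def d'_def o_def by (intro has_vector_derivative_diff zJ[OF t])
    have \<rho>z: "\<rho> (z t) \<in> cball z0 R" "\<rho> (z t) \<in> M" "\<rho> (z t) \<in> W"
      using r(3)[OF zr[OF t]] W(5) zW R(2) by auto
    have "frechet_derivative \<rho> (at (\<rho> (z t))) (H t (z t)) = H t (z t)"
      unfolding H_def P_self[OF zr[OF t]]
      using D\<rho>(2)[OF \<rho>z(3)] tan[OF _ \<rho>z(2,3)] by (simp add: linear_sum linear_scale)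
    then have "d' t = frechet_derivative \<rho> (at (\<rho> (z t))) (H t (z t)) - frechet_derivative \<rho> (at (z t)) (H t (z t))"
      unfolding d'_def by simp
    also have "\<dots> = (\<Sum>b\<in>Basis. (H t (z t) \<bullet> b) *\<^sub>R (frechet_derivative \<rho> (at (\<rho> (z t))) b - frechet_derivative \<rho> (at (z t)) b))"
    proof -
      have e: "frechet_derivative \<rho> (at x) v = (\<Sum>b\<in>Basis. (v \<bullet> b) *\<^sub>R frechet_derivative \<rho> (at x) b)" if "x \<in> W" for x v
        by (rule linear_Basis_expansion[OF D\<rho>(2)[OF that]])
      show ?thesis
        unfolding e[OF \<rho>z(3), of "H t (z t)"] e[OF zW, of "H t (z t)"] by (simp add: sum_subtractf scaleR_diff_right)
    qed
    also have "norm \<dots> \<le> (\<Sum>b\<in>Basis. B * (Lb b * norm (d t)))"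
    proof (rule sum_norm_le)
      fix b :: 's assume b: "b \<in> Basis"
      have "\<bar>H t (z t) \<bullet> b\<bar> \<le> B" using Basis_le_norm[OF b] B order_trans by blast
      moreover have "norm (frechet_derivative \<rho> (at (\<rho> (z t))) b - frechet_derivative \<rho> (at (z t)) b) \<le> Lb b * norm (d t)"
        using Lb(2)[OF \<rho>z(1), of "z t" b] zr[OF t] r(2) unfolding d_def by (auto simp: norm_minus_commute)
      ultimately show "norm ((H t (z t) \<bullet> b) *\<^sub>R (frechet_derivative \<rho> (at (\<rho> (z t))) b - frechet_derivative \<rho> (at (z t)) b)) \<le> B * (Lb b * norm (d t))"
        unfolding norm_scaleR using \<open>B \<ge> 0\<close> by (intro mult_mono) auto
    qed
    finally show "norm (d' t) \<le> B * (\<Sum>b\<in>Basis. Lb b) * norm (d t)"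
      by (simp add: sum_distrib_left sum_distrib_right mult.assoc)
  next
    show "B * (\<Sum>b\<in>Basis. Lb b) \<ge> 0" using \<open>B \<ge> 0\<close> Lb(1) by (simp add: sum_nonneg)
    show "d t0 = 0" using \<epsilon>1(2) W(6)[OF W(3,2)] unfolding d_def by simp
  qed (use t \<epsilon>(1) in auto)
  show ?thesis
  proof (intro exI[of _ \<epsilon>] exI[of _ z] conjI ballI)
    fix t assume t: "t \<in> ?J"
    have e: "\<rho> (z t) = z t" using d0[OF t] unfolding d_def by simp
    have zW: "z t \<in> W" using zr[OF t] rW by blast
    show "z t \<in> M" using W(5) zW e by force
    show "(z has_vector_derivative (\<Sum>l\<in>I. c l t *\<^sub>R f l (z t))) (at t)"
      using zJ[OF t] unfolding H_def P_self[OF zr[OF t]] e .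
  qed (use \<epsilon> \<epsilon>1 in auto)
qed

section \<open>Absolute continuity and Lebesgue differentiation\<close>

text \<open>Riemann sums are split by tag. Off \<open>N\<close>, differentiability at the tag makes
  each error small relative to the length of its interval. Tags in \<open>N\<close> are confined by
  the gauge to an open set of measure below \<delta>, so absolute continuity bounds the total
  increment there.\<close>

lemma absolutely_continuous_has_integral:
  fixes f :: "real \<Rightarrow> 'a::banach"
  assumes ac: "absolutely_continuous_on_interval a b f" and "a \<le> b" "negligible N"
    and f': "\<And>t. t \<in> {a..b} - N \<Longrightarrow> (f has_vector_derivative g t) (at t)"
  shows "(g has_integral (f b - f a)) {a..b}"
proof -
  \<comment> \<open>With the value 0 on \<open>N\<close>, a term tagged there is the bare increment
    of \<open>f\<close>; this negligible change is undone at the end.\<close>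
  define h where "h t = (if t \<in> N then 0 else g t)" for t
  have "(h has_integral (f b - f a)) {a..b}"
    unfolding has_integral_real
  proof (intro allI impI)
    fix e :: real assume "e > 0"
    define e1 where "e1 = e / (2 * (b - a + 1))"
    have e1: "e1 > 0" "e1 * (b - a) < e / 2"
      using \<open>e > 0\<close> \<open>a \<le> b\<close> by (auto simp: e1_def field_simps)
    obtain \<delta> where \<delta>: "\<delta> > 0" "\<And>D S. D division_of S \<Longrightarrow> S \<subseteq> {a..b} \<Longrightarrow> (\<Sum>K\<in>D. Sup K - Inf K) < \<delta> \<Longrightarrow>
        (\<Sum>K\<in>D. norm (f (Sup K) - f (Inf K))) < e / 2"
      using ac \<open>e > 0\<close> unfolding absolutely_continuous_on_interval_def by (metis half_gt_zero)
    have N: "N \<in> sets lebesgue" "measure lebesgue N = 0" "N \<in> lmeasurable"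
      using \<open>negligible N\<close> negligible_iff_measure by (auto simp: fmeasurableD)
    obtain T where T: "open T" "N \<subseteq> T" "T - N \<in> lmeasurable" "emeasure lebesgue (T - N) < ennreal \<delta>"
      using sets_lebesgue_outer_open[OF N(1) \<delta>(1)] by metis
    have Teq: "T = N \<union> (T - N)" using T(2) by auto
    have Tm: "T \<in> lmeasurable" using N(3) T(3) fmeasurable.Un Teq by metis
    have "measure lebesgue T \<le> measure lebesgue N + measure lebesgue (T - N)"
      by (subst Teq, rule measure_Un_le) (use N T in auto)
    also have "\<dots> < \<delta>"
      using T(3,4) N(2) \<delta>(1) by (simp add: emeasure_eq_measure2 ennreal_less_iff)
    finally have T\<delta>: "measure lebesgue T < \<delta>" .
    have "\<forall>t\<in>{a..b} - N. \<exists>d>0. \<forall>s. \<bar>s - t\<bar> < d \<longrightarrow> norm (f s - f t - (s - t) *\<^sub>R g t) \<le> e1 * \<bar>s - t\<bar>"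
      using has_vector_derivative_withinD[OF f' e1(1)] by blast
    then obtain d where d: "\<And>t. t \<in> {a..b} - N \<Longrightarrow> d t > 0"
      "\<And>t s. t \<in> {a..b} - N \<Longrightarrow> \<bar>s - t\<bar> < d t \<Longrightarrow> norm (f s - f t - (s - t) *\<^sub>R g t) \<le> e1 * \<bar>s - t\<bar>"
      unfolding bchoice_iff by metis
    define \<gamma> where "\<gamma> t = (if t \<in> N then T else if t \<in> {a..b} then ball t (d t) else UNIV)" for t
    have g: "gauge \<gamma>"
      unfolding gauge_def \<gamma>_def using T(1,2) d(1) by auto
    have p: "norm ((\<Sum>(x, k)\<in>p. measure lborel k *\<^sub>R h x) - (f b - f a)) < e"
      if p: "p tagged_division_of {a..b}" "\<gamma> fine p" for p
    proof -
      note tag = tagged_division_ofD[OF p(1)]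
      define pN where "pN = {(x, K) \<in> p. x \<in> N}"
      have sub: "pN \<subseteq> p" "p - pN \<subseteq> p" unfolding pN_def by auto
      have fin: "finite p" "finite pN" using tag(1) sub finite_subset by blast+
      have K: "\<exists>u v. K = {u..v} \<and> u \<le> x \<and> x \<le> v \<and> a \<le> u \<and> v \<le> b \<and> measure lborel K = v - u \<and> Sup K = v \<and> Inf K = u"
        if xK: "(x, K) \<in> p" for x K
      proof -
        obtain u v where "K = cbox u v" using tag(4)[OF xK] by blast
        then have "K = {u..v}" "u \<le> x" "x \<le> v" using tag(2)[OF xK] by auto
        moreover have "{u..v} \<subseteq> {a..b}" using tag(3)[OF xK] calculation by simp
        ultimately show ?thesis by (intro exI[of _ u] exI[of _ v]) auto
      qed
      have "(\<Sum>(x, k)\<in>p. measure lborel k *\<^sub>R h x) - (f b - f a)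
          = (\<Sum>(x, k)\<in>p. measure lborel k *\<^sub>R h x - (f (Sup k) - f (Inf k)))"
        using additive_tagged_division_1[OF \<open>a \<le> b\<close> p(1), of f] by (simp add: sum_subtractf case_prod_beta)
      also have "\<dots> = (\<Sum>(x, k)\<in>p - pN. measure lborel k *\<^sub>R h x - (f (Sup k) - f (Inf k)))
          + (\<Sum>(x, k)\<in>pN. measure lborel k *\<^sub>R h x - (f (Sup k) - f (Inf k)))"
        using sum.subset_diff[OF sub(1) fin(1)] .
      also have "norm \<dots> \<le> (\<Sum>(x, k)\<in>p - pN. e1 * measure lborel k) + (\<Sum>(x, k)\<in>pN. norm (f (Sup k) - f (Inf k)))"
      proof (rule norm_triangle_mono; rule sum_norm_le; clarify)
        fix x k assume xk: "(x, k) \<in> p" "(x, k) \<notin> pN"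
        then obtain u v where uv: "k = {u..v}" "u \<le> x" "x \<le> v" "a \<le> u" "v \<le> b" "measure lborel k = v - u" "Sup k = v" "Inf k = u"
          using K by blast
        have x: "x \<in> {a..b} - N" using xk uv unfolding pN_def by auto
        then have "k \<subseteq> ball x (d x)" using fineD[OF p(2) xk(1)] unfolding \<gamma>_def by auto
        moreover have "u \<in> k" "v \<in> k" using uv by auto
        ultimately have "u \<in> ball x (d x)" "v \<in> ball x (d x)" by blast+
        then have "\<bar>u - x\<bar> < d x" "\<bar>v - x\<bar> < d x" by (auto simp: dist_real_def abs_minus_commute)
        then have 1: "norm (f u - f x - (u - x) *\<^sub>R g x) \<le> e1 * \<bar>u - x\<bar>" "norm (f v - f x - (v - x) *\<^sub>R g x) \<le> e1 * \<bar>v - x\<bar>"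
          using d(2)[OF x] by auto
        have "h x = g x" using x unfolding h_def by simp
        then have "measure lborel k *\<^sub>R h x - (f (Sup k) - f (Inf k))
            = (f u - f x - (u - x) *\<^sub>R g x) - (f v - f x - (v - x) *\<^sub>R g x)"
          unfolding uv(6,7,8) by (simp add: algebra_simps)
        also have "norm \<dots> \<le> e1 * \<bar>u - x\<bar> + e1 * \<bar>v - x\<bar>"
          by (rule order_trans[OF norm_triangle_ineq4 add_mono[OF 1]])
        also have "\<dots> = e1 * measure lborel k" using uv by (simp add: algebra_simps)
        finally show "norm (measure lborel k *\<^sub>R h x - (f (Sup k) - f (Inf k))) \<le> e1 * measure lborel k" .
      next
        fix x k assume "(x, k) \<in> pN"
        then have "h x = 0" unfolding pN_def h_def by auto
        then show "norm (measure lborel k *\<^sub>R h x - (f (Sup k) - f (Inf k))) \<le> norm (f (Sup k) - f (Inf k))"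
          by (simp add: norm_minus_commute)
      qed
      also have "(\<Sum>(x, k)\<in>p - pN. e1 * measure lborel k) \<le> (\<Sum>(x, k)\<in>p. e1 * measure lborel k)"
        using fin sub e1(1) by (intro sum_mono2) (auto simp: case_prod_beta)
      also have "\<dots> = e1 * (b - a)"
        using additive_content_tagged_division[of p a b] p(1) \<open>a \<le> b\<close>
        by (simp add: case_prod_beta sum_distrib_left[symmetric])
      also have "(\<Sum>(x, k)\<in>pN. norm (f (Sup k) - f (Inf k))) < e / 2"
      proof -
        have pp: "pN tagged_partial_division_of {a..b}"
          using tagged_partial_division_subset[OF _ sub(1)] p(1) unfolding tagged_division_of_def by blast
        define S where "S = \<Union>(snd ` pN)"
        have pt: "pN tagged_division_of S" unfolding S_def by (rule tagged_partial_division_of_Union_self[OF pp])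
        have dv: "snd ` pN division_of S" unfolding S_def by (rule partial_division_of_tagged_division[OF pp])
        have S: "S \<subseteq> T" "S \<subseteq> {a..b}"
          unfolding S_def using fineD[OF p(2)] tag(3) sub(1) by (fastforce simp: pN_def \<gamma>_def)+
        have fN: "(\<Sum>(x, k)\<in>pN. norm (f (Sup k) - f (Inf k))) = (\<Sum>K\<in>snd ` pN. norm (f (Sup K) - f (Inf K)))"
        proof -
          \<comment> \<open>Passing from tagged pairs to their intervals can merge pairs only for
            intervals without interior, whose increment is 0. The empty set gets its own value
            because \<open>Sup {}\<close> and \<open>Inf {}\<close> carry no information.\<close>
          define w where "w K = (if K = {} then 0 else norm (f (Sup K) - f (Inf K)))" for K
          have w: "w K = norm (f (Sup K) - f (Inf K))" if "K \<in> snd ` pN" for K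
            using that K sub(1) unfolding w_def by fastforce
          have "(\<Sum>(x, k)\<in>pN. norm (f (Sup k) - f (Inf k))) = (\<Sum>(x, k)\<in>pN. w k)"
            using w by (intro sum.cong refl) force
          also have "\<dots> = (\<Sum>K\<in>snd ` pN. w K)"
          proof (rule sum.over_tagged_division_lemma[OF pt])
            fix u v :: real assume "box u v = {}"
            then have "v \<le> u" by auto
            then show "w (cbox u v) = 0" by (cases "u = v") (auto simp: w_def)
          qed
          finally show ?thesis using w by simp
        qed
        have "(\<Sum>K\<in>snd ` pN. Sup K - Inf K) = (\<Sum>K\<in>snd ` pN. measure lebesgue K)"
        proof (rule sum.cong[OF refl])
          fix J assume "J \<in> snd ` pN"
          then obtain x where "(x, J) \<in> p" using sub(1) by force
          from K[OF this] obtain u v where "J = {u..v}" "u \<le> v" "Sup J = v" "Inf J = u" by auto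
          then show "Sup J - Inf J = measure lebesgue J" by simp
        qed
        also have "\<dots> = measure lebesgue S" using content_division[OF dv] by simp
        also have "\<dots> \<le> measure lebesgue T"
          using S(1) Tm lmeasurable_division[OF dv] by (intro measure_mono_fmeasurable) (auto simp: fmeasurableD)
        finally show ?thesis unfolding fN using \<delta>(2)[OF dv S(2)] T\<delta> by linarith
      qed
      finally show ?thesis using e1(2) by linarith
    qed
    show "\<exists>\<gamma>. gauge \<gamma> \<and> (\<forall>\<D>. \<D> tagged_division_of {a..b} \<and> \<gamma> fine \<D> \<longrightarrow>
        norm ((\<Sum>(x, k)\<in>\<D>. measure lborel k *\<^sub>R h x) - (f b - f a)) < e)"
      by (rule exI[of _ \<gamma>]) (use g p in simp)
  qed
  from has_integral_spike[OF \<open>negligible N\<close> _ this] show ?thesis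
    by (simp add: h_def)
qed

section \<open>Absolute continuity under Lipschitz changes of variables\<close>

text \<open>A system of intervals with small total length and small total increment of
  \<open>g\<close> has small total increment of \<open>f\<close>. The term with the length of the
  interval admits changes of variables that depend on time.\<close>

lemma absolutely_continuous_on_interval_le:
  assumes ac: "absolutely_continuous_on_interval a b g"
    and le: "\<And>s t. s \<in> {a..b} \<Longrightarrow> t \<in> {a..b} \<Longrightarrow> norm (f t - f s) \<le> K * (norm (g t - g s) + \<bar>t - s\<bar>)"
    and "K \<ge> 0"
  shows "absolutely_continuous_on_interval a b f"
  unfolding absolutely_continuous_on_interval_def
proof (intro allI impI)
  fix e :: real assume "e > 0"
  define e' where "e' = e / (2 * (K + 1))"
  have e': "e' > 0" "K * (2 * e') < e" using \<open>e > 0\<close> \<open>K \<ge> 0\<close> by (auto simp: e'_def field_simps)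
  obtain \<delta> where \<delta>: "\<delta> > 0" "\<And>D S. D division_of S \<Longrightarrow> S \<subseteq> {a..b} \<Longrightarrow> (\<Sum>K\<in>D. Sup K - Inf K) < \<delta> \<Longrightarrow>
      (\<Sum>K\<in>D. norm (g (Sup K) - g (Inf K))) < e'"
    using ac e'(1) unfolding absolutely_continuous_on_interval_def by metis
  show "\<exists>\<delta>>0. \<forall>D S. D division_of S \<and> S \<subseteq> {a..b} \<and> (\<Sum>K\<in>D. Sup K - Inf K) < \<delta> \<longrightarrow>
      (\<Sum>K\<in>D. norm (f (Sup K) - f (Inf K))) < e"
  proof (intro exI[of _ "min \<delta> e'"] conjI allI impI; (elim conjE)?)
    fix D S assume D: "D division_of S" "S \<subseteq> {a..b}" "(\<Sum>K\<in>D. Sup K - Inf K) < min \<delta> e'"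
    have I: "Inf J \<le> Sup J \<and> Inf J \<in> {a..b} \<and> Sup J \<in> {a..b}" if J: "J \<in> D" for J
    proof -
      obtain u v where uv: "J = cbox u v" using division_ofD(4)[OF D(1) J] by blast
      have "J \<noteq> {}" "J \<subseteq> {a..b}" using division_ofD(2,3)[OF D(1) J] D(2) by auto
      then show ?thesis using uv by auto
    qed
    have "(\<Sum>J\<in>D. norm (f (Sup J) - f (Inf J))) \<le> (\<Sum>J\<in>D. K * (norm (g (Sup J) - g (Inf J)) + (Sup J - Inf J)))"
    proof (rule sum_mono)
      fix J assume "J \<in> D"
      then show "norm (f (Sup J) - f (Inf J)) \<le> K * (norm (g (Sup J) - g (Inf J)) + (Sup J - Inf J))"
        using I[of J] le[of "Inf J" "Sup J"] by simp
    qed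
    also have "\<dots> = K * ((\<Sum>J\<in>D. norm (g (Sup J) - g (Inf J))) + (\<Sum>J\<in>D. Sup J - Inf J))"
      by (simp add: sum_distrib_left[symmetric] sum.distrib)
    also have "\<dots> \<le> K * (e' + e')"
      using \<delta>(2)[OF D(1,2)] D(3) \<open>K \<ge> 0\<close> by (intro mult_left_mono add_mono) auto
    finally show "(\<Sum>J\<in>D. norm (f (Sup J) - f (Inf J))) < e" using e'(2) by simp
  qed (use \<delta>(1) e'(1) in auto)
qed

lemma absolutely_continuous_on_interval_const: "absolutely_continuous_on_interval a b (\<lambda>t. c)"
  unfolding absolutely_continuous_on_interval_def by (auto intro!: exI[of _ 1])

lemma lipschitz_imp_absolutely_continuous:
  assumes "\<And>s t. s \<in> {a..b} \<Longrightarrow> t \<in> {a..b} \<Longrightarrow> norm (f t - f s) \<le> K * \<bar>t - s\<bar>" "K \<ge> 0"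
  shows "absolutely_continuous_on_interval a b f"
  by (rule absolutely_continuous_on_interval_le[OF absolutely_continuous_on_interval_const[of a b 0]])
    (use assms in auto)

lemma absolutely_continuous_imp_continuous_on:
  assumes "absolutely_continuous_on_interval a b f"
  shows "continuous_on {a..b} f"
  unfolding continuous_on_iff
proof (intro ballI allI impI)
  fix t e :: real assume t: "t \<in> {a..b}" "e > 0"
  then obtain \<delta> where \<delta>: "\<delta> > 0" "\<And>D S. D division_of S \<Longrightarrow> S \<subseteq> {a..b} \<Longrightarrow> (\<Sum>K\<in>D. Sup K - Inf K) < \<delta> \<Longrightarrow>
      (\<Sum>K\<in>D. norm (f (Sup K) - f (Inf K))) < e"
    using assms unfolding absolutely_continuous_on_interval_def by metis
  have *: "norm (f v - f u) < e" if "u \<le> v" "u \<in> {a..b}" "v \<in> {a..b}" "v - u < \<delta>" for u v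
  proof -
    have "{cbox u v} division_of (cbox u v)" by (rule division_of_self) (use that in auto)
    from \<delta>(2)[OF this] show ?thesis using that by auto
  qed
  show "\<exists>d>0. \<forall>s\<in>{a..b}. dist s t < d \<longrightarrow> dist (f s) (f t) < e"
  proof (intro exI[of _ \<delta>] conjI ballI impI)
    fix s assume s: "s \<in> {a..b}" "dist s t < \<delta>"
    show "dist (f s) (f t) < e"
    proof (cases "s \<le> t")
      case True
      then show ?thesis using *[of s t] s t(1) by (simp add: dist_norm norm_minus_commute)
    next
      case False
      then show ?thesis using *[of t s] s t(1) by (simp add: dist_norm)
    qed
  qed (rule \<delta>(1))
qed

text \<open>The exceptional set is covered, in the sense of Vitali, by intervals on which the difference
  quotient is off by more than \<open>1/k\<close>; by Henstock's lemma disjoint such intervals have small total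
  length.\<close>

lemma indefinite_integral_derivative_ae:
  fixes u U :: "real \<Rightarrow> real"
  assumes int: "\<And>s t. s \<le> t \<Longrightarrow> (u has_integral (U t - U s)) {s..t}"
  shows "\<exists>N. negligible N \<and> (\<forall>t. t \<notin> N \<longrightarrow> (U has_real_derivative u t) (at t))"
proof -
  define S where "S k = {t. \<bar>t\<bar> < real k \<and> (\<forall>d>0. \<exists>s. s \<noteq> t \<and> \<bar>s - t\<bar> < d \<and> \<bar>U s - U t - (s - t) * u t\<bar> * real k > \<bar>s - t\<bar>)}" for k :: nat
  have "negligible (S k)" for k
    unfolding negligible_outer_le
  proof (intro allI impI)
    fix e :: real assume "e > 0"
    show "\<exists>T. S k \<subseteq> T \<and> T \<in> lmeasurable \<and> measure lebesgue T \<le> e"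
    proof (cases "k = 0")
      case True
      then have "S k = {}" unfolding S_def by auto
      then show ?thesis using \<open>e > 0\<close> by (intro exI[of _ "{}"]) auto
    next
      case False
      then have k: "real k > 0" by simp
      have "u integrable_on cbox (- real k) (real k)" using int[of "- real k" "real k"] by (auto simp: integrable_on_def)
      moreover have "e / real k > 0" using \<open>e > 0\<close> k by simp
      ultimately obtain \<gamma> where \<gamma>: "gauge \<gamma>"
        "\<And>p. p tagged_partial_division_of (cbox (- real k) (real k)) \<Longrightarrow> \<gamma> fine p \<Longrightarrow>
             (\<Sum>(x, K)\<in>p. norm (measure lborel K *\<^sub>R u x - integral K u)) < e / real k"
        by (rule Henstock_lemma) blast
      \<comment> \<open>Centre and radius of the interval between the tag \<open>fst p\<close> and
        the nearby point \<open>snd p\<close>; the tag is an endpoint, as the difference quotients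
        require.\<close>
      define c r where "c p = (fst p + snd p) / 2" and "r p = \<bar>fst p - snd p\<bar> / 2" for p :: "real \<times> real"
      define X where "X = {p. snd p \<noteq> fst p \<and> cball (c p) (r p) \<subseteq> \<gamma> (fst p) \<and> cball (c p) (r p) \<subseteq> {- real k..real k}
        \<and> \<bar>U (snd p) - U (fst p) - (snd p - fst p) * u (fst p)\<bar> * real k > \<bar>snd p - fst p\<bar>}"
      have cb: "cball (c p) (r p) = {min (fst p) (snd p)..max (fst p) (snd p)}" for p
        unfolding cball_eq_atLeastAtMost c_def r_def by (auto simp: min_def max_def abs_if field_simps)
      obtain C where C: "countable C" "C \<subseteq> X" "pairwise (\<lambda>i j. disjnt (cball (c i) (r i)) (cball (c j) (r j))) C"
        "negligible (S k - (\<Union>i\<in>C. cball (c i) (r i)))"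
      proof (rule Vitali_covering_theorem_cballs[of X r "S k" c])
        show "0 < r p" if "p \<in> X" for p using that unfolding X_def r_def by auto
      next
        fix x d :: real assume x: "x \<in> S k" "d > 0"
        have xk: "\<bar>x\<bar> < k" using x(1) unfolding S_def by auto
        have "open (\<gamma> x)" "x \<in> \<gamma> x" using \<gamma>(1) unfolding gauge_def by auto
        then obtain \<rho> where \<rho>: "\<rho> > 0" "ball x \<rho> \<subseteq> \<gamma> x" using openE by blast
        have "min d (min \<rho> (k - \<bar>x\<bar>)) > 0" using x(2) \<rho>(1) xk by simp
        then obtain s where s: "s \<noteq> x" "\<bar>s - x\<bar> < min d (min \<rho> (k - \<bar>x\<bar>))" "\<bar>U s - U x - (s - x) * u x\<bar> * real k > \<bar>s - x\<bar>"
          using x(1) unfolding S_def by blast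
        have "cball (c (x, s)) (r (x, s)) \<subseteq> ball x \<rho>"
          unfolding cb using s(2) by (auto simp: dist_real_def min_def max_def abs_if split: if_splits)
        moreover have "cball (c (x, s)) (r (x, s)) \<subseteq> {- real k..real k}"
          unfolding cb using s(2) xk by (auto simp: min_def max_def abs_if split: if_splits)
        ultimately have "(x, s) \<in> X" unfolding X_def using s \<rho>(2) by auto
        moreover have "x \<in> cball (c (x, s)) (r (x, s))" unfolding cb by auto
        moreover have "r (x, s) < d" unfolding r_def using s(2) by (auto simp: abs_if split: if_splits)
        ultimately show "\<exists>i. i \<in> X \<and> x \<in> cball (c i) (r i) \<and> r i < d" by blast
      qed blast
      let ?B = "\<lambda>i. cball (c i) (r i)"
      \<comment> \<open>Henstock's lemma speaks of finite systems; the bound does not depend on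
        \<open>F\<close> and so passes to the countable union. The accuracy \<open>e / k\<close>
        absorbs the factor \<open>k\<close> that appears when the defining inequality of
        \<open>X\<close> is solved for the length.\<close>
      have bound: "measure lebesgue (\<Union>i\<in>F. ?B i) \<le> e" if F: "F \<subseteq> C" "finite F" for F
      proof -
        define p where "p = (\<lambda>i. (fst i, ?B i)) ` F"
        have inj: "inj_on (\<lambda>i. (fst i, ?B i)) F"
        proof (rule inj_onI)
          fix i j assume ij: "i \<in> F" "j \<in> F" "(fst i, ?B i) = (fst j, ?B j)"
          then have "\<not> disjnt (?B i) (?B j)" using cb[of i] unfolding disjnt_def by auto
          then show "i = j" using C(3) ij F(1) unfolding pairwise_def by blast
        qed
        have pd: "p tagged_partial_division_of (cbox (- real k) (real k))"
          unfolding tagged_partial_division_of_def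
        proof (intro conjI allI impI)
          show "finite p" unfolding p_def using F(2) by simp
          fix x K assume xK: "(x, K) \<in> p"
          then obtain i where i: "i \<in> F" "x = fst i" "K = ?B i" unfolding p_def by auto
          show "x \<in> K" unfolding i cb by auto
          show "K \<subseteq> cbox (- real k) (real k)" using i F(1) C(2) unfolding X_def by auto
          show "\<exists>a b. K = cbox a b" unfolding i cb by (metis box_real(2))
        next
          fix x K x' K' assume xK': "(x, K) \<in> p \<and> (x', K') \<in> p \<and> (x, K) \<noteq> (x', K')"
          then obtain i where i: "i \<in> F" "x = fst i" "K = ?B i" unfolding p_def by auto
          from xK' obtain j where j: "j \<in> F" "x' = fst j" "K' = ?B j" unfolding p_def by auto
          have "i \<noteq> j" using xK' i j by auto
          then have "disjnt K K'" using C(3) i j F(1) unfolding pairwise_def by blast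
          then show "interior K \<inter> interior K' = {}" using interior_subset unfolding disjnt_def by blast
        qed
        have fine: "\<gamma> fine p" unfolding fine_def p_def using F(1) C(2) unfolding X_def by auto
        have ge: "measure lebesgue (?B i) \<le> k * norm (measure lborel (?B i) *\<^sub>R u (fst i) - integral (?B i) u)" if i: "i \<in> F" for i
        proof -
          define m M where "m = min (fst i) (snd i)" and "M = max (fst i) (snd i)"
          have B: "?B i = {m..M}" "m \<le> M" unfolding cb m_def M_def by auto
          have ii: "integral (?B i) u = U M - U m" unfolding B(1) using int[OF B(2)] by (rule integral_unique)
          have ci: "measure lborel (?B i) = M - m" unfolding B(1) using B(2) by simp
          have "norm (measure lborel (?B i) *\<^sub>R u (fst i) - integral (?B i) u) = \<bar>U (snd i) - U (fst i) - (snd i - fst i) * u (fst i)\<bar>"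
            unfolding ii ci unfolding m_def M_def
            by (cases "fst i \<le> snd i") (simp_all add: algebra_simps abs_if)
          moreover have "measure lebesgue (?B i) = \<bar>snd i - fst i\<bar>" unfolding B(1) using B(2) by (auto simp: m_def M_def)
          moreover have "i \<in> X" using i F(1) C(2) by blast
          ultimately show ?thesis unfolding X_def by (simp add: mult.commute less_imp_le)
        qed
        have "measure lebesgue (\<Union>i\<in>F. ?B i) \<le> (\<Sum>i\<in>F. measure lebesgue (?B i))"
          by (rule measure_UNION_le[OF F(2)]) auto
        also have "\<dots> \<le> (\<Sum>i\<in>F. k * norm (measure lborel (?B i) *\<^sub>R u (fst i) - integral (?B i) u))"
          by (rule sum_mono[OF ge])
        also have "\<dots> = k * (\<Sum>(x, K)\<in>p. norm (measure lborel K *\<^sub>R u x - integral K u))"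
          unfolding p_def sum.reindex[OF inj] by (simp add: sum_distrib_left)
        also have "\<dots> \<le> k * (e / k)" using \<gamma>(2)[OF pd fine] k by (intro mult_left_mono) auto
        also have "\<dots> = e" using k by simp
        finally show ?thesis .
      qed
      define T where "T = (\<Union>i\<in>C. ?B i)"
      have T: "T \<in> lmeasurable" "measure lebesgue T \<le> e"
        unfolding T_def using fmeasurable_UN_bound[OF C(1) _ bound] measure_UN_bound[OF C(1) _ bound] by auto
      have N: "S k - T \<in> lmeasurable" "measure lebesgue (S k - T) = 0"
        using C(4) negligible_iff_measure unfolding T_def by auto
      show ?thesis
      proof (intro exI[of _ "T \<union> (S k - T)"] conjI)
        show "T \<union> (S k - T) \<in> lmeasurable" using T N by (intro fmeasurable.Un)
        have "measure lebesgue (T \<union> (S k - T)) \<le> measure lebesgue T + measure lebesgue (S k - T)"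
          using T N by (intro measure_Un_le) (auto simp: fmeasurableD)
        then show "measure lebesgue (T \<union> (S k - T)) \<le> e" using T N by simp
      qed auto
    qed
  qed
  then have "negligible (\<Union>k. S k)" by (intro negligible_countable_Union) auto
  moreover have "(U has_real_derivative u t) (at t)" if t: "t \<notin> (\<Union>k. S k)" for t
  proof -
    have "\<exists>d>0. \<forall>s. \<bar>s - t\<bar> < d \<longrightarrow> \<bar>U s - U t - (s - t) * u t\<bar> \<le> e * \<bar>s - t\<bar>" if "e > 0" for e
    proof -
      obtain k :: nat where k: "real k > max \<bar>t\<bar> (1 / e)" using reals_Archimedean2 by blast
      then have k0: "real k > 0" "1 / e < real k" by auto
      have "t \<notin> S k" using t by blast
      then have "\<exists>d>0. \<not> (\<exists>s. s \<noteq> t \<and> \<bar>s - t\<bar> < d \<and> \<bar>U s - U t - (s - t) * u t\<bar> * real k > \<bar>s - t\<bar>)"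
        unfolding S_def using k by simp
      then obtain d where d: "d > 0" "\<And>s. s \<noteq> t \<Longrightarrow> \<bar>s - t\<bar> < d \<Longrightarrow> \<bar>U s - U t - (s - t) * u t\<bar> * real k \<le> \<bar>s - t\<bar>"
        by (meson not_less)
      have "\<bar>U s - U t - (s - t) * u t\<bar> \<le> e * \<bar>s - t\<bar>" if s: "\<bar>s - t\<bar> < d" for s
      proof (cases "s = t")
        case False
        have "\<bar>U s - U t - (s - t) * u t\<bar> * 1 \<le> \<bar>U s - U t - (s - t) * u t\<bar> * (e * real k)"
          using k0 \<open>e > 0\<close> by (intro mult_left_mono) (auto simp: field_simps)
        also have "\<dots> = e * (\<bar>U s - U t - (s - t) * u t\<bar> * real k)" by simp
        also have "\<dots> \<le> e * \<bar>s - t\<bar>" using d(2)[OF False s] \<open>e > 0\<close> by (intro mult_left_mono) auto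
        finally show ?thesis by simp
      qed auto
      then show ?thesis using d(1) by blast
    qed
    then have "(U has_derivative (\<lambda>h. h * u t)) (at t)"
      unfolding has_derivative_at_alt using bounded_linear_mult_left by auto
    then show ?thesis unfolding has_field_derivative_def by (simp add: mult_commute_abs)
  qed
  ultimately show ?thesis by blast
qed

section \<open>Maximal solutions\<close>

text \<open>The equation is local and all the intervals share the point \<open>r\<close>, so their
  union is an interval, and on each piece \<open>x\<close> agrees with a solution.\<close>

lemma classical_solution_union:
  fixes x :: "real \<Rightarrow> 's::euclidean_space"
  assumes P_local: "\<And>x y t J. open J \<Longrightarrow> t \<in> J \<Longrightarrow> (\<And>s. s \<in> J \<Longrightarrow> x s = y s) \<Longrightarrow> P x t \<Longrightarrow> P y t"
    and "\<And>J. J \<in> \<J> \<Longrightarrow> \<exists>y. classical_solution M P J y \<and> r \<in> J \<and> (\<forall>t\<in>J. y t = x t)"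
  shows "classical_solution M P (\<Union>\<J>) x"
  unfolding classical_solution_def
proof (intro conjI ballI)
  show "open (\<Union>\<J>)" using assms(2) unfolding classical_solution_def by blast
  have "is_interval J" "r \<in> J" if "J \<in> \<J>" for J using assms(2)[OF that] unfolding classical_solution_def by blast+
  then show "is_interval (\<Union>\<J>)"
    unfolding is_interval_connected_1 by (cases "\<J> = {}") (simp, rule connected_Union, blast+)
  fix t assume "t \<in> \<Union>\<J>"
  then obtain J y where J: "t \<in> J" "classical_solution M P J y" "\<And>t. t \<in> J \<Longrightarrow> y t = x t" using assms(2) by blast
  then have "y t \<in> M" "P y t" "open J" unfolding classical_solution_def by blast+
  then show "x t \<in> M" "P x t" using J P_local[of J t y x] by auto
qed

text \<open>Zorn's lemma on graphs: inclusion of graphs is extension of both the interval and the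
  curve, and the graph over the interval discards the irrelevant values outside. A chain is a
  consistent family, so its union is again the graph of a solution.\<close>

lemma maximal_classical_solution_exists:
  fixes x0 :: "real \<Rightarrow> 's::euclidean_space"
  assumes P_local: "\<And>x y t J. open J \<Longrightarrow> t \<in> J \<Longrightarrow> (\<And>s. s \<in> J \<Longrightarrow> x s = y s) \<Longrightarrow> P x t \<Longrightarrow> P y t"
    and "classical_solution M P J0 x0" "t0 \<in> J0"
  shows "\<exists>J x. maximal_solution (classical_solution M P) t0 (x0 t0) J x"
proof -
  define gr where "gr J x = (\<lambda>t. (t, x t)) ` J" for J :: "real set" and x :: "real \<Rightarrow> 's"
  define A where "A = {gr J x | J x. classical_solution M P J x \<and> t0 \<in> J \<and> x t0 = x0 t0}"
  have gr_mem: "(t, y) \<in> gr J x \<longleftrightarrow> t \<in> J \<and> y = x t" for t y J x unfolding gr_def by auto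
  have gr_sub: "gr J x \<subseteq> gr J' x' \<longleftrightarrow> J \<subseteq> J' \<and> (\<forall>t\<in>J. x' t = x t)" for J x J' x'
    unfolding gr_def by auto
  have "\<exists>G\<in>A. \<forall>X\<in>A. G \<subseteq> X \<longrightarrow> X = G"
  proof (rule subset_Zorn_nonempty)
    show "A \<noteq> {}" using assms(2,3) unfolding A_def by blast
    fix \<C> assume \<C>: "\<C> \<noteq> {}" "subset.chain A \<C>"
    define x where "x t = (SOME y. (t, y) \<in> \<Union>\<C>)" for t
    define \<J> where "\<J> = {J. \<exists>y. gr J y \<in> \<C> \<and> classical_solution M P J y \<and> t0 \<in> J \<and> y t0 = x0 t0}"
    have mem: "\<exists>J y. G = gr J y \<and> classical_solution M P J y \<and> t0 \<in> J \<and> y t0 = x0 t0" if "G \<in> \<C>" for G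
      using \<C>(2) that unfolding subset.chain_def A_def by blast
    have x: "x t = y t" if "gr J y \<in> \<C>" "t \<in> J" for J y t
    proof -
      have "(t, y t) \<in> \<Union>\<C>" using that gr_mem by blast
      then have "(t, x t) \<in> \<Union>\<C>" unfolding x_def by (rule someI)
      then obtain G where G: "G \<in> \<C>" "(t, x t) \<in> G" by blast
      moreover have "G \<subseteq> gr J y \<or> gr J y \<subseteq> G" using \<C>(2) that(1) G(1) unfolding subset.chain_def by blast
      moreover obtain J' y' where "G = gr J' y'" using mem[OF G(1)] by blast
      ultimately show ?thesis using that(2) gr_mem by (metis subsetD)
    qed
    have sol: "classical_solution M P (\<Union>\<J>) x"
    proof (rule classical_solution_union[where r = t0])
      fix J assume "J \<in> \<J>"
      then obtain y where "gr J y \<in> \<C>" "classical_solution M P J y" "t0 \<in> J" unfolding \<J>_def by blast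
      then show "\<exists>y. classical_solution M P J y \<and> t0 \<in> J \<and> (\<forall>t\<in>J. y t = x t)" using x by auto
    qed (rule P_local)
    have "\<Union>\<C> = gr (\<Union>\<J>) x"
    proof (intro equalityI subsetI)
      fix p assume "p \<in> \<Union>\<C>"
      then obtain G where G: "G \<in> \<C>" "p \<in> G" by blast
      obtain J y where J: "G = gr J y" "classical_solution M P J y" "t0 \<in> J" "y t0 = x0 t0" using mem[OF G(1)] by blast
      then have "J \<in> \<J>" unfolding \<J>_def using G(1) by blast
      moreover obtain t where "t \<in> J" "p = (t, y t)" using G(2) J(1) unfolding gr_def by blast
      ultimately show "p \<in> gr (\<Union>\<J>) x" using x G(1) J(1) gr_mem by force
    next
      fix p assume "p \<in> gr (\<Union>\<J>) x"
      then obtain t J y where "p = (t, x t)" "t \<in> J" "gr J y \<in> \<C>" unfolding gr_def \<J>_def by blast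
      then show "p \<in> \<Union>\<C>" using x gr_mem by (metis UnionI)
    qed
    moreover have "t0 \<in> \<Union>\<J> \<and> x t0 = x0 t0"
    proof -
      obtain G where "G \<in> \<C>" using \<C>(1) by blast
      then obtain J y where J: "gr J y \<in> \<C>" "classical_solution M P J y" "t0 \<in> J" "y t0 = x0 t0" using mem by blast
      then show ?thesis unfolding \<J>_def using x by auto
    qed
    ultimately show "\<Union>\<C> \<in> A" unfolding A_def using sol by blast
  qed
  then obtain G where G: "G \<in> A" "\<And>X. X \<in> A \<Longrightarrow> G \<subseteq> X \<Longrightarrow> X = G" by blast
  then obtain J x where J: "G = gr J x" "classical_solution M P J x" "t0 \<in> J" "x t0 = x0 t0" unfolding A_def by blast
  have "J' = J" if J': "classical_solution M P J' y" "J \<subseteq> J'" "\<forall>t\<in>J. y t = x t" for J' y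
  proof -
    have "t0 \<in> J'" "y t0 = x0 t0" using J' J by auto
    then have "gr J' y \<in> A" unfolding A_def using J'(1) by blast
    then have "gr J' y = gr J x" using G(2) J(1) J' gr_sub by auto
    then show ?thesis using gr_sub by blast
  qed
  then show ?thesis
    unfolding maximal_solution_def using J by (intro exI[of _ J] exI[of _ x]) auto
qed

section \<open>Continuation of maximal solutions\<close>

abbreviation ode_solution :: "'s::euclidean_space set \<Rightarrow> (real \<Rightarrow> 's \<Rightarrow> 's) \<Rightarrow> real set \<Rightarrow> (real \<Rightarrow> 's) \<Rightarrow> bool" where
  "ode_solution M G \<equiv> classical_solution M (\<lambda>x t. (x has_vector_derivative G t (x t)) (at t))"

lemma has_vector_derivative_local:
  "open J \<Longrightarrow> t \<in> J \<Longrightarrow> (\<And>s. s \<in> J \<Longrightarrow> x s = y s) \<Longrightarrow>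
    (x has_vector_derivative G t (x t)) (at t) \<Longrightarrow> (y has_vector_derivative G t (y t)) (at t)"
  using has_vector_derivative_transform_within_open[of x "G t (x t)" t J y] by auto

text \<open>A curve confined to a compact set has bounded velocity up to \<open>b\<close>, hence a
  limit there, which lies in the compact set. A local solution started at the limit continues the
  curve past \<open>b\<close>, contradicting maximality if \<open>b\<close> were outside
  \<open>J\<close>.\<close>

lemma maximal_solution_extends:
  fixes z :: "real \<Rightarrow> 's::euclidean_space"
  assumes max: "maximal_solution (ode_solution M G) t0 x0 J z"
    and cont: "continuous_on (UNIV \<times> M) (\<lambda>(t, x). G t x)"
    and loc: "\<And>t1 x1. x1 \<in> M \<Longrightarrow> \<exists>\<epsilon>>0. \<exists>y. y t1 = x1 \<and> (\<forall>t\<in>{t1-\<epsilon><..<t1+\<epsilon>}. y t \<in> M \<and> (y has_vector_derivative G t (y t)) (at t))"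
    and K: "compact K" "K \<subseteq> M" "\<And>t. t \<in> {t0..<b} \<Longrightarrow> z t \<in> K" and J: "{t0..<b} \<subseteq> J" "t0 \<le> b"
  shows "b \<in> J"
proof (rule ccontr)
  assume "b \<notin> J"
  have sol: "ode_solution M G J z" "t0 \<in> J" and mx: "\<And>J' y. ode_solution M G J' y \<Longrightarrow> J \<subseteq> J' \<Longrightarrow> (\<forall>t\<in>J. y t = z t) \<Longrightarrow> J' = J"
    using max unfolding maximal_solution_def by auto
  have Jo: "open J" "is_interval J" and zJ: "\<And>t. t \<in> J \<Longrightarrow> z t \<in> M" "\<And>t. t \<in> J \<Longrightarrow> (z has_vector_derivative G t (z t)) (at t)"
    using sol(1) unfolding classical_solution_def by auto
  have "t0 < b" using J(2) sol(2) \<open>b \<notin> J\<close> by (cases "t0 = b") auto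
  have Jb: "t < b" if "t \<in> J" for t
  proof (rule ccontr)
    assume "\<not> t < b"
    then have "b \<in> J" using mem_is_interval_1_I[OF Jo(2) sol(2) that] \<open>t0 < b\<close> by auto
    then show False using \<open>b \<notin> J\<close> by simp
  qed
  have "compact ((\<lambda>(t, x). G t x) ` ({t0..b} \<times> K))"
    using K(2) by (intro compact_continuous_image continuous_on_subset[OF cont] compact_Times K(1)) auto
  then have "bounded ((\<lambda>(t, x). G t x) ` ({t0..b} \<times> K))" by (rule compact_imp_bounded)
  then obtain B where B: "B > 0" "\<And>y. y \<in> (\<lambda>(t, x). G t x) ` ({t0..b} \<times> K) \<Longrightarrow> norm y \<le> B"
    unfolding bounded_pos by metis
  have zlip: "norm (z s - z t) \<le> B * \<bar>s - t\<bar>" if "s \<in> {t0..<b}" "t \<in> {t0..<b}" for s t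
  proof (rule has_vector_derivative_lipschitz[of "{t0..<b}" z "\<lambda>t. G t (z t)"])
    fix t assume t: "t \<in> {t0..<b}"
    show "(z has_vector_derivative G t (z t)) (at t within {t0..<b})"
      using zJ(2) J(1) t has_vector_derivative_at_within by blast
    show "norm (G t (z t)) \<le> B" using K(3)[OF t] t by (intro B(2) image_eqI[of _ _ "(t, z t)"]) auto
  qed (use that in auto)
  have "uniformly_continuous_on {t0..<b} z"
    unfolding uniformly_continuous_on_def
  proof (intro allI impI)
    fix e :: real assume "e > 0"
    show "\<exists>d>0. \<forall>x\<in>{t0..<b}. \<forall>x'\<in>{t0..<b}. dist x' x < d \<longrightarrow> dist (z x') (z x) < e"
    proof (intro exI[of _ "e / B"] conjI ballI impI)
      fix x x' assume x: "x \<in> {t0..<b}" "x' \<in> {t0..<b}" "dist x' x < e / B"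
      have "norm (z x' - z x) \<le> B * \<bar>x' - x\<bar>" using zlip x by blast
      also have "\<dots> < B * (e / B)" using x(3) B(1) unfolding dist_real_def by (rule mult_strict_left_mono)
      finally show "dist (z x') (z x) < e" using B(1) by (simp add: dist_norm)
    qed (use \<open>e > 0\<close> B in auto)
  qed
  moreover have bcl: "b \<in> closure {t0..<b}" using \<open>t0 < b\<close> by simp
  ultimately obtain zb where zb: "(z \<longlongrightarrow> zb) (at b within {t0..<b})"
    using uniformly_continuous_on_extension_at_closure by blast
  have nb: "at b within {t0..<b} \<noteq> bot"
    using \<open>t0 < b\<close> bcl by (metis atLeastLessThan_iff closure_def Un_iff less_irrefl mem_Collect_eq trivial_limit_within)
  have "zb \<in> K"
    by (rule Lim_in_closed_set[OF compact_imp_closed[OF K(1)] _ nb zb])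
      (use K(3) in \<open>auto simp: eventually_at_filter\<close>)
  define zz where "zz t = (if t < b then z t else zb)" for t
  have zzc: "continuous_on {t0..b} zz"
    unfolding continuous_on_eq_continuous_within
  proof
    fix t assume t: "t \<in> {t0..b}"
    show "continuous (at t within {t0..b}) zz"
    proof (cases "t = b")
      case True
      have "{t0..b} - {b} = {t0..<b} - {b}" by auto
      then have "at b within {t0..b} = at b within {t0..<b}" by (metis at_within_def)
      then have "(zz \<longlongrightarrow> zb) (at b within {t0..b})"
        using Lim_transform_within[OF zb, of 1 zz] by (auto simp: zz_def)
      then show ?thesis unfolding True continuous_within by (simp add: zz_def)
    next
      case False
      then have t': "t \<in> {t0..<b}" using t by auto
      then have "(z has_vector_derivative G t (z t)) (at t)" using zJ(2) J(1) by blast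
      then have "(zz has_vector_derivative G t (z t)) (at t)"
        by (rule has_vector_derivative_transform_within_open[of _ _ _ "{..<b}"]) (use t' in \<open>auto simp: zz_def\<close>)
      then show ?thesis using has_vector_derivative_continuous continuous_at_imp_continuous_at_within by blast
    qed
  qed
  have zzK: "zz t \<in> K" if "t \<in> {t0..b}" for t using K(3) that \<open>zb \<in> K\<close> unfolding zz_def by auto
  define g where "g t = G t (zz t)" for t
  have gc: "continuous_on {t0..b} g"
  proof -
    have "continuous_on {t0..b} (\<lambda>t. (t, zz t))" by (intro continuous_intros zzc)
    moreover have "(\<lambda>t. (t, zz t)) ` {t0..b} \<subseteq> UNIV \<times> M" using zzK K(2) by fastforce
    ultimately show ?thesis unfolding g_def using continuous_on_compose2[OF cont] by fastforce
  qed
  \<comment> \<open>At \<open>b\<close> only continuity of \<open>zz\<close> is known; the integral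
    equation supplies its one-sided derivative there.\<close>
  have zz_eq: "zz t = zz t0 + integral {t0..t} g" if t: "t \<in> {t0..b}" for t
  proof -
    have "(g has_integral zz t - zz t0) {t0..t}"
    proof (rule fundamental_theorem_of_calculus_interior)
      show "continuous_on {t0..t} zz" using zzc t continuous_on_subset[of "{t0..b}" zz "{t0..t}"] by auto
      fix s assume s: "s \<in> {t0<..<t}"
      then have "s \<in> J" using J(1) t by (auto simp: subset_iff)
      then have "(z has_vector_derivative G s (z s)) (at s)" by (rule zJ(2))
      moreover have "g s = G s (z s)" using s t unfolding g_def zz_def by auto
      ultimately show "(zz has_vector_derivative g s) (at s)"
        using has_vector_derivative_transform_within_open[of z "G s (z s)" s "{..<b}" zz] s t by (auto simp: zz_def)
    qed (use t in auto)
    then show ?thesis by (simp add: integral_unique)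
  qed
  have gb: "g b = G b zb" unfolding g_def zz_def by simp
  have "((\<lambda>t. zz t0 + integral {t0..t} g) has_vector_derivative G b zb) (at b within {t0..b})"
    using integral_has_vector_derivative[OF gc, of b] \<open>t0 < b\<close>
    by (auto intro!: derivative_eq_intros simp: gb)
  then have zzb: "(zz has_vector_derivative G b zb) (at b within {t0..b})"
  proof (rule has_vector_derivative_transform[rotated 2])
    show "b \<in> {t0..b}" using \<open>t0 < b\<close> by simp
  qed (rule zz_eq)
  obtain \<epsilon> y where y: "\<epsilon> > 0" "y b = zb" "\<And>t. t \<in> {b-\<epsilon><..<b+\<epsilon>} \<Longrightarrow> y t \<in> M"
    "\<And>t. t \<in> {b-\<epsilon><..<b+\<epsilon>} \<Longrightarrow> (y has_vector_derivative G t (y t)) (at t)"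
    using loc[of zb b] \<open>zb \<in> K\<close> K(2) by blast
  define x where "x t = (if t < b then z t else y t)" for t
  define J' where "J' = J \<union> {t0<..<b+\<epsilon>}"
  have J'_eq: "J' \<inter> {..<b} = J"
  proof -
    have "{t0<..<b} \<subseteq> J" using J(1) by (auto simp: subset_iff)
    then show ?thesis unfolding J'_def using Jb by fastforce
  qed
  have "ode_solution M G J' x"
    unfolding classical_solution_def
  proof (intro conjI ballI)
    show "open J'" unfolding J'_def using Jo(1) by auto
    have "connected J'"
    proof -
      obtain s where "s \<in> {t0<..<b}" using \<open>t0 < b\<close> dense by auto
      then have "s \<in> J \<inter> {t0<..<b+\<epsilon>}" using J(1) y(1) by auto
      then show ?thesis unfolding J'_def using Jo(2)
        by (intro connected_Un) (auto simp: is_interval_connected_1)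
    qed
    then show "is_interval J'" by (simp add: is_interval_connected_1)
    fix t assume t: "t \<in> J'"
    have t_ge: "t \<in> {b-\<epsilon><..<b+\<epsilon>}" if "\<not> t < b" using t that Jb y(1) unfolding J'_def by auto
    have t_J: "t \<in> J" if "t < b" using t that J'_eq by blast
    show "x t \<in> M" using zJ(1) t_J y(3) t_ge unfolding x_def by auto
    consider "t < b" | "t = b" | "t > b" by linarith
    then show "(x has_vector_derivative G t (x t)) (at t)"
    proof cases
      case 1
      have "(z has_vector_derivative G t (z t)) (at t)" by (rule zJ(2)[OF t_J[OF 1]])
      then have "(x has_vector_derivative G t (z t)) (at t)"
        by (rule has_vector_derivative_transform_within_open[of _ _ _ "{..<b}"]) (use 1 in \<open>auto simp: x_def\<close>)
      then show ?thesis using 1 unfolding x_def by simp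
    next
      case 3
      have "(y has_vector_derivative G t (y t)) (at t)" by (rule y(4)[OF t_ge]) (use 3 in simp)
      then have "(x has_vector_derivative G t (y t)) (at t)"
        by (rule has_vector_derivative_transform_within_open[of _ _ _ "{b<..}"]) (use 3 in \<open>auto simp: x_def\<close>)
      then show ?thesis using 3 unfolding x_def by simp
    next
      case 2
      have "(x has_vector_derivative G b zb) (at b within {t0..b})"
        using zzb by (rule has_vector_derivative_transform[rotated 2]) (use \<open>t0 < b\<close> y(2) in \<open>auto simp: x_def zz_def\<close>)
      moreover have "(x has_vector_derivative G b zb) (at b within {b..b+\<epsilon>})"
      proof (rule has_vector_derivative_transform[rotated 2])
        show "(y has_vector_derivative G b zb) (at b within {b..b+\<epsilon>})"
          using y(4)[of b] y(1,2) has_vector_derivative_at_within by auto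
      qed (use y(1) in \<open>auto simp: x_def\<close>)
      \<comment> \<open>The two pieces meet with the same velocity \<open>G b zb\<close>, so the
        one-sided derivatives combine.\<close>
      ultimately have "(x has_vector_derivative G b zb) (at b within ({t0..b} \<union> {b..b+\<epsilon>}))"
        unfolding has_vector_derivative_def has_derivative_within by (auto intro: Lim_Un)
      moreover have "{t0..b} \<union> {b..b+\<epsilon>} = {t0..b+\<epsilon>}" using \<open>t0 < b\<close> y(1) by auto
      ultimately have "(x has_vector_derivative G b zb) (at b within {t0..b+\<epsilon>})" by simp
      then have "(x has_vector_derivative G b zb) (at b)" using \<open>t0 < b\<close> y(1) by (simp add: at_within_Icc_at)
      moreover have "x b = zb" using y(2) unfolding x_def by simp
      ultimately show ?thesis unfolding 2 by simp
    qed
  qed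
  moreover have "\<forall>t\<in>J. x t = z t" using Jb unfolding x_def by auto
  ultimately have "J' = J" using mx[of J' x] unfolding J'_def by blast
  moreover have "b \<in> J'" unfolding J'_def using \<open>t0 < b\<close> y(1) by auto
  ultimately show False using \<open>b \<notin> J\<close> by simp
qed

text \<open>Continuation argument. Up to the supremum \<open>\<sigma>\<close> of the good times the
  distance is at most \<open>\<nu>\<close>, so the solution still exists at \<open>\<sigma>\<close>
  and the strict estimate applies there; continuity would carry the weak estimate beyond
  \<open>\<sigma>\<close> if \<open>\<sigma>\<close> were earlier than
  \<open>t0 + \<Delta>\<close>.\<close>

lemma maximal_solution_stays_close:
  fixes z x :: "real \<Rightarrow> 's::euclidean_space"
  assumes max: "maximal_solution (ode_solution M G) t0 x0 J z"
    and ext: "\<And>b. {t0..<b} \<subseteq> J \<Longrightarrow> t0 \<le> b \<Longrightarrow> (\<And>t. t \<in> {t0..<b} \<Longrightarrow> z t \<in> K) \<Longrightarrow> b \<in> J"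
    and "\<nu> > 0" "\<Delta> > 0" "z t0 = x t0" "continuous_on {t0..t0+\<Delta>} x"
    and K: "\<And>t. t \<in> {t0..t0+\<Delta>} \<Longrightarrow> t \<in> J \<Longrightarrow> norm (z t - x t) \<le> \<nu> \<Longrightarrow> z t \<in> K"
    and est: "\<And>b. b \<in> {t0..t0+\<Delta>} \<Longrightarrow> {t0..b} \<subseteq> J \<Longrightarrow> (\<And>t. t \<in> {t0..b} \<Longrightarrow> norm (z t - x t) \<le> \<nu>) \<Longrightarrow> norm (z b - x b) < \<nu>"
  shows "{t0..t0+\<Delta>} \<subseteq> J \<and> (\<forall>t\<in>{t0..t0+\<Delta>}. norm (z t - x t) \<le> \<nu>)"
proof -
  have sol: "ode_solution M G J z" "t0 \<in> J" using max unfolding maximal_solution_def by auto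
  have Jo: "open J" and zJ: "\<And>t. t \<in> J \<Longrightarrow> (z has_vector_derivative G t (z t)) (at t)"
    using sol(1) unfolding classical_solution_def by auto
  have zc: "continuous_on J z" using zJ has_vector_derivative_continuous continuous_at_imp_continuous_on by blast
  define n where "n t = norm (z t - x t)" for t
  have nc: "continuous_on (J \<inter> {t0..t0+\<Delta>}) n"
    unfolding n_def by (intro continuous_intros continuous_on_subset[OF zc] continuous_on_subset[OF assms(6)]) auto
  define S where "S = {b \<in> {t0..t0+\<Delta>}. {t0..b} \<subseteq> J \<and> (\<forall>t\<in>{t0..b}. n t \<le> \<nu>)}"
  have t0S: "t0 \<in> S" unfolding S_def n_def using sol(2) assms(3,4,5) by auto
  have bdd: "bdd_above S" unfolding S_def by (rule bdd_aboveI[of _ "t0 + \<Delta>"]) auto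
  define \<sigma> where "\<sigma> = Sup S"
  have \<sigma>: "t0 \<le> \<sigma>" "\<sigma> \<le> t0 + \<Delta>"
  proof -
    show "t0 \<le> \<sigma>" unfolding \<sigma>_def by (rule cSup_upper[OF t0S bdd])
    have "S \<noteq> {}" using t0S by blast
    then show "\<sigma> \<le> t0 + \<Delta>" unfolding \<sigma>_def by (rule cSup_least) (auto simp: S_def)
  qed
  have below: "t \<in> J" "n t \<le> \<nu>" if t: "t \<in> {t0..<\<sigma>}" for t
  proof -
    have "S \<noteq> {}" "t < Sup S" using t0S t unfolding \<sigma>_def by auto
    then obtain b where "b \<in> S" "t < b" using less_cSup_iff[OF _ bdd] by blast
    then show "t \<in> J" "n t \<le> \<nu>" using t unfolding S_def by auto
  qed
  have "\<sigma> \<in> J"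
    by (rule ext) (use below \<sigma> K in \<open>auto simp: n_def\<close>)
  have J\<sigma>: "{t0..\<sigma>} \<subseteq> J"
  proof
    fix t assume "t \<in> {t0..\<sigma>}"
    then show "t \<in> J" using below(1)[of t] \<open>\<sigma> \<in> J\<close> by (cases "t = \<sigma>") auto
  qed
  have nle: "n t \<le> \<nu>" if t: "t \<in> {t0..\<sigma>}" for t
  proof (cases "t0 = \<sigma>")
    case True
    then show ?thesis using t assms(3,5) by (simp add: n_def)
  next
    case False
    then have cl: "closure {t0..<\<sigma>} = {t0..\<sigma>}" using \<sigma>(1) by simp
    have "continuous_on {t0..\<sigma>} n" by (rule continuous_on_subset[OF nc]) (use J\<sigma> \<sigma> in auto)
    then have "continuous_on (closure {t0..<\<sigma>}) n" unfolding cl .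
    moreover have "t \<in> closure {t0..<\<sigma>}" unfolding cl by (rule t)
    ultimately show ?thesis by (rule continuous_le_on_closure) (rule below(2))
  qed
  have "\<sigma> = t0 + \<Delta>"
  proof (rule ccontr)
    assume "\<sigma> \<noteq> t0 + \<Delta>"
    then have lt: "\<sigma> < t0 + \<Delta>" using \<sigma> by simp
    have "n \<sigma> < \<nu>" unfolding n_def by (rule est) (use \<sigma> J\<sigma> nle in \<open>auto simp: n_def\<close>)
    then have "\<exists>d>0. \<forall>t\<in>J \<inter> {t0..t0+\<Delta>}. dist t \<sigma> < d \<longrightarrow> dist (n t) (n \<sigma>) < \<nu> - n \<sigma>"
      using nc \<sigma> \<open>\<sigma> \<in> J\<close> unfolding continuous_on_iff by auto
    then obtain d1 where d1: "d1 > 0" "\<And>t. t \<in> J \<inter> {t0..t0+\<Delta>} \<Longrightarrow> dist t \<sigma> < d1 \<Longrightarrow> dist (n t) (n \<sigma>) < \<nu> - n \<sigma>"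
      by blast
    obtain d2 where d2: "d2 > 0" "ball \<sigma> d2 \<subseteq> J" using Jo \<open>\<sigma> \<in> J\<close> openE by blast
    define d where "d = min (t0 + \<Delta> - \<sigma>) (min (d1 / 2) (d2 / 2))"
    have d: "d > 0" "d < d1" "d < d2" "\<sigma> + d \<le> t0 + \<Delta>" unfolding d_def using lt d1(1) d2(1) by auto
    have "t \<in> J \<and> n t \<le> \<nu>" if t: "t \<in> {t0..\<sigma>+d}" for t
    proof (cases "t \<le> \<sigma>")
      case True
      then show ?thesis using t J\<sigma> nle by auto
    next
      case False
      then have "t \<in> J" using d2(2) t d by (auto simp: subset_iff dist_real_def)
      moreover have "dist (n t) (n \<sigma>) < \<nu> - n \<sigma>"
        by (rule d1(2)) (use False t d \<open>t \<in> J\<close> in \<open>auto simp: dist_real_def\<close>)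
      ultimately show ?thesis by (auto simp: dist_real_def)
    qed
    then have "\<sigma> + d \<in> S" unfolding S_def using d \<sigma> by auto
    then have "\<sigma> + d \<le> \<sigma>" unfolding \<sigma>_def by (rule cSup_upper[OF _ bdd])
    then show False using d(1) by simp
  qed
  then show ?thesis using J\<sigma> nle unfolding n_def by auto
qed

section \<open>The averaging principle\<close>

text \<open>Full periods contribute nothing, so only a remainder no longer than \<open>T\<close>
  counts, whatever the length of the interval. This uniformity makes the integral of order
  1/\<omega> after the time scaling.\<close>

lemma periodic_zero_mean_integral_bound:
  fixes g :: "real \<Rightarrow> real"
  assumes g: "continuous_on UNIV g" and "T > 0" and per: "\<And>t. g (t + T) = g t"
    and mean: "integral {0..T} g = 0" and B: "\<And>t. \<bar>g t\<bar> \<le> B" and "a \<le> b"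
  shows "\<bar>integral {a..b} g\<bar> \<le> B * T"
proof -
  have int: "g integrable_on {c..d}" for c d
    by (rule integrable_continuous_real[OF continuous_on_subset[OF g]]) auto
  have period: "integral {s..s + T} g = 0" for s
  proof -
    \<comment> \<open>The window contains \<open>s\<close>, \<open>0\<close> and both points shifted
      by \<open>T\<close>. Where it is defined in this window, \<open>A (t + T) - A t\<close> has
      derivative zero, hence the same value at \<open>s\<close> and at \<open>0\<close>.\<close>
    define c d where "c = min s 0" and "d = max s 0 + T"
    have cd: "c \<le> s" "c \<le> 0" "s + T \<le> d" "T \<le> d" by (auto simp: c_def d_def)
    define A where "A t = integral {c..t} g" for t
    have A': "(A has_real_derivative g t) (at t within {c..d})" if "t \<in> {c..d}" for t
      unfolding A_def has_real_derivative_iff_has_vector_derivative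
      by (rule integral_has_vector_derivative[OF continuous_on_subset[OF g] that]) auto
    have A: "A w - A v = integral {v..w} g" if "c \<le> v" "v \<le> w" for v w
      unfolding A_def using Henstock_Kurzweil_Integration.integral_combine[OF that int] by simp
    have D: "((\<lambda>t. A (t + T) - A t) has_real_derivative 0) (at t within {c..d-T})" if t: "t \<in> {c..d-T}" for t
    proof -
      have "((\<lambda>t. A (t + T)) has_real_derivative g (t + T) * 1) (at t within {c..d-T})"
      proof -
        have "(A has_real_derivative g (t + T)) (at (t + T) within {c..d})"
          by (rule A') (use t \<open>T > 0\<close> in auto)
        then have "(A has_real_derivative g (t + T)) (at (t + T) within (\<lambda>t. t + T) ` {c..d-T})"
          by (rule DERIV_subset) (use \<open>T > 0\<close> in auto)
        moreover have "((\<lambda>t. t + T) has_real_derivative 1) (at t within {c..d-T})"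
          by (auto intro!: derivative_eq_intros)
        ultimately show ?thesis
          using DERIV_image_chain[of A "g (t + T)" "\<lambda>t. t + T" t "{c..d-T}" 1] by (simp add: o_def)
      qed
      moreover have "(A has_real_derivative g t) (at t within {c..d-T})"
        using A'[of t] t \<open>T > 0\<close> by (auto intro: DERIV_subset)
      ultimately show ?thesis using DERIV_diff per[of t] by fastforce
    qed
    have "A (s + T) - A s = A (0 + T) - A 0"
    proof -
      have "\<exists>k. \<forall>t\<in>{c..d-T}. A (t + T) - A t = k"
        by (rule has_field_derivative_zero_constant[OF _ D]) auto
      moreover have "s \<in> {c..d-T}" "0 \<in> {c..d-T}" using cd by (auto simp: c_def d_def)
      ultimately show ?thesis by (metis (no_types, lifting))
    qed
    then show ?thesis using A[of s "s + T"] A[of 0 "0 + T"] cd mean \<open>T > 0\<close> by simp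
  qed
  have "\<bar>integral {a..b} g\<bar> \<le> B * T" if "a \<le> b" "b - a \<le> real k * T" for k b
    using that
  proof (induction k arbitrary: b)
    case 0
    then have "b = a" by simp
    then show ?case using B[of 0] \<open>T > 0\<close> by simp
  next
    case (Suc k)
    show ?case
    proof (cases "b - a \<le> T")
      case True
      have "norm (integral {a..b} g) \<le> B * (b - a)"
        by (rule integral_bound[OF Suc.prems(1) continuous_on_subset[OF g]]) (use B in auto)
      also have "\<dots> \<le> B * T" using True order_trans[OF abs_ge_zero B] by (intro mult_left_mono)
      finally show ?thesis by simp
    next
      case False
      have "integral {a..b} g = integral {a..b - T} g + integral {b - T..b - T + T} g"
        using Henstock_Kurzweil_Integration.integral_combine[of a "b - T" b g] int False \<open>T > 0\<close> by simp
      then show ?thesis using Suc.IH[of "b - T"] Suc.prems False period[of "b - T"] by (simp add: algebra_simps)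
    qed
  qed
  moreover obtain k :: nat where "(b - a) / T \<le> real k" using real_arch_simple by blast
  ultimately show ?thesis using \<open>a \<le> b\<close> \<open>T > 0\<close> by (simp add: field_simps)
qed

lemma periodic_continuous_bounded:
  fixes g :: "real \<Rightarrow> real"
  assumes g: "continuous_on UNIV g" and "T > 0" and per: "\<And>t. g (t + T) = g t"
  shows "\<exists>B. \<forall>t. \<bar>g t\<bar> \<le> B"
proof -
  have "compact (g ` {0..T})"
    by (intro compact_continuous_image continuous_on_subset[OF g]) auto
  then have "bounded (g ` {0..T})" by (rule compact_imp_bounded)
  then obtain B where B: "\<And>y. y \<in> g ` {0..T} \<Longrightarrow> \<bar>y\<bar> \<le> B" unfolding bounded_iff by auto
  interpret periodic_fun_simple g T by standard (rule per)
  have "\<bar>g t\<bar> \<le> B" for t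
  proof -
    define k where "k = \<lfloor>t / T\<rfloor>"
    have "of_int k \<le> t / T" "t / T < of_int k + 1" unfolding k_def by linarith+
    then have "t - of_int k * T \<in> {0..T}" using \<open>T > 0\<close> by (auto simp: field_simps)
    moreover have "g t = g (t - of_int k * T)" using minus_of_int[of t k] by simp
    ultimately show ?thesis using B by auto
  qed
  then show ?thesis by blast
qed

text \<open>In fast time the coefficient minus its mean has integrals of order
  \<open>T / \<omega>\<close>, so the estimate for the near-identity transformation is of order
  1/\<omega> as long as \<open>z\<close> stays in the tube \<open>K\<close>. For large \<omega> it
  is strictly below \<open>\<nu>\<close>, and the continuation argument does the rest. The
  retractions provide local existence on \<open>M\<close>.\<close>

theorem averaging_principle:
  fixes M :: "'s::euclidean_space set" and f :: "'l \<Rightarrow> 's \<Rightarrow> 's" and c :: "'l \<Rightarrow> real \<Rightarrow> real" and m :: "'l \<Rightarrow> real"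
  assumes "finite I" "closed M" "T > 0"
    and f: "\<And>l. l \<in> I \<Longrightarrow> smooth_on M (f l)"
    and c: "\<And>l. l \<in> I \<Longrightarrow> continuous_on UNIV (c l)" "\<And>l t. l \<in> I \<Longrightarrow> c l (t + T) = c l t"
      "\<And>l. l \<in> I \<Longrightarrow> integral {0..T} (c l) = m l * T"
    and retract: "\<And>p. p \<in> M \<Longrightarrow> \<exists>W \<rho>. open W \<and> p \<in> W \<and> C_inf_on W \<rho> \<and> \<rho> ` W \<subseteq> M \<and> (\<forall>x\<in>M \<inter> W. \<rho> x = x) \<and>
        (\<forall>l\<in>I. \<forall>x\<in>M \<inter> W. frechet_derivative \<rho> (at x) (f l x) = f l x)"
    and C: "compact C" "C \<subseteq> M" "\<nu> > 0" "\<Delta> > 0"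
  shows "\<exists>\<omega>0>0. \<forall>\<omega>\<ge>\<omega>0. \<forall>t0 x.
      (\<forall>t\<in>{t0..t0+\<Delta>}. x t \<in> C \<and> (x has_vector_derivative (\<Sum>l\<in>I. m l *\<^sub>R f l (x t))) (at t)) \<longrightarrow>
      (\<exists>J z. maximal_solution (ode_solution M (\<lambda>t x. \<Sum>l\<in>I. c l (\<omega> * t) *\<^sub>R f l x)) t0 (x t0) J z) \<and>
      (\<forall>J z. maximal_solution (ode_solution M (\<lambda>t x. \<Sum>l\<in>I. c l (\<omega> * t) *\<^sub>R f l x)) t0 (x t0) J z \<longrightarrow>
         {t0..t0+\<Delta>} \<subseteq> J \<and> (\<forall>t\<in>{t0..t0+\<Delta>}. norm (z t - x t) \<le> \<nu>))"
  (is "\<exists>\<omega>0>0. \<forall>\<omega>\<ge>\<omega>0. \<forall>t0 x. ?average t0 x \<longrightarrow> (\<exists>J z. ?maximal \<omega> t0 x J z) \<and> (\<forall>J z. ?maximal \<omega> t0 x J z \<longrightarrow> ?close t0 x J z)")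
proof -
  have "\<forall>l\<in>I. \<exists>B. \<forall>t. \<bar>c l t\<bar> \<le> B" using periodic_continuous_bounded[OF c(1) \<open>T > 0\<close> c(2)] by blast
  then obtain b where b: "\<And>l t. l \<in> I \<Longrightarrow> \<bar>c l t\<bar> \<le> b l" unfolding bchoice_iff by blast
  define cb where "cb = (\<Sum>l\<in>I. \<bar>b l\<bar>)"
  have cb: "\<bar>c l t\<bar> \<le> cb" if "l \<in> I" for l t
  proof -
    have "\<bar>b l\<bar> \<le> cb" unfolding cb_def using that \<open>finite I\<close> by (intro member_le_sum) auto
    then show ?thesis using b[OF that, of t] by linarith
  qed
  have cb0: "cb \<ge> 0" unfolding cb_def by (simp add: sum_nonneg)
  define mb where "mb = (\<Sum>l\<in>I. \<bar>m l\<bar>)"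
  have mb: "\<bar>m l\<bar> \<le> mb" if "l \<in> I" for l
    unfolding mb_def using that \<open>finite I\<close> by (intro member_le_sum) auto
  have mb0: "mb \<ge> 0" unfolding mb_def by (simp add: sum_nonneg)
  \<comment> \<open>The part of \<open>M\<close> within distance \<open>\<nu>\<close> of
    \<open>C\<close> is compact because \<open>M\<close> is closed. The constants for the fields are
    taken on it, so that \<open>\<omega>0\<close> depends on neither \<open>t0\<close> nor
    \<open>x\<close>.\<close>
  define K where "K = {y \<in> M. \<exists>x\<in>C. norm (y - x) \<le> \<nu>}"
  have "compact K"
  proof -
    have "K = M \<inter> (\<Union>x\<in>C. \<Union>v\<in>cball 0 \<nu>. {x + v})"
    proof (intro equalityI subsetI)
      fix y assume "y \<in> K"
      then obtain x where "y \<in> M" "x \<in> C" "norm (y - x) \<le> \<nu>" unfolding K_def by blast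
      then show "y \<in> M \<inter> (\<Union>x\<in>C. \<Union>v\<in>cball 0 \<nu>. {x + v})"
        by (intro IntI UN_I[of x] UN_I[of "y - x"]) auto
    next
      fix y assume "y \<in> M \<inter> (\<Union>x\<in>C. \<Union>v\<in>cball 0 \<nu>. {x + v})"
      then obtain x v where "y \<in> M" "x \<in> C" "norm v \<le> \<nu>" "y = x + v" by auto
      then show "y \<in> K" unfolding K_def by (auto intro!: bexI[of _ x])
    qed
    moreover have "compact (\<Union>x\<in>C. \<Union>v\<in>cball 0 \<nu>. {x + v})"
      by (rule compact_sums'[OF C(1) compact_cball])
    ultimately show ?thesis using closed_Int_compact[OF \<open>closed M\<close>] by simp
  qed
  have KM: "K \<subseteq> M" unfolding K_def by auto
  have CK: "C \<subseteq> K"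
  proof
    fix x assume "x \<in> C"
    then show "x \<in> K" unfolding K_def using C(2,3) by (auto intro!: bexI[of _ x])
  qed
  have "\<forall>l\<in>I. \<exists>L\<ge>0. \<forall>x\<in>K. \<forall>y\<in>K. norm (f l x - f l y) \<le> L * norm (x - y)"
    using smooth_on_compact_lipschitz[OF f \<open>compact K\<close> KM] by blast
  then obtain \<Lambda>0 where \<Lambda>0: "\<And>l. l \<in> I \<Longrightarrow> \<Lambda>0 l \<ge> 0"
    "\<And>l x y. l \<in> I \<Longrightarrow> x \<in> K \<Longrightarrow> y \<in> K \<Longrightarrow> norm (f l x - f l y) \<le> \<Lambda>0 l * norm (x - y)"
    unfolding bchoice_iff by metis
  define \<Lambda> where "\<Lambda> = (\<Sum>l\<in>I. \<Lambda>0 l)"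
  have \<Lambda>: "norm (f l x - f l y) \<le> \<Lambda> * norm (x - y)" if "l \<in> I" "x \<in> K" "y \<in> K" for l x y
  proof -
    have "\<Lambda>0 l \<le> \<Lambda>" unfolding \<Lambda>_def using that(1) \<open>finite I\<close> \<Lambda>0(1) by (intro member_le_sum) auto
    then show ?thesis using \<Lambda>0(2)[OF that] mult_right_mono[of "\<Lambda>0 l" \<Lambda> "norm (x - y)"] by simp
  qed
  have \<Lambda>_nn: "\<Lambda> \<ge> 0" unfolding \<Lambda>_def using \<Lambda>0(1) by (simp add: sum_nonneg)
  have "\<forall>l\<in>I. \<exists>B\<ge>0. \<forall>x\<in>K. norm (f l x) \<le> B"
    using smooth_on_compact_bounded[OF f \<open>compact K\<close> KM] by blast
  then obtain B0 where B0: "\<And>l. l \<in> I \<Longrightarrow> B0 l \<ge> 0" "\<And>l x. l \<in> I \<Longrightarrow> x \<in> K \<Longrightarrow> norm (f l x) \<le> B0 l"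
    unfolding bchoice_iff by metis
  define B where "B = (\<Sum>l\<in>I. B0 l)"
  have B: "norm (f l x) \<le> B" if "l \<in> I" "x \<in> K" for l x
  proof -
    have "B0 l \<le> B" unfolding B_def using that(1) \<open>finite I\<close> B0(1) by (intro member_le_sum) auto
    then show ?thesis using B0(2)[OF that] by simp
  qed
  have B_nn: "B \<ge> 0" unfolding B_def using B0(1) by (simp add: sum_nonneg)
  define N where "N = real (card I)"
  define V where "V = N * (cb * B)"
  have V: "norm (\<Sum>l\<in>I. c l t *\<^sub>R f l x) \<le> V" if "x \<in> K" for t x
  proof -
    have "norm (\<Sum>l\<in>I. c l t *\<^sub>R f l x) \<le> (\<Sum>l\<in>I. cb * B)"
      using B[OF _ that] cb cb0 by (intro sum_norm_le) (auto intro!: mult_mono)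
    then show ?thesis unfolding V_def N_def by simp
  qed
  have V_nn: "V \<ge> 0" unfolding V_def N_def using cb0 B_nn by simp
  define L where "L = N * (mb * \<Lambda>)"
  have L: "norm ((\<Sum>l\<in>I. m l *\<^sub>R f l x) - (\<Sum>l\<in>I. m l *\<^sub>R f l y)) \<le> L * norm (x - y)" if "x \<in> K" "y \<in> K" for x y
  proof -
    have "norm ((\<Sum>l\<in>I. m l *\<^sub>R f l x) - (\<Sum>l\<in>I. m l *\<^sub>R f l y)) = norm (\<Sum>l\<in>I. m l *\<^sub>R (f l x - f l y))"
      by (simp add: sum_subtractf scaleR_diff_right)
    also have "\<dots> \<le> (\<Sum>l\<in>I. mb * (\<Lambda> * norm (x - y)))"
      using \<Lambda>[OF _ that] mb mb0 by (intro sum_norm_le) (auto intro!: mult_mono)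
    finally show ?thesis unfolding L_def N_def by (simp add: mult_ac)
  qed
  have L_nn: "L \<ge> 0" unfolding L_def N_def using mb0 \<Lambda>_nn by simp
  \<comment> \<open>The factor of \<open>\<kappa>\<close> in the averaging estimate, with the
    elapsed time replaced by its upper bound \<open>\<Delta>\<close> and with
    \<open>\<Lambda> * V\<close> bounding the derivative of \<open>f l (z t)\<close>.\<close>
  define E where "E = N * (B + (L * B + \<Lambda> * V) * \<Delta> * exp (L * \<Delta>))"
  have E_nn: "E \<ge> 0" unfolding E_def N_def using B_nn L_nn \<Lambda>_nn V_nn C(4) by simp
  \<comment> \<open>The summand 1 makes the resulting bound strict and \<open>\<omega>0\<close>
    positive.\<close>
  define \<omega>0 where "\<omega>0 = ((cb + mb) * T * E + 1) / \<nu>"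
  have num: "(cb + mb) * T * E \<ge> 0" using cb0 mb0 E_nn \<open>T > 0\<close> by simp
  have \<omega>0: "\<omega>0 > 0" unfolding \<omega>0_def using num C(3) by simp
  have small: "(cb + mb) * (T / \<omega>) * E < \<nu>" if "\<omega> \<ge> \<omega>0" for \<omega>
  proof -
    have "\<omega> > 0" using \<omega>0 that by simp
    have "(cb + mb) * T * E < \<nu> * \<omega>0" unfolding \<omega>0_def using C(3) by simp
    also have "\<dots> \<le> \<nu> * \<omega>" using that C(3) by simp
    finally show ?thesis using \<open>\<omega> > 0\<close> by (simp add: field_simps)
  qed
  show ?thesis
  proof (rule exI[of _ \<omega>0], rule conjI[OF \<omega>0], intro allI impI)
    fix \<omega> t0 and x :: "real \<Rightarrow> 's" assume \<omega>: "\<omega> \<ge> \<omega>0"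
      and x: "?average t0 x"
    have "\<omega> > 0" using \<omega> \<omega>0 by simp
    define G where "G t x = (\<Sum>l\<in>I. c l (\<omega> * t) *\<^sub>R f l x)" for t x
    have c\<omega>: "continuous_on S (\<lambda>t. c l (\<omega> * t))" if "l \<in> I" for l S
      by (rule continuous_on_compose2[OF c(1)[OF that]]) (auto intro!: continuous_intros)
    have loc: "\<exists>\<epsilon>>0. \<exists>y. y t1 = x1 \<and> (\<forall>t\<in>{t1-\<epsilon><..<t1+\<epsilon>}. y t \<in> M \<and> (y has_vector_derivative G t (y t)) (at t))"
      if x1: "x1 \<in> M" for t1 x1
    proof -
      obtain W \<rho> where W: "open W" "x1 \<in> W" "C_inf_on W \<rho>" "\<rho> ` W \<subseteq> M" "\<forall>x\<in>M \<inter> W. \<rho> x = x"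
        "\<forall>l\<in>I. \<forall>x\<in>M \<inter> W. frechet_derivative \<rho> (at x) (f l x) = f l x"
        using retract[OF x1] by (elim exE conjE)
      show ?thesis
        unfolding G_def
        by (rule local_solution_on_retract[OF \<open>finite I\<close> f c\<omega> cb W(1,2) x1 W(3,4)])
          (use W(5,6) in auto)
    qed
    have x0: "x t0 \<in> M" using x C(2,4) by auto
    have "\<exists>J z. ?maximal \<omega> t0 x J z"
    proof -
      obtain \<epsilon> y where y: "\<epsilon> > 0" "y t0 = x t0" "\<forall>t\<in>{t0-\<epsilon><..<t0+\<epsilon>}. y t \<in> M \<and> (y has_vector_derivative G t (y t)) (at t)"
        using loc[OF x0, of t0] by (elim exE conjE)
      have sol: "ode_solution M G {t0-\<epsilon><..<t0+\<epsilon>} y"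
        unfolding classical_solution_def using y(3) by (auto simp: is_interval_oo)
      have "\<exists>J z. maximal_solution (ode_solution M G) t0 (y t0) J z"
      proof (rule maximal_classical_solution_exists[OF _ sol])
        fix x y :: "real \<Rightarrow> 's" and t :: real and J :: "real set"
        assume "open J" "t \<in> J" "\<And>s. s \<in> J \<Longrightarrow> x s = y s" "(x has_vector_derivative G t (x t)) (at t)"
        then show "(y has_vector_derivative G t (y t)) (at t)"
          by (rule has_vector_derivative_local[where G = G])
      qed (use y(1) in auto)
      then show ?thesis unfolding y(2) G_def .
    qed
    moreover have "?close t0 x J z" if max: "?maximal \<omega> t0 x J z" for J z
    proof -
      from max have max': "maximal_solution (ode_solution M G) t0 (x t0) J z" unfolding G_def .
      have zJ: "z t \<in> M" "(z has_vector_derivative G t (z t)) (at t)" if "t \<in> J" for t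
        using max' that unfolding maximal_solution_def classical_solution_def by auto
      have z0: "z t0 = x t0" using max unfolding maximal_solution_def by auto
      have contG: "continuous_on (UNIV \<times> M) (\<lambda>(t, x). G t x)"
        unfolding G_def case_prod_beta
      proof (intro continuous_on_sum continuous_on_scaleR)
        fix l assume l: "l \<in> I"
        show "continuous_on (UNIV \<times> M) (\<lambda>p. c l (\<omega> * fst p))"
          by (rule continuous_on_compose2[OF c(1)[OF l]]) (auto intro!: continuous_intros)
        show "continuous_on (UNIV \<times> M) (\<lambda>p. f l (snd p))"
          by (rule continuous_on_compose2[OF smooth_on_continuous[OF f[OF l]]]) (auto intro!: continuous_intros)
      qed
      show ?thesis
      proof (rule maximal_solution_stays_close[where G = G and x = x and K = K, OF max' _ C(3,4) z0])
        show "b \<in> J" if "{t0..<b} \<subseteq> J" "t0 \<le> b" "\<And>t. t \<in> {t0..<b} \<Longrightarrow> z t \<in> K" for b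
          by (rule maximal_solution_extends[where G = G, OF max' contG loc \<open>compact K\<close> KM that(3,1,2)])
        show "continuous_on {t0..t0+\<Delta>} x"
          using x has_vector_derivative_continuous by (blast intro: continuous_at_imp_continuous_on)
        show "z t \<in> K" if "t \<in> {t0..t0+\<Delta>}" "t \<in> J" "norm (z t - x t) \<le> \<nu>" for t
          unfolding K_def using that zJ(1) x by blast
        fix b assume b: "b \<in> {t0..t0+\<Delta>}" "{t0..b} \<subseteq> J" "\<And>t. t \<in> {t0..b} \<Longrightarrow> norm (z t - x t) \<le> \<nu>"
        have zK: "z t \<in> K" and xK: "x t \<in> K" if t: "t \<in> {t0..b}" for t
        proof -
          have t': "t \<in> {t0..t0+\<Delta>}" "t \<in> J" using t b(1,2) by auto
          show "z t \<in> K" unfolding K_def using zJ(1)[OF t'(2)] x t'(1) b(3)[OF t] by blast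
          show "x t \<in> K" using x t'(1) CK by blast
        qed
        have zd: "(z has_vector_derivative G t (z t)) (at t within {t0..b})" if "t \<in> {t0..b}" for t
          using zJ(2) b(2) that has_vector_derivative_at_within by blast
        have fz: "\<exists>D. ((\<lambda>s. f l (z s)) has_vector_derivative D) (at t within {t0..b})" if l: "l \<in> I" and t: "t \<in> {t0..b}" for l t
        proof -
          have tJ: "t \<in> J" using b(2) t by blast
          have "\<forall>\<^sub>F s in nhds t. s \<in> J"
            using max' tJ unfolding maximal_solution_def classical_solution_def by (auto intro: eventually_nhds_in_open)
          then have "\<forall>\<^sub>F s in nhds t. z s \<in> M" by (rule eventually_mono) (rule zJ(1))
          from smooth_on_vector_derivative_compose[OF f[OF l] zJ(1)[OF tJ] zJ(2)[OF tJ] this]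
          show ?thesis using has_vector_derivative_at_within by blast
        qed
        then obtain D where D: "\<And>l t. l \<in> I \<Longrightarrow> t \<in> {t0..b} \<Longrightarrow> ((\<lambda>s. f l (z s)) has_vector_derivative D l t) (at t within {t0..b})"
          by metis
        show "norm (z b - x b) < \<nu>"
        \<comment> \<open>In a degenerate interval every vector is a derivative, so the bound on
          \<open>D\<close> needs \<open>t0 < b\<close>.\<close>
        proof (cases "b = t0")
          case True
          then show ?thesis using z0 C(3) by simp
        next
          case False
          then have tb: "t0 < b" using b(1) by simp
          have Dle: "norm (D l t) \<le> \<Lambda> * V" if l: "l \<in> I" and t: "t \<in> {t0..b}" for l t
          proof -
            have "norm (D l t) \<le> \<Lambda> * norm (G t (z t))"
              by (rule has_vector_derivative_norm_le[OF D[OF l t] zd[OF t]])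
                (use \<Lambda>[OF l zK zK[OF t]] \<Lambda>_nn t tb in \<open>auto simp: islimpt_Icc\<close>)
            also have "\<dots> \<le> \<Lambda> * V" using V[OF zK[OF t]] \<Lambda>_nn unfolding G_def by (intro mult_left_mono)
            finally show ?thesis .
          qed
          have gc: "continuous_on S (\<lambda>s. c l (\<omega> * s) - m l)" if "l \<in> I" for l S
            by (intro continuous_intros c\<omega>[OF that])
          have \<kappa>: "\<bar>integral {t0..t} (\<lambda>s. c l (\<omega> * s) - m l)\<bar> \<le> (cb + mb) * (T / \<omega>)" if l: "l \<in> I" and t: "t \<in> {t0..b}" for l t
          proof (rule periodic_zero_mean_integral_bound[OF gc[OF l]])
            show "T / \<omega> > 0" using \<open>T > 0\<close> \<open>\<omega> > 0\<close> by simp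
            show "c l (\<omega> * (s + T / \<omega>)) - m l = c l (\<omega> * s) - m l" for s
              using c(2)[OF l, of "\<omega> * s"] \<open>\<omega> > 0\<close> by (simp add: distrib_left)
            show "\<bar>c l (\<omega> * s) - m l\<bar> \<le> cb + mb" for s
              using cb[OF l, of "\<omega> * s"] mb[OF l] by linarith
            have "(c l has_integral m l * T) {0..T}"
              using integrable_integral[OF integrable_continuous_real[OF continuous_on_subset[OF c(1)[OF l]]], of 0 T] c(3)[OF l] by simp
            then have "((\<lambda>s. c l (\<omega> * s)) has_integral (1 / \<bar>\<omega>\<bar>) *\<^sub>R (m l * T)) ((\<lambda>x. x / \<omega>) ` {0..T})"
              by (rule has_integral_stretch_real) (use \<open>\<omega> > 0\<close> in simp)
            moreover have "(\<lambda>x. x / \<omega>) ` {0..T} = {0..T / \<omega>}"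
              using \<open>\<omega> > 0\<close> \<open>T > 0\<close> image_divide_atLeastAtMost[of \<omega> 0 T] by simp
            ultimately have 1: "((\<lambda>s. c l (\<omega> * s)) has_integral m l * T / \<omega>) {0..T / \<omega>}"
              using \<open>\<omega> > 0\<close> by (simp add: field_simps)
            have 2: "((\<lambda>s. m l) has_integral m l * T / \<omega>) {0..T / \<omega>}"
              using has_integral_const_real[of "m l" 0 "T / \<omega>"] \<open>\<omega> > 0\<close> \<open>T > 0\<close> by (simp add: mult.commute)
            show "integral {0..T / \<omega>} (\<lambda>s. c l (\<omega> * s) - m l) = 0"
              using has_integral_diff[OF 1 2] by (simp add: integral_unique)
          qed (use t in auto)
          have \<kappa>0: "(cb + mb) * (T / \<omega>) \<ge> 0" using cb0 mb0 \<open>T > 0\<close> \<open>\<omega> > 0\<close> by simp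
          have "norm (z b - x b) \<le> (cb + mb) * (T / \<omega>) * (card I * (B + (L * B + \<Lambda> * V) * (b - t0) * exp (L * (b - t0))))"
          proof (rule averaging_estimate[OF \<open>finite I\<close>, where favg = "\<lambda>x. \<Sum>l\<in>I. m l *\<^sub>R f l x" and f = f and D = D])
            fix t assume t: "t \<in> {t0..b}"
            have "(\<Sum>l\<in>I. m l *\<^sub>R f l (z t)) + (\<Sum>l\<in>I. (c l (\<omega> * t) - m l) *\<^sub>R f l (z t)) = G t (z t)"
              unfolding G_def by (simp add: sum.distrib[symmetric] scaleR_diff_left)
            then show "(z has_vector_derivative (\<Sum>l\<in>I. m l *\<^sub>R f l (z t)) + (\<Sum>l\<in>I. (c l (\<omega> * t) - m l) *\<^sub>R f l (z t))) (at t within {t0..b})"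
              using zd[OF t] by simp
            show "(x has_vector_derivative (\<Sum>l\<in>I. m l *\<^sub>R f l (x t))) (at t within {t0..b})"
            proof (rule has_vector_derivative_at_within)
              have "t \<in> {t0..t0+\<Delta>}" using t b(1) by auto
              then show "(x has_vector_derivative (\<Sum>l\<in>I. m l *\<^sub>R f l (x t))) (at t)" using x by blast
            qed
            show "norm ((\<Sum>l\<in>I. m l *\<^sub>R f l (z t)) - (\<Sum>l\<in>I. m l *\<^sub>R f l (x t))) \<le> L * norm (z t - x t)"
              by (rule L[OF zK[OF t] xK[OF t]])
          qed (use tb z0 D Dle B zK gc \<kappa> L_nn B_nn \<Lambda>_nn V_nn \<kappa>0 in auto)
          also have "\<dots> \<le> (cb + mb) * (T / \<omega>) * E"
          proof (rule mult_left_mono[OF _ \<kappa>0])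
            have bt: "b - t0 \<le> \<Delta>" "0 \<le> b - t0" using b(1) by auto
            have "(b - t0) * exp (L * (b - t0)) \<le> \<Delta> * exp (L * \<Delta>)"
              using bt L_nn by (intro mult_mono) (auto intro: mult_left_mono)
            then have "(L * B + \<Lambda> * V) * ((b - t0) * exp (L * (b - t0))) \<le> (L * B + \<Lambda> * V) * (\<Delta> * exp (L * \<Delta>))"
              using L_nn B_nn \<Lambda>_nn V_nn by (intro mult_left_mono) auto
            then show "card I * (B + (L * B + \<Lambda> * V) * (b - t0) * exp (L * (b - t0))) \<le> E"
              unfolding E_def N_def by (intro mult_left_mono add_left_mono) (auto simp: mult.assoc)
          qed
          also have "\<dots> < \<nu>" by (rule small[OF \<omega>])
          finally show ?thesis .
        qed
      qed
    qed
    ultimately show "(\<exists>J z. ?maximal \<omega> t0 x J z) \<and> (\<forall>J z. ?maximal \<omega> t0 x J z \<longrightarrow> ?close t0 x J z)"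
      by (intro conjI allI impI) (assumption, blast+)
  qed
qed

section \<open>Orthogonal projections\<close>

text \<open>Stated by the orthogonality conditions, so that linearity and the Gram-Schmidt step
  follow by checking a candidate.\<close>

definition orth_proj :: "'a::euclidean_space set \<Rightarrow> 'a \<Rightarrow> 'a" where
  "orth_proj S w = (THE p. p \<in> S \<and> (\<forall>y\<in>S. (w - p) \<bullet> y = 0))"

lemma orth_proj_eqI:
  assumes "subspace S" "p \<in> S" "\<And>y. y \<in> S \<Longrightarrow> (w - p) \<bullet> y = 0"
  shows "orth_proj S w = p"
  unfolding orth_proj_def
proof (rule the_equality)
  fix p' assume p': "p' \<in> S \<and> (\<forall>y\<in>S. (w - p') \<bullet> y = 0)"
  then have "p - p' \<in> S" using assms subspace_diff by blast
  then have "(w - p') \<bullet> (p - p') - (w - p) \<bullet> (p - p') = 0" using p' assms(3) by simp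
  then have "(p - p') \<bullet> (p - p') = 0" by (simp add: inner_diff_left)
  then show "p' = p" by simp
qed (use assms in auto)

lemma
  assumes "subspace S"
  shows orth_proj_in: "orth_proj S w \<in> S"
    and orth_proj_orthogonal: "y \<in> S \<Longrightarrow> (w - orth_proj S w) \<bullet> y = 0"
proof -
  obtain p z where "p \<in> span S" "\<And>y. y \<in> span S \<Longrightarrow> orthogonal z y" "w = p + z"
    using orthogonal_subspace_decomp_exists[of S w] by metis
  then have p: "p \<in> S" "\<And>y. y \<in> S \<Longrightarrow> (w - p) \<bullet> y = 0"
    using span_eq_iff[THEN iffD2, OF assms] by (auto simp: orthogonal_def)
  then have "orth_proj S w = p" using assms by (intro orth_proj_eqI)
  then show "orth_proj S w \<in> S" "y \<in> S \<Longrightarrow> (w - orth_proj S w) \<bullet> y = 0" using p by auto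
qed

lemma orth_proj_self: "subspace S \<Longrightarrow> w \<in> S \<Longrightarrow> orth_proj S w = w"
  by (rule orth_proj_eqI) auto

lemma linear_orth_proj: "subspace S \<Longrightarrow> linear (orth_proj S)"
proof (rule linearI)
  fix v w assume S: "subspace S"
  show "orth_proj S (v + w) = orth_proj S v + orth_proj S w"
  proof (rule orth_proj_eqI[OF S])
    fix y assume "y \<in> S"
    then have "(v - orth_proj S v) \<bullet> y + (w - orth_proj S w) \<bullet> y = 0" using orth_proj_orthogonal[OF S] by simp
    then show "(v + w - (orth_proj S v + orth_proj S w)) \<bullet> y = 0" by (simp add: inner_diff_left inner_add_left)
  qed (simp add: S orth_proj_in subspace_add)
next
  fix c :: real and w assume S: "subspace S"
  show "orth_proj S (c *\<^sub>R w) = c *\<^sub>R orth_proj S w"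
  proof (rule orth_proj_eqI[OF S])
    fix y assume "y \<in> S"
    then have "c * ((w - orth_proj S w) \<bullet> y) = 0" using orth_proj_orthogonal[OF S] by simp
    then show "(c *\<^sub>R w - c *\<^sub>R orth_proj S w) \<bullet> y = 0" by (simp add: inner_diff_left algebra_simps)
  qed (simp add: S orth_proj_in subspace_scale)
qed

lemma smooth_on_inverse:
  fixes f :: "'a::euclidean_space \<Rightarrow> real"
  assumes "open W" "smooth_on W f" "\<And>x. x \<in> W \<Longrightarrow> f x \<noteq> 0"
  shows "smooth_on W (\<lambda>x. inverse (f x))"
  using assms C_k_on_inverse unfolding smooth_on_open_iff[OF assms(1)] C_inf_on_def by blast

text \<open>Gram--Schmidt: adding a vector \<open>t b\<close> to the spanning family adds the projection onto
  \<open>t b - orth_proj (span \<dots>) (t b)\<close>.\<close>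

lemma smooth_on_orth_proj_span:
  fixes t :: "'b \<Rightarrow> 'a::euclidean_space \<Rightarrow> 'c::euclidean_space"
  assumes "open W" "finite B"
    and "\<And>b. b \<in> B \<Longrightarrow> smooth_on W (t b)"
    and "\<And>q. q \<in> W \<Longrightarrow> inj_on (\<lambda>b. t b q) B \<and> independent ((\<lambda>b. t b q) ` B)"
  shows "smooth_on W (\<lambda>q. orth_proj (span ((\<lambda>b. t b q) ` B)) w)"
  using assms(2-)
proof (induction B arbitrary: w rule: finite_induct)
  case empty
  have "orth_proj (span {}) w = (0 :: 'c)" for w
    by (rule orth_proj_eqI) auto
  then show ?case by (simp add: smooth_on_const)
next
  case (insert b B)
  define S where "S q = span ((\<lambda>b. t b q) ` B)" for q
  define g where "g q = t b q - orth_proj (S q) (t b q)" for q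
  have S: "subspace (S q)" for q unfolding S_def by simp
  have sub: "inj_on (\<lambda>b. t b q) B \<and> independent ((\<lambda>b. t b q) ` B)" if "q \<in> W" for q
    using insert.prems(2)[OF that] independent_mono[of "(\<lambda>b. t b q) ` insert b B" "(\<lambda>b. t b q) ` B"]
    by (auto simp: inj_on_insert)
  have P: "smooth_on W (\<lambda>q. orth_proj (S q) w)" for w
    unfolding S_def by (rule insert.IH) (use insert.prems sub in auto)
  \<comment> \<open>The induction hypothesis gives smoothness for a fixed projected vector;
    expanding in the basis covers the moving vector \<open>t b q\<close>.\<close>
  have Psum: "orth_proj (S q) v = (\<Sum>i\<in>Basis. (v \<bullet> i) *\<^sub>R orth_proj (S q) i)" for q v
    by (rule linear_Basis_expansion[OF linear_orth_proj[OF S]])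
  have tb: "smooth_on W (t b)" using insert.prems(1) by simp
  have g: "smooth_on W g"
  proof -
    have "smooth_on W (\<lambda>q. t b q - (\<Sum>i\<in>Basis. (t b q \<bullet> i) *\<^sub>R orth_proj (S q) i))"
      by (intro smooth_intros tb P)
    then show ?thesis unfolding g_def Psum[symmetric] .
  qed
  have g0: "g q \<noteq> 0" if q: "q \<in> W" for q
  proof
    assume "g q = 0"
    then have "t b q \<in> S q" using orth_proj_in[OF S, of q "t b q"] unfolding g_def by simp
    moreover have "t b q \<notin> (\<lambda>b. t b q) ` B"
      using insert.prems(2)[OF q] insert.hyps(2) by (auto simp: inj_on_def)
    ultimately show False
      using insert.prems(2)[OF q] unfolding S_def by (auto simp: independent_insert)
  qed
  have "orth_proj (span ((\<lambda>b. t b q) ` insert b B)) w = orth_proj (S q) w + ((w \<bullet> g q) * inverse (g q \<bullet> g q)) *\<^sub>R g q"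
    if q: "q \<in> W" for q
  proof (rule orth_proj_eqI)
    let ?S' = "span ((\<lambda>b. t b q) ` insert b B)"
    have sub: "S q \<subseteq> ?S'" unfolding S_def by (intro span_mono) auto
    have tb: "t b q \<in> ?S'" by (intro span_base) auto
    have gS: "g q \<in> ?S'" unfolding g_def using sub tb orth_proj_in[OF S] by (intro span_diff) auto
    show "orth_proj (S q) w + ((w \<bullet> g q) * inverse (g q \<bullet> g q)) *\<^sub>R g q \<in> ?S'"
      using sub gS orth_proj_in[OF S] by (intro span_add span_scale) auto
    fix y assume "y \<in> ?S'"
    then obtain k where k: "y - k *\<^sub>R t b q \<in> S q"
      unfolding S_def by (auto simp: span_breakdown_eq)
    define s where "s = y - k *\<^sub>R t b q + k *\<^sub>R orth_proj (S q) (t b q)"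
    have s: "s \<in> S q" unfolding s_def by (intro subspace_add[OF S] k subspace_scale[OF S] orth_proj_in[OF S])
    have y: "y = s + k *\<^sub>R g q" unfolding s_def g_def by (simp add: algebra_simps)
    have 1: "(w - orth_proj (S q) w) \<bullet> s = 0" by (rule orth_proj_orthogonal[OF S s])
    have 2: "g q \<bullet> s = 0" unfolding g_def by (rule orth_proj_orthogonal[OF S s])
    have "g q \<bullet> orth_proj (S q) w = 0" unfolding g_def by (rule orth_proj_orthogonal[OF S orth_proj_in[OF S]])
    then have 3: "(w - orth_proj (S q) w) \<bullet> g q = w \<bullet> g q" by (simp add: inner_diff_left inner_commute[of "g q"])
    have 4: "(w \<bullet> g q) * inverse (g q \<bullet> g q) * (g q \<bullet> g q) = w \<bullet> g q" using g0[OF q] by simp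
    have "(w - (orth_proj (S q) w + ((w \<bullet> g q) * inverse (g q \<bullet> g q)) *\<^sub>R g q)) \<bullet> y
        = (w - orth_proj (S q) w) \<bullet> y - (w \<bullet> g q) * inverse (g q \<bullet> g q) * (g q \<bullet> y)"
      by (simp add: inner_diff_left inner_add_left)
    also have "\<dots> = k * (w \<bullet> g q) - k * ((w \<bullet> g q) * inverse (g q \<bullet> g q) * (g q \<bullet> g q))"
      unfolding y inner_add_right inner_scaleR_right 1 2 3 by (simp add: algebra_simps)
    also have "\<dots> = 0" unfolding 4 by simp
    finally show "(w - (orth_proj (S q) w + ((w \<bullet> g q) * inverse (g q \<bullet> g q)) *\<^sub>R g q)) \<bullet> y = 0" .
  qed simp
  moreover have "smooth_on W (\<lambda>q. orth_proj (S q) w + ((w \<bullet> g q) * inverse (g q \<bullet> g q)) *\<^sub>R g q)"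
    by (intro smooth_intros P g smooth_on_inverse \<open>open W\<close>) (use g0 in auto)
  ultimately show ?case
    using smooth_on_cong by (smt (verit, best))
qed

section \<open>Tangent spaces of embedded submanifolds\<close>

lemma submanifold_chart:
  fixes Q :: "'a::euclidean_space set"
  assumes "embedded_submanifold Q" "p \<in> Q"
  obtains W W' \<Phi> \<Psi> and S :: "'a set" where "open W" "p \<in> W" "open W'" "homeomorphism W W' \<Phi> \<Psi>"
    "C_inf_on W \<Phi>" "C_inf_on W' \<Psi>" "subspace S" "\<Phi> ` (Q \<inter> W) = S \<inter> W'"
proof -
  obtain k where "\<forall>p\<in>Q. \<exists>W W' \<Phi> \<Psi> (S :: 'a set). open W \<and> p \<in> W \<and> open W' \<and> homeomorphism W W' \<Phi> \<Psi> \<and>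
        smooth_on W \<Phi> \<and> smooth_on W' \<Psi> \<and> subspace S \<and> dim S = k \<and> \<Phi> ` (Q \<inter> W) = S \<inter> W'"
    using assms(1) unfolding embedded_submanifold_def by (elim exE)
  from bspec[OF this assms(2)] obtain W W' \<Phi> \<Psi> and S :: "'a set" where *: "open W" "p \<in> W" "open W'" "homeomorphism W W' \<Phi> \<Psi>"
    "smooth_on W \<Phi>" "smooth_on W' \<Psi>" "subspace S" "dim S = k" "\<Phi> ` (Q \<inter> W) = S \<inter> W'"
    by (elim exE conjE)
  have "C_inf_on W \<Phi>" "C_inf_on W' \<Psi>"
    using * smooth_on_open_iff by blast+
  then show ?thesis by (rule that[OF *(1-4) _ _ *(7,9)])
qed

lemma tangent_curve:
  assumes "v \<in> tangent_space Q q"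
  obtains \<gamma> where "\<gamma> 0 = q" "(\<gamma> has_vector_derivative v) (at 0)" "\<forall>\<^sub>F s in nhds 0. \<gamma> s \<in> Q" "q \<in> Q"
proof -
  obtain e \<gamma> where e: "e > 0" "\<gamma> ` {-e<..<e::real} \<subseteq> Q" "\<gamma> 0 = q" "(\<gamma> has_vector_derivative v) (at 0)"
    using assms unfolding tangent_space_def by blast
  have "\<forall>\<^sub>F s in nhds 0. s \<in> {-e<..<e}"
    using e(1) by (intro eventually_nhds_in_open) auto
  then have "\<forall>\<^sub>F s in nhds 0. \<gamma> s \<in> Q"
    by (rule eventually_mono) (use e(2) in blast)
  moreover have "q \<in> Q" using e(1-3) by force
  ultimately show ?thesis using e that by blast
qed

lemma has_vector_derivative_compose:
  assumes "(f has_derivative D) (at (c t))" "(c has_vector_derivative v) (at t)"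
  shows "((\<lambda>s. f (c s)) has_vector_derivative D v) (at t)"
  using vector_derivative_diff_chain_within[OF assms(2) has_derivative_at_withinI[OF assms(1)]] by (simp add: o_def)

lemma has_vector_derivative_cong_nhds:
  assumes "(f has_vector_derivative v) (at t)" "\<forall>\<^sub>F s in nhds t. f s = g s"
  shows "(g has_vector_derivative v) (at t)"
proof -
  obtain S where "open S" "t \<in> S" "\<And>s. s \<in> S \<Longrightarrow> f s = g s" using assms(2) unfolding eventually_nhds by blast
  then show ?thesis using has_vector_derivative_transform_within_open[OF assms(1)] by blast
qed

lemma has_vector_derivative_unique:
  assumes "(f has_vector_derivative v) (at t)" "(g has_vector_derivative w) (at t)" "\<forall>\<^sub>F s in nhds t. f s = g s"
  shows "v = w"
  using has_vector_derivative_cong_nhds[OF assms(1,3)] assms(2) vector_derivative_unique_at by blast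

lemma eventually_nhds_compose:
  assumes "(c has_vector_derivative v) (at (t::real))" "open W" "c t \<in> W"
  shows "\<forall>\<^sub>F s in nhds t. c s \<in> W"
  using has_vector_derivative_continuous[OF assms(1)] assms(2,3)
  by (simp add: continuous_at_open eventually_nhds)

text \<open>A curve in \<open>Q\<close> is read in the chart as a curve in the linear space
  \<open>S\<close>; it is fixed by the projection onto \<open>S\<close>, so its velocity lies in
  \<open>S\<close>. Conversely a segment in \<open>S\<close> lifts to a curve in \<open>Q\<close>.
  This gives the set of velocities its linear structure.\<close>

lemma tangent_space_chart:
  fixes Q S :: "'a::euclidean_space set"
  assumes W: "open W" "open W'" "homeomorphism W W' \<Phi> \<Psi>" "C_inf_on W \<Phi>" "C_inf_on W' \<Psi>" "subspace S"
    "\<Phi> ` (Q \<inter> W) = S \<inter> W'" and q: "q \<in> Q" "q \<in> W"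
  shows "tangent_space Q q = frechet_derivative \<Psi> (at (\<Phi> q)) ` S"
proof (intro equalityI subsetI)
  have \<Phi>q: "\<Phi> q \<in> W'" "\<Phi> q \<in> S" "\<Psi> (\<Phi> q) = q" using W(3,7) q by (auto simp: homeomorphism_def)
  note D\<Phi> = C_inf_on_derivative[OF W(4) q(2)]
  note D\<Psi> = C_inf_on_derivative[OF W(5) \<Phi>q(1)]
  fix v assume "v \<in> tangent_space Q q"
  then obtain \<gamma> where \<gamma>: "\<gamma> 0 = q" "(\<gamma> has_vector_derivative v) (at 0)" "\<forall>\<^sub>F s in nhds 0. \<gamma> s \<in> Q"
    using tangent_curve by metis
  define s where "s = frechet_derivative \<Phi> (at q) v"
  have s: "((\<lambda>t. \<Phi> (\<gamma> t)) has_vector_derivative s) (at 0)"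
    unfolding s_def by (rule has_vector_derivative_compose) (use D\<Phi> \<gamma> in auto)
  have \<gamma>W: "\<forall>\<^sub>F t in nhds 0. \<gamma> t \<in> Q \<inter> W"
    using eventually_conj[OF \<gamma>(3) eventually_nhds_compose[OF \<gamma>(2) W(1)]] \<gamma>(1) q(2) by simp
  have "((\<lambda>t. orth_proj S (\<Phi> (\<gamma> t))) has_vector_derivative orth_proj S s) (at 0)"
    by (rule has_vector_derivative_compose[OF _ s])
      (intro linear_imp_has_derivative linear_orth_proj W(6))
  moreover have "\<forall>\<^sub>F t in nhds 0. orth_proj S (\<Phi> (\<gamma> t)) = \<Phi> (\<gamma> t)"
    using \<gamma>W by (rule eventually_mono) (use W(6,7) orth_proj_self in blast)
  ultimately have "orth_proj S s = s" using has_vector_derivative_unique[OF _ s] by blast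
  then have "s \<in> S" using orth_proj_in[OF W(6)] by metis
  have "((\<lambda>t. \<Psi> (\<Phi> (\<gamma> t))) has_vector_derivative frechet_derivative \<Psi> (at (\<Phi> q)) s) (at 0)"
    by (rule has_vector_derivative_compose[OF _ s]) (use D\<Psi> \<gamma>(1) in simp)
  moreover have "\<forall>\<^sub>F t in nhds 0. \<Psi> (\<Phi> (\<gamma> t)) = \<gamma> t"
    using \<gamma>W by (rule eventually_mono) (use W(3) in \<open>auto simp: homeomorphism_def\<close>)
  ultimately have "frechet_derivative \<Psi> (at (\<Phi> q)) s = v" using has_vector_derivative_unique[OF _ \<gamma>(2)] by blast
  then show "v \<in> frechet_derivative \<Psi> (at (\<Phi> q)) ` S" using \<open>s \<in> S\<close> by blast
next
  have \<Phi>q: "\<Phi> q \<in> W'" "\<Phi> q \<in> S" "\<Psi> (\<Phi> q) = q" using W(3,7) q by (auto simp: homeomorphism_def)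
  note D\<Psi> = C_inf_on_derivative[OF W(5) \<Phi>q(1)]
  fix v assume "v \<in> frechet_derivative \<Psi> (at (\<Phi> q)) ` S"
  then obtain s where s: "s \<in> S" "v = frechet_derivative \<Psi> (at (\<Phi> q)) s" by blast
  define c where "c t = \<Phi> q + t *\<^sub>R s" for t
  have c': "(c has_vector_derivative s) (at t)" for t
    unfolding c_def by (auto intro!: derivative_eq_intros)
  have "\<forall>\<^sub>F t in nhds 0. c t \<in> W'" by (rule eventually_nhds_compose[OF c' W(2)]) (simp add: c_def \<Phi>q)
  then obtain e where e: "e > 0" "\<And>t. dist t 0 < e \<Longrightarrow> c t \<in> W'" unfolding eventually_nhds_metric by blast
  have cW: "c t \<in> S \<inter> W'" if "t \<in> {-e<..<e}" for t
  proof
    show "c t \<in> S" unfolding c_def by (intro subspace_add[OF W(6)] subspace_scale[OF W(6)] \<Phi>q s)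
    show "c t \<in> W'" by (rule e(2)) (use that in auto)
  qed
  have "smooth_on {-e<..<e} (\<lambda>t. \<Psi> (c t))"
  proof (rule smooth_on_compose[OF C_inf_on_imp_smooth_on[OF W(2,5)]])
    show "smooth_on {-e<..<e} c" unfolding c_def by (intro smooth_intros)
  qed (use cW in auto)
  moreover have "(\<lambda>t. \<Psi> (c t)) ` {-e<..<e} \<subseteq> Q"
  proof clarify
    fix t assume "t \<in> {-e<..<e}"
    then have "c t \<in> \<Phi> ` (Q \<inter> W)" using cW W(7) by blast
    then show "\<Psi> (c t) \<in> Q" using W(3) by (auto simp: homeomorphism_def)
  qed
  moreover have "((\<lambda>t. \<Psi> (c t)) has_vector_derivative v) (at 0)"
    unfolding s(2) by (rule has_vector_derivative_compose[OF _ c']) (use D\<Psi> in \<open>simp add: c_def\<close>)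
  moreover have "\<Psi> (c 0) = q" using \<Phi>q unfolding c_def by simp
  ultimately show "v \<in> tangent_space Q q"
    unfolding tangent_space_def using e(1) by blast
qed

text \<open>Differentiate \<open>\<Phi> (\<Psi> y) = y\<close> along a line. It makes the derivative
  of the parametrisation \<open>\<Psi>\<close> injective, so that a basis of \<open>S\<close> is
  sent to independent vectors.\<close>

lemma chart_derivative_inverse:
  fixes W W' :: "'a::euclidean_space set"
  assumes W: "open W" "open W'" "homeomorphism W W' \<Phi> \<Psi>" "C_inf_on W \<Phi>" "C_inf_on W' \<Psi>" and x: "x \<in> W"
  shows "frechet_derivative \<Phi> (at x) (frechet_derivative \<Psi> (at (\<Phi> x)) v) = v"
proof -
  have \<Phi>x: "\<Phi> x \<in> W'" "\<Psi> (\<Phi> x) = x" using W(3) x by (auto simp: homeomorphism_def)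
  define c where "c t = \<Phi> x + t *\<^sub>R v" for t
  have c': "(c has_vector_derivative v) (at 0)" "c 0 = \<Phi> x"
    unfolding c_def by (auto intro!: derivative_eq_intros)
  have 1: "((\<lambda>t. \<Psi> (c t)) has_vector_derivative frechet_derivative \<Psi> (at (\<Phi> x)) v) (at 0)"
    by (rule has_vector_derivative_compose[OF _ c'(1)]) (use C_inf_on_derivative[OF W(5) \<Phi>x(1)] c' in simp)
  have "((\<lambda>t. \<Phi> (\<Psi> (c t))) has_vector_derivative frechet_derivative \<Phi> (at x) (frechet_derivative \<Psi> (at (\<Phi> x)) v)) (at 0)"
    by (rule has_vector_derivative_compose[OF _ 1]) (use C_inf_on_derivative[OF W(4) x] c' \<Phi>x in simp)
  moreover have "\<forall>\<^sub>F t in nhds 0. \<Phi> (\<Psi> (c t)) = c t"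
  proof -
    have "\<forall>\<^sub>F t in nhds 0. c t \<in> W'" by (rule eventually_nhds_compose[OF c'(1) W(2)]) (use c' \<Phi>x in simp)
    then show ?thesis by (rule eventually_mono) (use W(3) in \<open>auto simp: homeomorphism_def\<close>)
  qed
  ultimately show ?thesis using has_vector_derivative_unique[OF _ c'(1)] by blast
qed

lemma subspace_tangent_space:
  fixes Q :: "'a::euclidean_space set"
  assumes "embedded_submanifold Q" "q \<in> Q"
  shows "subspace (tangent_space Q q)"
proof -
  obtain W W' \<Phi> \<Psi> and S :: "'a set" where W: "open W" "q \<in> W" "open W'" "homeomorphism W W' \<Phi> \<Psi>"
    "C_inf_on W \<Phi>" "C_inf_on W' \<Psi>" "subspace S" "\<Phi> ` (Q \<inter> W) = S \<inter> W'"
    using submanifold_chart[OF assms] .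
  have "\<Phi> q \<in> W'" using W(2,4) by (auto simp: homeomorphism_def)
  then have "linear (frechet_derivative \<Psi> (at (\<Phi> q)))"
    using C_inf_on_derivative[OF W(6)] has_derivative_linear by blast
  then show ?thesis
    unfolding tangent_space_chart[OF W(1,3-8) assms(2) W(2)] using W(7) linear_subspace_image by blast
qed

text \<open>A basis of the tangent spaces by global vector fields need not exist. This family may be
  redundant, yet it is global and has the canonical coefficients
  \<open>w \<bullet> b\<close>.\<close>

definition tangent_frame :: "'a::euclidean_space set \<Rightarrow> 'a \<Rightarrow> 'a \<Rightarrow> 'a" where
  "tangent_frame Q b q = orth_proj (tangent_space Q q) b"

lemma orth_proj_tangent_frame:
  assumes "embedded_submanifold Q" "q \<in> Q"
  shows "orth_proj (tangent_space Q q) w = (\<Sum>b\<in>Basis. (w \<bullet> b) *\<^sub>R tangent_frame Q b q)"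
  unfolding tangent_frame_def by (rule linear_Basis_expansion[OF linear_orth_proj[OF subspace_tangent_space[OF assms]]])

lemma tangent_frame_representation:
  assumes "embedded_submanifold Q" "q \<in> Q" "w \<in> tangent_space Q q"
  shows "(\<Sum>b\<in>Basis. (w \<bullet> b) *\<^sub>R tangent_frame Q b q) = w"
  using orth_proj_tangent_frame[OF assms(1,2)] orth_proj_self[OF subspace_tangent_space[OF assms(1,2)] assms(3)] by simp

text \<open>In a chart the images of a basis of \<open>S\<close> under the derivative of
  \<open>\<Psi>\<close> form a smoothly varying basis of the tangent space, and Gram-Schmidt turns
  it into a smooth projection.\<close>

lemma vector_field_tangent_frame:
  fixes Q :: "'a::euclidean_space set"
  assumes "embedded_submanifold Q"
  shows "vector_field Q (tangent_frame Q w)"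
  unfolding vector_field_def
proof (intro conjI ballI)
  show "tangent_frame Q w q \<in> tangent_space Q q" if "q \<in> Q" for q
    unfolding tangent_frame_def by (rule orth_proj_in[OF subspace_tangent_space[OF assms that]])
  show "smooth_on Q (tangent_frame Q w)"
  proof (rule smooth_onI)
    fix p assume "p \<in> Q"
    obtain W W' \<Phi> \<Psi> and S :: "'a set" where W: "open W" "p \<in> W" "open W'" "homeomorphism W W' \<Phi> \<Psi>"
      "C_inf_on W \<Phi>" "C_inf_on W' \<Psi>" "subspace S" "\<Phi> ` (Q \<inter> W) = S \<inter> W'"
      using submanifold_chart[OF assms \<open>p \<in> Q\<close>] .
    obtain B where B: "B \<subseteq> S" "independent B" "S \<subseteq> span B" using basis_exists[of S] by metis
    have SB: "span B = S" using B(1,3) span_minimal[OF B(1) W(7)] by blast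
    define t where "t b x = frechet_derivative \<Psi> (at (\<Phi> x)) b" for b x
    have \<Phi>W: "\<Phi> x \<in> W'" if "x \<in> W" for x using that W(4) by (auto simp: homeomorphism_def)
    have lin: "linear (frechet_derivative \<Psi> (at (\<Phi> x)))" if "x \<in> W" for x
      using C_inf_on_derivative[OF W(6) \<Phi>W[OF that]] has_derivative_linear by blast
    have inj: "inj (frechet_derivative \<Psi> (at (\<Phi> x)))" if "x \<in> W" for x
      by (rule inj_on_inverseI) (rule chart_derivative_inverse[OF W(1,3-6) that])
    have "smooth_on W (\<lambda>x. orth_proj (span ((\<lambda>b. t b x) ` B)) w)"
    proof (rule smooth_on_orth_proj_span[OF W(1)])
      show "finite B" using B(2) independent_imp_finite by blast
      show "smooth_on W (t b)" for b
        unfolding t_def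
        by (rule smooth_on_compose[OF C_inf_on_imp_smooth_on[OF W(3) C_inf_on_directional[OF W(6)]] C_inf_on_imp_smooth_on[OF W(1,5)]])
          (use \<Phi>W in auto)
      show "inj_on (\<lambda>b. t b q) B \<and> independent ((\<lambda>b. t b q) ` B)" if "q \<in> W" for q
        unfolding t_def using inj[OF that] lin[OF that] B(2) linear_independent_injective_image[OF lin[OF that] B(2)]
        by (auto intro: inj_on_subset)
    qed
    moreover have "orth_proj (span ((\<lambda>b. t b x) ` B)) w = tangent_frame Q w x" if "x \<in> Q" "x \<in> W" for x
    proof -
      have "span ((\<lambda>b. t b x) ` B) = frechet_derivative \<Psi> (at (\<Phi> x)) ` S"
        unfolding t_def SB[symmetric] using linear_span_image[OF lin[OF that(2)]] .
      then show ?thesis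
        unfolding tangent_frame_def tangent_space_chart[OF W(1,3-8) that] by simp
    qed
    ultimately show "\<exists>W g. open W \<and> p \<in> W \<and> C_inf_on W g \<and> (\<forall>x\<in>Q \<inter> W. g x = tangent_frame Q w x)"
      using W(1,2) smooth_on_open_iff by (metis (no_types, lifting) IntD1 IntD2)
  qed
qed

text \<open>The chart flattens \<open>Q\<close>, so project onto \<open>S\<close> there and map
  back; the domain is shrunk until the projected point stays in the image of the chart.\<close>

lemma submanifold_retraction:
  fixes Q :: "'a::euclidean_space set"
  assumes "embedded_submanifold Q" "p \<in> Q"
  obtains W r where "open W" "p \<in> W" "C_inf_on W r" "r ` W \<subseteq> Q" "\<And>x. x \<in> Q \<Longrightarrow> x \<in> W \<Longrightarrow> r x = x"
proof -
  obtain W W' \<Phi> \<Psi> and S :: "'a set" where W: "open W" "p \<in> W" "open W'" "homeomorphism W W' \<Phi> \<Psi>"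
    "C_inf_on W \<Phi>" "C_inf_on W' \<Psi>" "subspace S" "\<Phi> ` (Q \<inter> W) = S \<inter> W'"
    using submanifold_chart[OF assms] .
  have \<pi>: "bounded_linear (orth_proj S)" using linear_orth_proj[OF W(7)] linear_conv_bounded_linear by blast
  have \<pi>\<Phi>: "smooth_on W (\<lambda>x. orth_proj S (\<Phi> x))"
    by (rule smooth_on_compose_linear[OF \<pi> C_inf_on_imp_smooth_on[OF W(1,5)]])
  define V where "V = W \<inter> (\<lambda>x. orth_proj S (\<Phi> x)) -` W'"
  have fix\<Phi>: "orth_proj S (\<Phi> x) = \<Phi> x" "\<Psi> (\<Phi> x) = x" "\<Phi> x \<in> W'" if "x \<in> Q" "x \<in> W" for x
    using that W(4,8) orth_proj_self[OF W(7), of "\<Phi> x"] by (auto simp: homeomorphism_def)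
  show ?thesis
  proof
    show V: "open V" unfolding V_def
      using continuous_open_preimage[OF smooth_on_continuous[OF \<pi>\<Phi>] W(1,3)] .
    show "p \<in> V" unfolding V_def using W(2) fix\<Phi>[OF assms(2) W(2)] by simp
    have "smooth_on V (\<lambda>x. \<Psi> (orth_proj S (\<Phi> x)))"
      by (rule smooth_on_compose[OF C_inf_on_imp_smooth_on[OF W(3,6)] smooth_on_subset[OF \<pi>\<Phi>]]) (auto simp: V_def)
    then show "C_inf_on V (\<lambda>x. \<Psi> (orth_proj S (\<Phi> x)))" by (rule iffD1[OF smooth_on_open_iff[OF V]])
    show "(\<lambda>x. \<Psi> (orth_proj S (\<Phi> x))) ` V \<subseteq> Q"
    proof clarify
      fix x assume "x \<in> V"
      then have "orth_proj S (\<Phi> x) \<in> \<Phi> ` (Q \<inter> W)" unfolding V_def W(8) using orth_proj_in[OF W(7)] by auto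
      then show "\<Psi> (orth_proj S (\<Phi> x)) \<in> Q" using W(4) by (auto simp: homeomorphism_def)
    qed
    show "\<Psi> (orth_proj S (\<Phi> x)) = x" if "x \<in> Q" "x \<in> V" for x
      using fix\<Phi>[of x] that unfolding V_def by auto
  qed
qed

section \<open>Derivatives along a submanifold\<close>

abbreviation deriv_within :: "'a::euclidean_space set \<Rightarrow> ('a \<Rightarrow> 'b::euclidean_space) \<Rightarrow> 'a \<Rightarrow> 'a \<Rightarrow> 'b" where
  "deriv_within Q f q v \<equiv> frechet_derivative f (at q within Q) v"

lemma linear_deriv_within: "smooth_on Q f \<Longrightarrow> q \<in> Q \<Longrightarrow> linear (deriv_within Q f q)"
  using smooth_on_derivative_within has_derivative_linear by blast

text \<open>Both sides are the velocity of the same curve \<open>f (\<gamma> s)\<close>, where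
  \<open>\<gamma>\<close> represents \<open>v\<close>. On tangent vectors the arbitrary choice in
  \<open>deriv_within\<close> therefore has no influence.\<close>

lemma deriv_within_extension:
  assumes "smooth_on Q f" "v \<in> tangent_space Q q" "open W" "q \<in> W" "C_inf_on W g"
    and "\<And>x. x \<in> Q \<Longrightarrow> x \<in> W \<Longrightarrow> g x = f x"
  shows "deriv_within Q f q v = frechet_derivative g (at q) v"
proof -
  obtain \<gamma> where \<gamma>: "\<gamma> 0 = q" "(\<gamma> has_vector_derivative v) (at 0)" "\<forall>\<^sub>F s in nhds 0. \<gamma> s \<in> Q" "q \<in> Q"
    using tangent_curve[OF assms(2)] .
  have "((\<lambda>s. f (\<gamma> s)) has_vector_derivative deriv_within Q f q v) (at 0)"
    using smooth_on_vector_derivative_compose[OF assms(1) _ \<gamma>(2,3)] \<gamma>(1,4) by simp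
  moreover have "((\<lambda>s. g (\<gamma> s)) has_vector_derivative frechet_derivative g (at q) v) (at 0)"
    by (rule has_vector_derivative_compose[OF _ \<gamma>(2)]) (use C_inf_on_derivative[OF assms(5,4)] \<gamma>(1) in simp)
  moreover have "\<forall>\<^sub>F s in nhds 0. f (\<gamma> s) = g (\<gamma> s)"
    using eventually_conj[OF \<gamma>(3) eventually_nhds_compose[OF \<gamma>(2) assms(3)]] assms(4,6) \<gamma>(1)
    by (auto elim!: eventually_mono)
  ultimately show ?thesis by (rule has_vector_derivative_unique)
qed

lemma smooth_on_deriv_within:
  assumes f: "smooth_on Q f" and X: "vector_field Q X"
  shows "smooth_on Q (\<lambda>q. deriv_within Q f q (X q))"
proof (rule smooth_onI)
  fix p assume p: "p \<in> Q"
  obtain W g where W: "open W" "p \<in> W" "C_inf_on W g" "\<And>x. x \<in> Q \<Longrightarrow> x \<in> W \<Longrightarrow> g x = f x"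
    using smooth_onE[OF f p] by blast
  obtain V Y where V: "open V" "p \<in> V" "C_inf_on V Y" "\<And>x. x \<in> Q \<Longrightarrow> x \<in> V \<Longrightarrow> Y x = X x"
    using smooth_onE[of Q X p] p X unfolding vector_field_def by blast
  define h where "h x = (\<Sum>b\<in>Basis. (Y x \<bullet> b) *\<^sub>R frechet_derivative g (at x) b)" for x
  have o: "open (W \<inter> V)" using W(1) V(1) by auto
  have s1: "smooth_on (W \<inter> V) (\<lambda>x. frechet_derivative g (at x) b)" for b
    using C_inf_on_imp_smooth_on[OF W(1) C_inf_on_directional[OF W(3)]] smooth_on_subset by blast
  have s2: "smooth_on (W \<inter> V) Y"
    using C_inf_on_imp_smooth_on[OF V(1,3)] smooth_on_subset by blast
  have "smooth_on (W \<inter> V) h" unfolding h_def by (intro smooth_intros s1 s2)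
  then have "C_inf_on (W \<inter> V) h" using smooth_on_open_iff[OF o] by blast
  moreover have "h x = deriv_within Q f x (X x)" if "x \<in> Q \<inter> (W \<inter> V)" for x
  proof -
    have x: "x \<in> Q" "x \<in> W" "x \<in> V" using that by auto
    have "linear (frechet_derivative g (at x))" using C_inf_on_derivative[OF W(3) x(2)] has_derivative_linear by blast
    then have "frechet_derivative g (at x) (X x) = (\<Sum>b\<in>Basis. (X x \<bullet> b) *\<^sub>R frechet_derivative g (at x) b)"
      by (rule linear_Basis_expansion)
    moreover have "deriv_within Q f x (X x) = frechet_derivative g (at x) (X x)"
      by (rule deriv_within_extension[OF f _ W(1) x(2) W(3,4)]) (use X x in \<open>auto simp: vector_field_def\<close>)
    ultimately show ?thesis unfolding h_def using V(4)[OF x(1,3)] by simp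
  qed
  ultimately show "\<exists>W h. open W \<and> p \<in> W \<and> C_inf_on W h \<and> (\<forall>x\<in>Q \<inter> W. h x = deriv_within Q f x (X x))"
    using o W(2) V(2) by blast
qed

text \<open>The derivative in direction \<open>v\<close> of the orthogonal projection onto the tangent space.\<close>

definition proj_deriv :: "'a::euclidean_space set \<Rightarrow> 'a \<Rightarrow> 'a \<Rightarrow> 'a \<Rightarrow> 'a" where
  "proj_deriv Q q v w = (\<Sum>b\<in>Basis. (w \<bullet> b) *\<^sub>R deriv_within Q (tangent_frame Q b) q v)"

text \<open>Product rule for the projection applied to \<open>V\<close>, both depending on time: in
  frame coordinates the result is a sum of products of \<open>V s \<bullet> b\<close> with smooth
  fields along the curve.\<close>

lemma has_vector_derivative_orth_proj_curve:
  assumes Q: "embedded_submanifold Q" and c: "c t \<in> Q" "(c has_vector_derivative v) (at t)" "\<forall>\<^sub>F s in nhds t. c s \<in> Q"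
    and V: "(V has_vector_derivative V') (at t)"
  shows "((\<lambda>s. orth_proj (tangent_space Q (c s)) (V s)) has_vector_derivative
      (proj_deriv Q (c t) v (V t) + orth_proj (tangent_space Q (c t)) V')) (at t)"
proof (rule has_vector_derivative_cong_nhds)
  have fr: "smooth_on Q (tangent_frame Q b)" for b using vector_field_tangent_frame[OF Q] unfolding vector_field_def by blast
  have "((\<lambda>s. \<Sum>b\<in>Basis. (V s \<bullet> b) *\<^sub>R tangent_frame Q b (c s)) has_vector_derivative
      (\<Sum>b\<in>Basis. (V t \<bullet> b) *\<^sub>R deriv_within Q (tangent_frame Q b) (c t) v + (V' \<bullet> b) *\<^sub>R tangent_frame Q b (c t))) (at t)"
  proof (intro has_vector_derivative_sum)
    fix b :: 'a
    have "((\<lambda>s. V s \<bullet> b) has_vector_derivative V' \<bullet> b) (at t)"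
      using bounded_linear.has_vector_derivative[OF bounded_linear_inner_left V] .
    from bounded_bilinear.has_vector_derivative[OF bounded_bilinear_scaleR this smooth_on_vector_derivative_compose[OF fr c]]
    show "((\<lambda>s. (V s \<bullet> b) *\<^sub>R tangent_frame Q b (c s)) has_vector_derivative
      (V t \<bullet> b) *\<^sub>R deriv_within Q (tangent_frame Q b) (c t) v + (V' \<bullet> b) *\<^sub>R tangent_frame Q b (c t)) (at t)" .
  qed
  then show "((\<lambda>s. \<Sum>b\<in>Basis. (V s \<bullet> b) *\<^sub>R tangent_frame Q b (c s)) has_vector_derivative
      (proj_deriv Q (c t) v (V t) + orth_proj (tangent_space Q (c t)) V')) (at t)"
    unfolding proj_deriv_def orth_proj_tangent_frame[OF Q c(1)] by (simp add: sum.distrib)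
  show "\<forall>\<^sub>F s in nhds t. (\<Sum>b\<in>Basis. (V s \<bullet> b) *\<^sub>R tangent_frame Q b (c s)) = orth_proj (tangent_space Q (c s)) (V s)"
    using c(3) by (rule eventually_mono) (simp add: orth_proj_tangent_frame[OF Q])
qed

text \<open>Differentiating \<open>P\<^sup>2 = P\<close> gives \<open>P DP = DP (1 - P)\<close>.\<close>

lemma orth_proj_proj_deriv:
  assumes Q: "embedded_submanifold Q" and v: "v \<in> tangent_space Q q" and w: "w \<in> tangent_space Q q"
  shows "orth_proj (tangent_space Q q) (proj_deriv Q q v w) = 0"
proof -
  obtain \<gamma> where \<gamma>: "\<gamma> 0 = q" "(\<gamma> has_vector_derivative v) (at 0)" "\<forall>\<^sub>F s in nhds 0. \<gamma> s \<in> Q" "q \<in> Q"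
    using tangent_curve[OF v] .
  note S = subspace_tangent_space[OF Q]
  let ?P = "\<lambda>s. orth_proj (tangent_space Q (\<gamma> s))"
  have \<gamma>0: "\<gamma> 0 \<in> Q" using \<gamma> by simp
  have 1: "((\<lambda>s. ?P s w) has_vector_derivative proj_deriv Q q v w) (at 0)"
    using has_vector_derivative_orth_proj_curve[OF Q \<gamma>0 \<gamma>(2,3) has_vector_derivative_const, of w] \<gamma>(1)
      linear_0[OF linear_orth_proj[OF S[OF \<gamma>(4)]]] by simp
  have 2: "((\<lambda>s. ?P s (?P s w)) has_vector_derivative proj_deriv Q q v (?P 0 w) + orth_proj (tangent_space Q q) (proj_deriv Q q v w)) (at 0)"
    using has_vector_derivative_orth_proj_curve[OF Q \<gamma>0 \<gamma>(2,3) 1] \<gamma>(1) by simp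
  have "\<forall>\<^sub>F s in nhds 0. ?P s (?P s w) = ?P s w"
    using \<gamma>(3) by (rule eventually_mono) (intro orth_proj_self S orth_proj_in)
  from has_vector_derivative_unique[OF 2 1 this] show ?thesis
    using orth_proj_self[OF S[OF \<gamma>(4)] w] \<gamma>(1) by simp
qed

section \<open>The tangent bundle\<close>

text \<open>The tangent bundle is the zero set of \<open>P(q) v - v\<close>, with \<open>P\<close>
  the tangent projection, on the closed set of all \<open>(q, v)\<close> with \<open>q\<close> in
  \<open>Q\<close>; frame coordinates make this function continuous.\<close>

lemma closed_state_space:
  assumes Q: "embedded_submanifold Q" and "closed Q"
  shows "closed (state_space Q)"
proof -
  have fr: "smooth_on Q (tangent_frame Q b)" for b using vector_field_tangent_frame[OF Q] unfolding vector_field_def by blast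
  define g where "g p = (\<Sum>b\<in>Basis. (snd p \<bullet> b) *\<^sub>R tangent_frame Q b (fst p)) - snd p" for p
  have s: "smooth_on (Q \<times> UNIV) (\<lambda>p. tangent_frame Q b (fst p))" for b
    by (rule smooth_on_compose[OF fr]) (auto intro!: smooth_intros)
  have "smooth_on (Q \<times> UNIV) g" unfolding g_def by (intro smooth_intros s)
  then have "closed ((Q \<times> UNIV) \<inter> g -` {0})"
    using \<open>closed Q\<close> by (intro continuous_closed_preimage smooth_on_continuous closed_Times) auto
  moreover have "(Q \<times> UNIV) \<inter> g -` {0} = tangent_bundle Q"
  proof (intro equalityI subsetI)
    fix p assume p: "p \<in> (Q \<times> UNIV) \<inter> g -` {0}"
    then have "orth_proj (tangent_space Q (fst p)) (snd p) = snd p"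
      unfolding g_def by (auto simp: orth_proj_tangent_frame[OF Q])
    moreover have "fst p \<in> Q" using p by auto
    ultimately show "p \<in> tangent_bundle Q"
      unfolding tangent_bundle_def using orth_proj_in[OF subspace_tangent_space[OF Q]] by (metis SigmaI prod.collapse)
  next
    fix p assume "p \<in> tangent_bundle Q"
    then show "p \<in> (Q \<times> UNIV) \<inter> g -` {0}"
      unfolding tangent_bundle_def g_def by (auto simp: tangent_frame_representation[OF Q])
  qed
  ultimately show ?thesis unfolding state_space_def by (auto intro: closed_Times)
qed

text \<open>Retract the base point into \<open>Q\<close>, then project the velocity onto the tangent
  space there. The condition on \<open>w - proj_deriv Q q v p\<close> says that
  \<open>(v, w)\<close> is tangent to the tangent bundle at \<open>(q, p)\<close>: it is the
  derivative of \<open>P p = p\<close> along the motion. Such a vector is the velocity of a curve in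
  the state space, on which the retraction is the identity.\<close>

lemma state_space_retraction:
  fixes Q :: "'a::euclidean_space set"
  assumes Q: "embedded_submanifold Q" and y0: "y0 \<in> state_space Q"
  shows "\<exists>W \<rho>. open W \<and> y0 \<in> W \<and> C_inf_on W \<rho> \<and> \<rho> ` W \<subseteq> state_space Q \<and> (\<forall>x\<in>state_space Q \<inter> W. \<rho> x = x) \<and>
    (\<forall>q p \<eta> v w e. ((q, p), \<eta>) \<in> state_space Q \<inter> W \<longrightarrow> v \<in> tangent_space Q q \<longrightarrow> w - proj_deriv Q q v p \<in> tangent_space Q q \<longrightarrow>
       frechet_derivative \<rho> (at ((q, p), \<eta>)) ((v, w), e :: real) = ((v, w), e))"
proof -
  have fr: "smooth_on Q (tangent_frame Q b)" for b using vector_field_tangent_frame[OF Q] unfolding vector_field_def by blast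
  note S = subspace_tangent_space[OF Q]
  have "fst (fst y0) \<in> Q" using y0 unfolding state_space_def tangent_bundle_def by auto
  then obtain W r where W: "open W" "fst (fst y0) \<in> W" "C_inf_on W r" "r ` W \<subseteq> Q" "\<And>x. x \<in> Q \<Longrightarrow> x \<in> W \<Longrightarrow> r x = x"
    using submanifold_retraction[OF Q] by metis
  define V where "V = (W \<times> (UNIV :: 'a set)) \<times> (UNIV :: real set)"
  define \<rho> where "\<rho> y = ((r (fst (fst y)), \<Sum>b\<in>Basis. (snd (fst y) \<bullet> b) *\<^sub>R tangent_frame Q b (r (fst (fst y)))), snd y)"
    for y :: "('a \<times> 'a) \<times> real"
  have V: "open V" unfolding V_def using W(1) by (intro open_Times) auto
  have "y0 \<in> V" unfolding V_def using W(2) by (cases y0) auto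
  have r: "smooth_on V (\<lambda>y. r (fst (fst y)))"
    by (rule smooth_on_compose[OF C_inf_on_imp_smooth_on[OF W(1,3)]]) (auto simp: V_def intro!: smooth_intros)
  have fr': "smooth_on V (\<lambda>y. tangent_frame Q b (r (fst (fst y))))" for b
    by (rule smooth_on_compose[OF fr r]) (use W(4) in \<open>auto simp: V_def\<close>)
  have "smooth_on V \<rho>" unfolding \<rho>_def by (intro smooth_intros r fr')
  then have \<rho>C: "C_inf_on V \<rho>" using smooth_on_open_iff[OF V] by blast
  have \<rho>_eq: "\<rho> ((x, p), \<eta>) = ((r x, orth_proj (tangent_space Q (r x)) p), \<eta>)" if "x \<in> W" for x p \<eta>
    unfolding \<rho>_def using W(4) that by (simp add: orth_proj_tangent_frame[OF Q] image_subset_iff)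
  have \<rho>M: "\<rho> ` V \<subseteq> state_space Q"
  proof (rule image_subsetI)
    fix y assume "y \<in> V"
    moreover obtain x p \<eta> where y: "y = ((x, p), \<eta>)" by (metis prod.collapse)
    ultimately have "x \<in> W" "r x \<in> Q" using W(4) unfolding V_def by auto
    then show "\<rho> y \<in> state_space Q"
      unfolding y \<rho>_eq[OF \<open>x \<in> W\<close>] state_space_def tangent_bundle_def using orth_proj_in[OF S] by auto
  qed
  have \<rho>id: "\<rho> y = y" if "y \<in> state_space Q" "y \<in> V" for y
  proof -
    obtain x p \<eta> where y: "y = ((x, p), \<eta>)" by (metis prod.collapse)
    then have "x \<in> W" "x \<in> Q" "p \<in> tangent_space Q x" using that unfolding V_def state_space_def tangent_bundle_def by auto
    then show ?thesis unfolding y \<rho>_eq[OF \<open>x \<in> W\<close>] W(5)[OF \<open>x \<in> Q\<close> \<open>x \<in> W\<close>] using orth_proj_self[OF S] by simp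
  qed
  have "frechet_derivative \<rho> (at ((q, p), \<eta>)) ((v, w), e) = ((v, w), e)"
    if y: "((q, p), \<eta>) \<in> state_space Q \<inter> V" and v: "v \<in> tangent_space Q q" and w: "w - proj_deriv Q q v p \<in> tangent_space Q q"
    for q p \<eta> v w e
  proof -
    have q: "q \<in> Q" "p \<in> tangent_space Q q" "q \<in> W" using y unfolding V_def state_space_def tangent_bundle_def by auto
    obtain \<gamma> where \<gamma>: "\<gamma> 0 = q" "(\<gamma> has_vector_derivative v) (at 0)" "\<forall>\<^sub>F s in nhds 0. \<gamma> s \<in> Q"
      using tangent_curve[OF v] by metis
    let ?P = "\<lambda>x. orth_proj (tangent_space Q x)"
    have "((\<lambda>s. p + s *\<^sub>R w) has_vector_derivative w) (at 0)" by (auto intro!: derivative_eq_intros)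
    from has_vector_derivative_orth_proj_curve[OF Q _ \<gamma>(2,3) this]
    have p': "((\<lambda>s. ?P (\<gamma> s) (p + s *\<^sub>R w)) has_vector_derivative proj_deriv Q q v p + ?P q w) (at 0)"
      using \<gamma>(1) q(1) by simp
    have "?P q w = ?P q (w - proj_deriv Q q v p) + ?P q (proj_deriv Q q v p)"
      using linear_add[OF linear_orth_proj[OF S[OF q(1)]], of "w - proj_deriv Q q v p" "proj_deriv Q q v p"] by simp
    also have "\<dots> = w - proj_deriv Q q v p"
      using orth_proj_self[OF S[OF q(1)] w] orth_proj_proj_deriv[OF Q v q(2)] by simp
    finally have "proj_deriv Q q v p + ?P q w = w" by simp
    \<comment> \<open>Projecting the straight line through \<open>p\<close> in direction
      \<open>w\<close> keeps the curve in the bundle; the tangency condition makes the velocity of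
      the projected line \<open>w\<close> again.\<close>
    define c where "c s = ((\<gamma> s, ?P (\<gamma> s) (p + s *\<^sub>R w)), \<eta> + s * e)" for s
    have "((\<lambda>s. \<eta> + s * e) has_vector_derivative e) (at 0)" by (auto intro!: derivative_eq_intros)
    then have c': "(c has_vector_derivative ((v, w), e)) (at 0)"
      unfolding c_def using \<gamma>(2) p' \<open>proj_deriv Q q v p + ?P q w = w\<close>
      by (auto intro!: has_vector_derivative_Pair)
    have c0: "c 0 = ((q, p), \<eta>)" unfolding c_def using \<gamma>(1) orth_proj_self[OF S[OF q(1)] q(2)] by simp
    have "((\<lambda>s. \<rho> (c s)) has_vector_derivative frechet_derivative \<rho> (at ((q, p), \<eta>)) ((v, w), e)) (at 0)"
      by (rule has_vector_derivative_compose[OF _ c']) (use C_inf_on_derivative[OF \<rho>C] c0 y in auto)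
    moreover have "\<forall>\<^sub>F s in nhds 0. \<rho> (c s) = c s"
    proof -
      have "\<gamma> 0 \<in> W" using q(3) \<gamma>(1) by simp
      note ev = eventually_conj[OF \<gamma>(3) eventually_nhds_compose[OF \<gamma>(2) W(1) this]]
      have "\<rho> (c s) = c s" if s: "\<gamma> s \<in> Q \<and> \<gamma> s \<in> W" for s
        unfolding c_def using s by (intro \<rho>id) (auto simp: V_def state_space_def tangent_bundle_def orth_proj_in[OF S])
      with ev show ?thesis by (rule eventually_mono)
    qed
    ultimately show ?thesis using has_vector_derivative_unique[OF _ c'] by blast
  qed
  then show ?thesis using V \<open>y0 \<in> V\<close> \<rho>C \<rho>M \<rho>id by (intro exI[of _ V] exI[of _ \<rho>]) auto
qed

section \<open>Affine connections in the global frame\<close>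

locale submanifold_connection =
  fixes Q :: "'a::euclidean_space set" and nabla :: "('a \<Rightarrow> 'a) \<Rightarrow> ('a \<Rightarrow> 'a) \<Rightarrow> 'a \<Rightarrow> 'a"
  assumes Q: "embedded_submanifold Q" and conn: "affine_connection Q nabla"
begin

abbreviation E :: "'a \<Rightarrow> 'a \<Rightarrow> 'a" where "E \<equiv> tangent_frame Q"

lemmas subspace_T = subspace_tangent_space[OF Q]

lemmas conn_axioms = conn[unfolded affine_connection_def]

lemmas nabla_vf = conn_axioms[THEN conjunct1, rule_format]
lemmas nabla_add_left = conn_axioms[THEN conjunct2, THEN conjunct2, THEN conjunct1, rule_format]
lemmas nabla_scale_left = conn_axioms[THEN conjunct2, THEN conjunct2, THEN conjunct2, THEN conjunct1, rule_format]
lemmas nabla_add_right = conn_axioms[THEN conjunct2, THEN conjunct2, THEN conjunct2, THEN conjunct2, THEN conjunct1, rule_format]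
lemmas nabla_scale_right = conn_axioms[THEN conjunct2, THEN conjunct2, THEN conjunct2, THEN conjunct2, THEN conjunct2,
    rule_format, unfolded lie_derivative_def]

lemma nabla_cong:
  assumes "vector_field Q X" "vector_field Q X'" "vector_field Q Y" "vector_field Q Y'"
    "\<And>q. q \<in> Q \<Longrightarrow> X q = X' q" "\<And>q. q \<in> Q \<Longrightarrow> Y q = Y' q" "q \<in> Q"
  shows "nabla X Y q = nabla X' Y' q"
  using assms(5,6)
  by (intro conn_axioms[THEN conjunct2, THEN conjunct1, rule_format, OF assms(1-4) _ assms(7)]) auto

lemma vf_E: "vector_field Q (E b)" by (rule vector_field_tangent_frame[OF Q])

lemma vf_smooth: "vector_field Q X \<Longrightarrow> smooth_on Q X" unfolding vector_field_def by simp

lemma vf_in: "vector_field Q X \<Longrightarrow> q \<in> Q \<Longrightarrow> X q \<in> tangent_space Q q" unfolding vector_field_def by simp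

lemma vf_zero: "vector_field Q (\<lambda>p. 0)"
  unfolding vector_field_def using subspace_0[OF subspace_T] by (auto intro: smooth_on_const)

lemma vf_add: "vector_field Q X \<Longrightarrow> vector_field Q Y \<Longrightarrow> vector_field Q (\<lambda>p. X p + Y p)"
  unfolding vector_field_def using subspace_add[OF subspace_T] by (auto intro: smooth_on_add)

lemma vf_scale: "smooth_on Q f \<Longrightarrow> vector_field Q X \<Longrightarrow> vector_field Q (\<lambda>p. f p *\<^sub>R X p)"
  unfolding vector_field_def using subspace_scale[OF subspace_T] by (auto intro: smooth_on_scaleR)

lemma vf_sum:
  "(\<And>i. i \<in> I \<Longrightarrow> smooth_on Q (f i)) \<Longrightarrow> (\<And>i. i \<in> I \<Longrightarrow> vector_field Q (X i)) \<Longrightarrow>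
    vector_field Q (\<lambda>p. \<Sum>i\<in>I. f i p *\<^sub>R X i p)"
proof (induction I rule: infinite_finite_induct)
  case (insert i I)
  have "vector_field Q (\<lambda>p. f i p *\<^sub>R X i p + (\<Sum>i\<in>I. f i p *\<^sub>R X i p))"
    by (intro vf_add vf_scale insert) (use insert in auto)
  then show ?case using insert.hyps by simp
qed (simp_all add: vf_zero)

lemma nabla_sum_left:
  assumes "finite I" "\<And>i. i \<in> I \<Longrightarrow> smooth_on Q (f i)" "\<And>i. i \<in> I \<Longrightarrow> vector_field Q (X i)" "vector_field Q Y" "q \<in> Q"
  shows "nabla (\<lambda>p. \<Sum>i\<in>I. f i p *\<^sub>R X i p) Y q = (\<Sum>i\<in>I. f i q *\<^sub>R nabla (X i) Y q)"
  using assms(1-3)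
proof (induction I rule: finite_induct)
  case empty
  \<comment> \<open>Additivity for 0 + 0 forces the value 0.\<close>
  show ?case using nabla_add_left[OF vf_zero vf_zero assms(4,5)] by simp
next
  case (insert i I)
  have f: "smooth_on Q (f i)" and X: "vector_field Q (X i)" using insert.prems by auto
  have s: "vector_field Q (\<lambda>p. \<Sum>i\<in>I. f i p *\<^sub>R X i p)" using insert.prems by (intro vf_sum) auto
  show ?case
    using insert nabla_add_left[OF vf_scale[OF f X] s assms(4,5)] nabla_scale_left[OF f X assms(4,5)] by simp
qed

lemma nabla_sum_right:
  assumes "finite I" "\<And>i. i \<in> I \<Longrightarrow> smooth_on Q (f i)" "\<And>i. i \<in> I \<Longrightarrow> vector_field Q (Y i)" "vector_field Q X" "q \<in> Q"
  shows "nabla X (\<lambda>p. \<Sum>i\<in>I. f i p *\<^sub>R Y i p) q = (\<Sum>i\<in>I. deriv_within Q (f i) q (X q) *\<^sub>R Y i q + f i q *\<^sub>R nabla X (Y i) q)"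
  using assms(1-3)
proof (induction I rule: finite_induct)
  case empty
  show ?case using nabla_add_right[OF assms(4) vf_zero vf_zero assms(5)] by simp
next
  case (insert i I)
  have f: "smooth_on Q (f i)" and Y: "vector_field Q (Y i)" using insert.prems by auto
  have s: "vector_field Q (\<lambda>p. \<Sum>i\<in>I. f i p *\<^sub>R Y i p)" using insert.prems by (intro vf_sum) auto
  show ?case
    using insert nabla_add_right[OF assms(4) vf_scale[OF f Y] s assms(5)] nabla_scale_right[OF f assms(4) Y assms(5)] by simp
qed

text \<open>\<open>cov x Y q\<close> is the covariant derivative of the field \<open>Y\<close> in direction \<open>x\<close> at \<open>q\<close>, and
  \<open>christ\<close> plays the role of the (negative) Christoffel symbols: along a curve \<open>c\<close> the covariant
  derivative of \<open>V\<close> is \<open>V' - christ c c' V\<close>.\<close>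

definition cov :: "'a \<Rightarrow> ('a \<Rightarrow> 'a) \<Rightarrow> 'a \<Rightarrow> 'a" where
  "cov x Y q = (\<Sum>a\<in>Basis. (x \<bullet> a) *\<^sub>R nabla (E a) Y q)"

definition christ :: "'a \<Rightarrow> 'a \<Rightarrow> 'a \<Rightarrow> 'a" where
  "christ q x v = proj_deriv Q q x v - (\<Sum>b\<in>Basis. (v \<bullet> b) *\<^sub>R cov x (E b) q)"

text \<open>Expanding \<open>X\<close> in the frame and using linearity over functions in the first
  argument shows that only the value \<open>X q\<close> enters. The frame is global, so the
  expansion is an identity of vector fields on all of \<open>Q\<close>.\<close>

lemma nabla_eq_cov:
  assumes "vector_field Q X" "vector_field Q Y" "q \<in> Q"
  shows "nabla X Y q = cov (X q) Y q"
proof -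
  have s: "smooth_on Q (\<lambda>p. X p \<bullet> a)" for a by (intro smooth_intros vf_smooth assms)
  have "nabla X Y q = nabla (\<lambda>p. \<Sum>a\<in>Basis. (X p \<bullet> a) *\<^sub>R E a p) Y q"
    by (rule nabla_cong) (use assms vf_sum[OF s vf_E] tangent_frame_representation[OF Q] vf_in in auto)
  also have "\<dots> = cov (X q) Y q"
    unfolding cov_def by (rule nabla_sum_left) (use s vf_E assms in auto)
  finally show ?thesis .
qed

lemma cov_in: "vector_field Q Y \<Longrightarrow> q \<in> Q \<Longrightarrow> cov x Y q \<in> tangent_space Q q"
  unfolding cov_def using vf_in[OF nabla_vf[OF vf_E]]
  by (intro subspace_sum subspace_scale subspace_T) auto

lemma linear_cov: "linear (\<lambda>x. cov x Y q)"
  unfolding cov_def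
  by (rule linearI) (simp_all add: inner_add_left scaleR_add_left sum.distrib scaleR_sum_right)

lemma linear_christ: "linear (christ q x)"
  unfolding christ_def proj_deriv_def
  by (rule linearI) (simp_all add: inner_add_left scaleR_add_left sum.distrib scaleR_sum_right algebra_simps)

lemma linear_christ_left:
  assumes "q \<in> Q" shows "linear (\<lambda>x. christ q x v)"
proof -
  have l: "linear (deriv_within Q (E b) q)" for b by (rule linear_deriv_within[OF vf_smooth[OF vf_E] assms])
  show ?thesis
    unfolding christ_def proj_deriv_def
    by (rule linearI) (simp_all add: linear_add[OF l] linear_scale[OF l] linear_add[OF linear_cov] linear_scale[OF linear_cov]
        scaleR_add_right sum.distrib scaleR_sum_right scaleR_diff_right mult.commute)
qed

text \<open>Constant coefficients in the global frame extend a single tangent vector to a vector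
  field, which is what the first argument of \<open>nabla\<close> has to be.\<close>

lemma const_field:
  assumes "q \<in> Q" "x \<in> tangent_space Q q"
  shows "vector_field Q (\<lambda>p. \<Sum>a\<in>Basis. (x \<bullet> a) *\<^sub>R E a p)" "(\<Sum>a\<in>Basis. (x \<bullet> a) *\<^sub>R E a q) = x"
  using vf_sum[of Basis "\<lambda>a p. x \<bullet> a" E] vf_E smooth_on_const tangent_frame_representation[OF Q assms] by auto

text \<open>The part of \<open>christ\<close> that comes from the moving projection is normal to the
  tangent space, so only the connection part survives.\<close>

lemma orth_proj_christ:
  assumes "q \<in> Q" "x \<in> tangent_space Q q" "v \<in> tangent_space Q q"
  shows "orth_proj (tangent_space Q q) (christ q x v) = - (\<Sum>b\<in>Basis. (v \<bullet> b) *\<^sub>R cov x (E b) q)"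
proof -
  have "(\<Sum>b\<in>Basis. (v \<bullet> b) *\<^sub>R cov x (E b) q) \<in> tangent_space Q q"
    by (intro subspace_sum subspace_scale subspace_T cov_in vf_E assms)
  then show ?thesis
    unfolding christ_def
    using linear_diff[OF linear_orth_proj[OF subspace_T[OF assms(1)]]] orth_proj_proj_deriv[OF Q assms(2,3)]
      orth_proj_self[OF subspace_T[OF assms(1)]] by simp
qed

lemma deriv_within_inner:
  assumes "smooth_on Q Y" "x \<in> tangent_space Q q"
  shows "deriv_within Q (\<lambda>p. Y p \<bullet> b) q x = deriv_within Q Y q x \<bullet> b"
proof -
  obtain \<gamma> where \<gamma>: "\<gamma> 0 = q" "(\<gamma> has_vector_derivative x) (at 0)" "\<forall>\<^sub>F s in nhds 0. \<gamma> s \<in> Q" "q \<in> Q"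
    using tangent_curve[OF assms(2)] .
  have \<gamma>0: "\<gamma> 0 \<in> Q" using \<gamma> by simp
  have "smooth_on Q (\<lambda>p. Y p \<bullet> b)" by (intro smooth_intros assms)
  from smooth_on_vector_derivative_compose[OF this \<gamma>0 \<gamma>(2,3)]
  have 1: "((\<lambda>s. Y (\<gamma> s) \<bullet> b) has_vector_derivative deriv_within Q (\<lambda>p. Y p \<bullet> b) q x) (at 0)" using \<gamma>(1) by simp
  have "((\<lambda>s. Y (\<gamma> s) \<bullet> b) has_vector_derivative deriv_within Q Y q x \<bullet> b) (at 0)"
    using bounded_linear.has_vector_derivative[OF bounded_linear_inner_left smooth_on_vector_derivative_compose[OF assms(1) \<gamma>0 \<gamma>(2,3)]] \<gamma>(1)
    by simp
  then show ?thesis using 1 vector_derivative_unique_at by blast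
qed

text \<open>With \<open>Y\<close> expanded in the frame, the product rule of the connection produces
  the tangential part of the ambient derivative of \<open>Y\<close>. Differentiating
  \<open>P Y = Y\<close> identifies the missing part as
  \<open>proj_deriv Q q x (Y q)\<close>.\<close>

lemma deriv_within_vector_field:
  assumes "vector_field Q Y" "q \<in> Q" "x \<in> tangent_space Q q"
  shows "deriv_within Q Y q x = christ q x (Y q) + cov x Y q"
proof -
  let ?X = "\<lambda>p. \<Sum>a\<in>Basis. (x \<bullet> a) *\<^sub>R E a p" and ?D = "deriv_within Q Y q x" and ?P = "orth_proj (tangent_space Q q)"
  note X = const_field[OF assms(2,3)]
  have s: "smooth_on Q (\<lambda>p. Y p \<bullet> b)" for b by (intro smooth_intros vf_smooth assms)
  have "cov x Y q = nabla ?X Y q" using nabla_eq_cov[OF X(1) assms(1,2)] X(2) by simp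
  also have "\<dots> = nabla ?X (\<lambda>p. \<Sum>b\<in>Basis. (Y p \<bullet> b) *\<^sub>R E b p) q"
    by (rule nabla_cong) (use assms X vf_sum[OF s vf_E] tangent_frame_representation[OF Q] vf_in in auto)
  also have "\<dots> = (\<Sum>b\<in>Basis. deriv_within Q (\<lambda>p. Y p \<bullet> b) q (?X q) *\<^sub>R E b q + (Y q \<bullet> b) *\<^sub>R nabla ?X (E b) q)"
    by (rule nabla_sum_right) (use s vf_E assms X in auto)
  also have "\<dots> = (\<Sum>b\<in>Basis. (?D \<bullet> b) *\<^sub>R E b q) + (\<Sum>b\<in>Basis. (Y q \<bullet> b) *\<^sub>R cov x (E b) q)"
    unfolding X(2) deriv_within_inner[OF vf_smooth[OF assms(1)] assms(3)] nabla_eq_cov[OF X(1) vf_E assms(2)]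
    by (simp add: sum.distrib)
  also have "(\<Sum>b\<in>Basis. (?D \<bullet> b) *\<^sub>R E b q) = ?D - proj_deriv Q q x (Y q)"
  proof -
    obtain \<gamma> where \<gamma>: "\<gamma> 0 = q" "(\<gamma> has_vector_derivative x) (at 0)" "\<forall>\<^sub>F s in nhds 0. \<gamma> s \<in> Q"
      using tangent_curve[OF assms(3)] by metis
    have \<gamma>0: "\<gamma> 0 \<in> Q" using \<gamma> assms(2) by simp
    have 1: "((\<lambda>s. Y (\<gamma> s)) has_vector_derivative ?D) (at 0)"
      using smooth_on_vector_derivative_compose[OF vf_smooth[OF assms(1)] \<gamma>0 \<gamma>(2,3)] \<gamma>(1) by simp
    have 2: "((\<lambda>s. orth_proj (tangent_space Q (\<gamma> s)) (Y (\<gamma> s))) has_vector_derivative proj_deriv Q q x (Y q) + ?P ?D) (at 0)"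
      using has_vector_derivative_orth_proj_curve[OF Q \<gamma>0 \<gamma>(2,3) 1] \<gamma>(1) by simp
    have "\<forall>\<^sub>F s in nhds 0. orth_proj (tangent_space Q (\<gamma> s)) (Y (\<gamma> s)) = Y (\<gamma> s)"
      using \<gamma>(3) by (rule eventually_mono) (intro orth_proj_self subspace_T vf_in assms(1))
    from has_vector_derivative_unique[OF 2 1 this] show ?thesis
      unfolding orth_proj_tangent_frame[OF Q assms(2)] by (simp add: algebra_simps)
  qed
  finally show ?thesis unfolding christ_def by simp
qed

text \<open>Any representation of \<open>V\<close> leads to the same ordinary derivative, by the
  product rule and the linearity of \<open>christ\<close>; conversely the frame coefficients
  \<open>V s \<bullet> b\<close> are a representation, differentiable because \<open>V\<close> is.
  This eliminates the existential definition from the analysis of the equations.\<close>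

lemma has_covariant_derivative_iff:
  assumes c: "\<forall>\<^sub>F s in nhds t. c s \<in> Q" and V: "\<forall>\<^sub>F s in nhds t. V s \<in> tangent_space Q (c s)"
    and x: "(c has_vector_derivative x) (at t)" "x \<in> tangent_space Q (c t)"
  shows "has_covariant_derivative Q nabla c V w t \<longleftrightarrow>
    w \<in> tangent_space Q (c t) \<and> (V has_vector_derivative (christ (c t) x (V t) + w)) (at t)"
proof
  have ct: "c t \<in> Q" using eventually_nhds_x_imp_x[OF c] .
  note S = subspace_T[OF ct]
  assume "has_covariant_derivative Q nabla c V w t"
  then obtain X m F a a' where X: "vector_field Q X" "(c has_vector_derivative X (c t)) (at t)"
    and F: "\<forall>i<(m::nat). vector_field Q (F i)" and a: "\<forall>i<m. (a i has_real_derivative a' i) (at t)"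
    and ev: "\<forall>\<^sub>F s in nhds t. V s = (\<Sum>i<m. a i s *\<^sub>R F i (c s))"
    and w: "w = (\<Sum>i<m. a' i *\<^sub>R F i (c t) + a i t *\<^sub>R nabla X (F i) (c t))"
    unfolding has_covariant_derivative_def by blast
  have Xx: "X (c t) = x" using X(2) x(1) vector_derivative_unique_at by blast
  have wi: "w = (\<Sum>i<m. a' i *\<^sub>R F i (c t) + a i t *\<^sub>R cov x (F i) (c t))"
    unfolding w using nabla_eq_cov[OF X(1) _ ct] F by (simp add: Xx)
  have "w \<in> tangent_space Q (c t)"
    unfolding wi using F ct by (intro subspace_sum subspace_add subspace_scale S cov_in vf_in) auto
  moreover have "(V has_vector_derivative (christ (c t) x (V t) + w)) (at t)"
  proof -
    have "((\<lambda>s. \<Sum>i<m. a i s *\<^sub>R F i (c s)) has_vector_derivative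
        (\<Sum>i<m. a i t *\<^sub>R deriv_within Q (F i) (c t) x + a' i *\<^sub>R F i (c t))) (at t)"
    proof (intro has_vector_derivative_sum)
      fix i assume "i \<in> {..<m}"
      then have i: "vector_field Q (F i)" "(a i has_vector_derivative a' i) (at t)"
        using F a by (auto simp: has_real_derivative_iff_has_vector_derivative)
      show "((\<lambda>s. a i s *\<^sub>R F i (c s)) has_vector_derivative
        a i t *\<^sub>R deriv_within Q (F i) (c t) x + a' i *\<^sub>R F i (c t)) (at t)"
        by (rule bounded_bilinear.has_vector_derivative[OF bounded_bilinear_scaleR i(2)
            smooth_on_vector_derivative_compose[OF vf_smooth[OF i(1)] ct x(1) c]])
    qed
    also have "(\<Sum>i<m. a i t *\<^sub>R deriv_within Q (F i) (c t) x + a' i *\<^sub>R F i (c t)) = (\<Sum>i<m. a i t *\<^sub>R christ (c t) x (F i (c t))) + w"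
      unfolding wi sum.distrib[symmetric]
      using F by (intro sum.cong refl) (simp add: deriv_within_vector_field[OF _ ct x(2)] scaleR_add_right)
    also have "(\<Sum>i<m. a i t *\<^sub>R christ (c t) x (F i (c t))) = christ (c t) x (V t)"
      unfolding eventually_nhds_x_imp_x[OF ev] by (simp add: linear_sum[OF linear_christ] linear_scale[OF linear_christ])
    finally show ?thesis
      by (rule has_vector_derivative_cong_nhds) (use ev in \<open>auto elim!: eventually_mono\<close>)
  qed
  ultimately show "w \<in> tangent_space Q (c t) \<and> (V has_vector_derivative (christ (c t) x (V t) + w)) (at t)" ..
next
  have ct: "c t \<in> Q" using eventually_nhds_x_imp_x[OF c] .
  have Vt: "V t \<in> tangent_space Q (c t)" using eventually_nhds_x_imp_x[OF V] .
  note S = subspace_T[OF ct]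
  define V' where "V' = christ (c t) x (V t) + w"
  assume "w \<in> tangent_space Q (c t) \<and> (V has_vector_derivative (christ (c t) x (V t) + w)) (at t)"
  then have w: "w \<in> tangent_space Q (c t)" "(V has_vector_derivative V') (at t)" unfolding V'_def by auto
  let ?X = "\<lambda>p. \<Sum>a\<in>Basis. (x \<bullet> a) *\<^sub>R E a p"
  note X = const_field[OF ct x(2)]
  \<comment> \<open>The definition indexes representations by natural numbers, so the basis is
    enumerated.\<close>
  obtain e where e: "bij_betw e {..<card (Basis :: 'a set)} (Basis :: 'a set)"
    using ex_bij_betw_nat_finite[of "Basis :: 'a set"] by (auto simp: atLeast0LessThan)
  have eB: "(\<Sum>i<card (Basis :: 'a set). f (e i)) = (\<Sum>b\<in>Basis. f b)" for f :: "'a \<Rightarrow> 'a"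
    using sum.reindex_bij_betw[OF e] .
  show "has_covariant_derivative Q nabla c V w t"
    unfolding has_covariant_derivative_def
  proof (intro exI conjI)
    show "vector_field Q ?X" by (rule X(1))
    show "(c has_vector_derivative ?X (c t)) (at t)" using x(1) X(2) by simp
    show "\<forall>i<card (Basis :: 'a set). vector_field Q ((\<lambda>i. E (e i)) i)" using vf_E by simp
    show "\<forall>i<card (Basis :: 'a set). ((\<lambda>i s. V s \<bullet> e i) i has_real_derivative (\<lambda>i. V' \<bullet> e i) i) (at t)"
      using bounded_linear.has_vector_derivative[OF bounded_linear_inner_left w(2)]
      by (simp add: has_real_derivative_iff_has_vector_derivative)
    show "\<forall>\<^sub>F s in nhds t. V s = (\<Sum>i<card (Basis :: 'a set). (\<lambda>i s. V s \<bullet> e i) i s *\<^sub>R (\<lambda>i. E (e i)) i (c s))"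
      using eventually_conj[OF c V]
      by (rule eventually_mono) (simp add: eB[of "\<lambda>b. (V _ \<bullet> b) *\<^sub>R E b (c _)"] tangent_frame_representation[OF Q])
    have "(\<Sum>i<card (Basis :: 'a set). (V' \<bullet> e i) *\<^sub>R E (e i) (c t) + (V t \<bullet> e i) *\<^sub>R nabla ?X (E (e i)) (c t))
        = (\<Sum>b\<in>Basis. (V' \<bullet> b) *\<^sub>R E b (c t)) + (\<Sum>b\<in>Basis. (V t \<bullet> b) *\<^sub>R cov x (E b) (c t))"
      using eB[of "\<lambda>b. (V' \<bullet> b) *\<^sub>R E b (c t) + (V t \<bullet> b) *\<^sub>R nabla ?X (E b) (c t)"]
      by (simp add: sum.distrib nabla_eq_cov[OF X(1) vf_E ct] X(2))
    also have "(\<Sum>b\<in>Basis. (V' \<bullet> b) *\<^sub>R E b (c t)) = orth_proj (tangent_space Q (c t)) V'"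
      using orth_proj_tangent_frame[OF Q ct] by simp
    \<comment> \<open>Projecting \<open>V'\<close> discards the normal part of
      \<open>christ\<close>; what remains of it cancels the connection terms of the frame.\<close>
    also have "\<dots> = - (\<Sum>b\<in>Basis. (V t \<bullet> b) *\<^sub>R cov x (E b) (c t)) + w"
      unfolding V'_def linear_add[OF linear_orth_proj[OF S]] orth_proj_christ[OF ct x(2) Vt] orth_proj_self[OF S w(1)] ..
    finally show "w = (\<Sum>i<card (Basis :: 'a set). (\<lambda>i. V' \<bullet> e i) i *\<^sub>R (\<lambda>i. E (e i)) i (c t) + (\<lambda>i s. V s \<bullet> e i) i t *\<^sub>R nabla ?X ((\<lambda>i. E (e i)) i) (c t))"
      by simp
  qed
qed

lemma smooth_on_deriv_within_compose:
  assumes "smooth_on Q f" "smooth_on A c" "smooth_on A x"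
    and cx: "\<And>z. z \<in> A \<Longrightarrow> c z \<in> Q \<and> x z \<in> tangent_space Q (c z)"
  shows "smooth_on A (\<lambda>z. deriv_within Q f (c z) (x z))"
proof -
  have "smooth_on A (\<lambda>z. deriv_within Q f (c z) (E a (c z)))" for a
    by (rule smooth_on_compose[OF smooth_on_deriv_within[OF assms(1) vf_E] assms(2)]) (use cx in auto)
  then have "smooth_on A (\<lambda>z. \<Sum>a\<in>Basis. (x z \<bullet> a) *\<^sub>R deriv_within Q f (c z) (E a (c z)))"
    by (intro smooth_intros assms)
  moreover have "(\<Sum>a\<in>Basis. (x z \<bullet> a) *\<^sub>R deriv_within Q f (c z) (E a (c z))) = deriv_within Q f (c z) (x z)" if "z \<in> A" for z
  proof -
    have l: "linear (deriv_within Q f (c z))" using linear_deriv_within[OF assms(1)] cx[OF that] by blast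
    have "(\<Sum>a\<in>Basis. (x z \<bullet> a) *\<^sub>R deriv_within Q f (c z) (E a (c z))) = deriv_within Q f (c z) (\<Sum>a\<in>Basis. (x z \<bullet> a) *\<^sub>R E a (c z))"
      unfolding linear_sum[OF l] linear_scale[OF l] ..
    then show ?thesis using tangent_frame_representation[OF Q, of "c z" "x z"] cx[OF that] by simp
  qed
  ultimately show ?thesis by (rule smooth_on_cong)
qed

lemma smooth_on_cov_compose:
  assumes "vector_field Q Y" "smooth_on A c" "smooth_on A x" "\<And>z. z \<in> A \<Longrightarrow> c z \<in> Q"
  shows "smooth_on A (\<lambda>z. cov (x z) Y (c z))"
proof -
  have "smooth_on A (\<lambda>z. nabla (E a) Y (c z))" for a
    by (rule smooth_on_compose[OF vf_smooth[OF nabla_vf[OF vf_E assms(1)]] assms(2)]) (use assms(4) in auto)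
  then show ?thesis unfolding cov_def by (intro smooth_intros assms)
qed

lemma smooth_on_christ_compose:
  assumes "smooth_on A c" "smooth_on A x" "smooth_on A v"
    and cx: "\<And>z. z \<in> A \<Longrightarrow> c z \<in> Q \<and> x z \<in> tangent_space Q (c z)"
  shows "smooth_on A (\<lambda>z. christ (c z) (x z) (v z))"
proof -
  have 1: "smooth_on A (\<lambda>z. deriv_within Q (E b) (c z) (x z))" for b
    by (rule smooth_on_deriv_within_compose[OF vf_smooth[OF vf_E] assms(1,2) cx])
  have 2: "smooth_on A (\<lambda>z. cov (x z) (E b) (c z))" for b
    by (rule smooth_on_cov_compose[OF vf_E assms(1,2)]) (use cx in blast)
  show ?thesis
    unfolding christ_def proj_deriv_def by (intro smooth_intros assms 1 2)
qed

end

section \<open>The closed-loop system in the new variables\<close>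

locale oscillatory_control = submanifold_connection Q nabla
  for Q :: "'a::euclidean_space set" and nabla :: "('a \<Rightarrow> 'a) \<Rightarrow> ('a \<Rightarrow> 'a) \<Rightarrow> 'a \<Rightarrow> 'a" +
  fixes n :: nat and Y :: "nat \<Rightarrow> 'a \<Rightarrow> 'a" and R :: "'a \<Rightarrow> 'a \<Rightarrow> 'a" and \<psi> :: "'a \<Rightarrow> real" and \<alpha> :: "real \<Rightarrow> real"
    and u U :: "nat \<Rightarrow> real \<Rightarrow> real" and lam mu :: "nat \<Rightarrow> real" and T h :: real
  assumes Y: "i \<le> n \<Longrightarrow> vector_field Q (Y i)" and R: "smooth_bundle_map Q R"
    and \<psi>: "smooth_on Q \<psi>" and \<alpha>: "smooth_on UNIV \<alpha>" and T: "T > 0"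
    and u_bounded: "i \<in> {1..n} \<Longrightarrow> bounded (range (u i))"
    and u_periodic: "i \<in> {1..n} \<Longrightarrow> u i (t + T) = u i t"
    and u_mean: "i \<in> {1..n} \<Longrightarrow> integral {0..T} (u i) = 0"
    and U: "i \<in> {1..n} \<Longrightarrow> zero_mean_antiderivative T (u i) (U i)"
    and U_orthonormal: "i \<in> {1..n} \<Longrightarrow> j \<in> {1..n} \<Longrightarrow> 1 / T * integral {0..T} (\<lambda>\<tau>. U i \<tau> * U j \<tau>) = (if i = j then 1 else 0)"
begin

abbreviation M :: "(('a \<times> 'a) \<times> real) set" where "M \<equiv> state_space Q"
abbreviation pos :: "('a \<times> 'a) \<times> real \<Rightarrow> 'a" where "pos z \<equiv> fst (fst z)"
abbreviation vel :: "('a \<times> 'a) \<times> real \<Rightarrow> 'a" where "vel z \<equiv> snd (fst z)"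

lemma M_iff: "z \<in> M \<longleftrightarrow> pos z \<in> Q \<and> vel z \<in> tangent_space Q (pos z)"
  unfolding state_space_def tangent_bundle_def by (cases z) auto

definition gain :: "('a \<times> 'a) \<times> real \<Rightarrow> real" where "gain z = \<alpha> (\<psi> (pos z) - snd z)"
definition dgain :: "('a \<times> 'a) \<times> real \<Rightarrow> real" where "dgain z = deriv \<alpha> (\<psi> (pos z) - snd z)"
definition filt :: "('a \<times> 'a) \<times> real \<Rightarrow> real" where "filt z = - h * snd z + h * \<psi> (pos z)"

text \<open>With the additional signal \<open>U 0 = 1\<close> the vanishing of the means of \<open>U 1, \<dots>, U n\<close> and
  their orthonormality say that \<open>U 0, \<dots>, U n\<close> are orthonormal, and the velocity in the original
  variables is \<open>v = (\<Sum>i\<le>n. sig i (\<omega> * t) *\<^sub>R W i z)\<close>.\<close>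

definition sig :: "nat \<Rightarrow> real \<Rightarrow> real" where "sig i \<tau> = (if i = 0 then 1 else U i \<tau>)"

definition W :: "nat \<Rightarrow> ('a \<times> 'a) \<times> real \<Rightarrow> 'a" where
  "W i z = (if i = 0 then vel z else (lam i * gain z) *\<^sub>R Y i (pos z))"

definition drift :: "('a \<times> 'a) \<times> real \<Rightarrow> 'a" where
  "drift z = Y 0 (pos z) + (gain z)\<^sup>2 *\<^sub>R (\<Sum>i=1..n. mu i *\<^sub>R Y i (pos z))"

text \<open>\<open>kp i j\<close> is the coefficient of \<open>sig i * sig j\<close> in the derivative of the new velocity
  \<open>v - (\<Sum>i=1..n. sig i (\<omega> * t) *\<^sub>R W i z)\<close>.\<close>

definition kp :: "nat \<Rightarrow> nat \<Rightarrow> ('a \<times> 'a) \<times> real \<Rightarrow> 'a" where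
  "kp i j z = (if i = 0
     then christ (pos z) (W j z) (vel z) - R (pos z) (W j z) + (if j = 0 then drift z else 0)
     else (if j = 0 then (lam i * dgain z * filt z) *\<^sub>R Y i (pos z) else 0)
       - lam i *\<^sub>R ((dgain z * deriv_within Q \<psi> (pos z) (W j z)) *\<^sub>R Y i (pos z) + gain z *\<^sub>R cov (W j z) (Y i) (pos z)))"

text \<open>Since \<open>sig 0\<close> is 1, terms of lower degree in the signals are placed in row
  or column 0: the velocity of the base point in row 0, the drift and the filter at
  \<open>(0, 0)\<close>. The transformed system is then a single quadratic expression in the
  signals.\<close>

definition k :: "nat \<times> nat \<Rightarrow> ('a \<times> 'a) \<times> real \<Rightarrow> ('a \<times> 'a) \<times> real" where
  "k l z = ((if fst l = 0 then W (snd l) z else 0, kp (fst l) (snd l) z), if l = (0, 0) then filt z else 0)"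

abbreviation I :: "(nat \<times> nat) set" where "I \<equiv> {0..n} \<times> {0..n}"

definition c :: "nat \<times> nat \<Rightarrow> real \<Rightarrow> real" where "c l \<tau> = sig (fst l) \<tau> * sig (snd l) \<tau>"

definition m :: "nat \<times> nat \<Rightarrow> real" where "m l = (if fst l = snd l then 1 else 0)"

section \<open>Smoothness and tangency of the coefficient fields\<close>

lemma W_in: "z \<in> M \<Longrightarrow> i \<le> n \<Longrightarrow> W i z \<in> tangent_space Q (pos z)"
  unfolding W_def M_iff using vf_in[OF Y] by (auto intro: subspace_scale[OF subspace_T])

lemma R_props:
  assumes "q \<in> Q" "v \<in> tangent_space Q q"
  shows R_in: "R q v \<in> tangent_space Q q"
    and R_add: "w \<in> tangent_space Q q \<Longrightarrow> R q (v + w) = R q v + R q w"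
    and R_scale: "R q (a *\<^sub>R v) = a *\<^sub>R R q v"
proof -
  note * = R[unfolded smooth_bundle_map_def, THEN conjunct2, THEN bspec, OF assms(1), THEN bspec, OF assms(2)]
  show "R q v \<in> tangent_space Q q" by (rule *[THEN conjunct1])
  show "w \<in> tangent_space Q q \<Longrightarrow> R q (v + w) = R q v + R q w" by (rule *[THEN conjunct2, THEN conjunct1, THEN bspec])
  show "R q (a *\<^sub>R v) = a *\<^sub>R R q v" by (rule *[THEN conjunct2, THEN conjunct2, THEN spec])
qed

lemma R_sum:
  assumes "q \<in> Q" "finite J" "\<And>j. j \<in> J \<Longrightarrow> v j \<in> tangent_space Q q"
  shows "R q (\<Sum>j\<in>J. a j *\<^sub>R v j) = (\<Sum>j\<in>J. a j *\<^sub>R R q (v j))"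
  using assms(2,3)
proof (induction J rule: finite_induct)
  case empty
  show ?case using R_scale[OF assms(1) subspace_0[OF subspace_T[OF assms(1)]], of 0] by simp
next
  case (insert j J)
  have 1: "a j *\<^sub>R v j \<in> tangent_space Q q" using insert.prems assms(1) by (intro subspace_scale subspace_T) auto
  have 2: "(\<Sum>j\<in>J. a j *\<^sub>R v j) \<in> tangent_space Q q"
    using insert.prems assms(1) by (intro subspace_sum subspace_scale subspace_T) auto
  show ?case using insert R_add[OF assms(1) 1 2] R_scale[OF assms(1)] by simp
qed

lemma smooth_pos: "smooth_on M (\<lambda>z. pos z)" and smooth_vel: "smooth_on M (\<lambda>z. vel z)"
  by (intro smooth_intros)+

lemma smooth_Q_pos: "smooth_on Q f \<Longrightarrow> smooth_on M (\<lambda>z. f (pos z))"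
  by (rule smooth_on_compose[OF _ smooth_pos]) (auto simp: M_iff)

lemma \<alpha>_deriv: "(\<alpha> has_real_derivative deriv \<alpha> y) (at y)" and smooth_deriv_\<alpha>: "smooth_on UNIV (deriv \<alpha>)"
proof -
  have C: "C_inf_on UNIV \<alpha>" using \<alpha> smooth_on_open_iff[OF open_UNIV] by blast
  have D: "(\<alpha> has_real_derivative frechet_derivative \<alpha> (at y) 1) (at y)" for y
  proof (rule has_derivative_imp_has_field_derivative[OF C_inf_on_derivative[OF C UNIV_I, of y]])
    fix x
    have "frechet_derivative \<alpha> (at y) (x *\<^sub>R 1) = x *\<^sub>R frechet_derivative \<alpha> (at y) 1"
      by (rule linear_scale[OF has_derivative_linear[OF C_inf_on_derivative[OF C UNIV_I]]])
    then show "x * frechet_derivative \<alpha> (at y) 1 = frechet_derivative \<alpha> (at y) x"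
      unfolding real_scaleR_def mult_1_right by (rule sym)
  qed
  then have e: "deriv \<alpha> y = frechet_derivative \<alpha> (at y) 1" for y using DERIV_imp_deriv by blast
  show "(\<alpha> has_real_derivative deriv \<alpha> y) (at y)" using D e by simp
  show "smooth_on UNIV (deriv \<alpha>)"
    by (rule smooth_on_cong[OF C_inf_on_imp_smooth_on[OF open_UNIV C_inf_on_directional[OF C, of 1]]]) (simp add: e)
qed

lemma smooth_gain: "smooth_on M gain" and smooth_dgain: "smooth_on M dgain" and smooth_filt: "smooth_on M filt"
proof -
  have s: "smooth_on M (\<lambda>z. \<psi> (pos z) - snd z)" by (intro smooth_intros smooth_Q_pos \<psi>)
  show "smooth_on M gain" unfolding gain_def by (rule smooth_on_compose[OF \<alpha> s]) simp
  show "smooth_on M dgain" unfolding dgain_def by (rule smooth_on_compose[OF smooth_deriv_\<alpha> s]) simp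
  show "smooth_on M filt" unfolding filt_def by (intro smooth_intros smooth_Q_pos \<psi>)
qed

lemma smooth_Y: "i \<le> n \<Longrightarrow> smooth_on M (\<lambda>z. Y i (pos z))" by (rule smooth_Q_pos[OF vf_smooth[OF Y]])

lemma smooth_W: "i \<le> n \<Longrightarrow> smooth_on M (W i)"
  unfolding W_def by (cases "i = 0") (auto intro!: smooth_intros smooth_gain smooth_Y)

lemma smooth_drift: "smooth_on M drift"
  unfolding drift_def power2_eq_square by (intro smooth_intros smooth_gain smooth_Y) auto

lemma smooth_kp:
  assumes "i \<le> n" "j \<le> n"
  shows "smooth_on M (kp i j)"
proof -
  have W: "smooth_on M (W j)" by (rule smooth_W[OF assms(2)])
  have pW: "z \<in> M \<Longrightarrow> pos z \<in> Q \<and> W j z \<in> tangent_space Q (pos z)" for z using W_in[OF _ assms(2)] M_iff by blast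
  have 1: "smooth_on M (\<lambda>z. christ (pos z) (W j z) (vel z))"
    by (rule smooth_on_christ_compose[OF smooth_pos W smooth_vel pW])
  have 2: "smooth_on M (\<lambda>z. R (pos z) (W j z))"
  proof -
    have "smooth_on (tangent_bundle Q) (\<lambda>(q, v). R q v)" using R unfolding smooth_bundle_map_def by blast
    from smooth_on_compose[OF this smooth_on_Pair[OF smooth_pos W]]
    show ?thesis using pW by (simp add: tangent_bundle_def image_subset_iff)
  qed
  have 3: "smooth_on M (\<lambda>z. deriv_within Q \<psi> (pos z) (W j z))"
    by (rule smooth_on_deriv_within_compose[OF \<psi> smooth_pos W pW])
  have 4: "smooth_on M (\<lambda>z. cov (W j z) (Y i) (pos z))"
    by (rule smooth_on_cov_compose[OF Y[OF assms(1)] smooth_pos W]) (use pW in blast)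
  show ?thesis
    unfolding kp_def
    by (intro smooth_intros 1 2 3 4 smooth_drift smooth_gain smooth_dgain smooth_filt smooth_Y assms)
qed

lemma smooth_k: "l \<in> I \<Longrightarrow> smooth_on M (k l)"
  unfolding k_def by (intro smooth_intros smooth_W smooth_kp smooth_filt) auto

lemma drift_in: "z \<in> M \<Longrightarrow> drift z \<in> tangent_space Q (pos z)"
  unfolding drift_def using vf_in[OF Y]
  by (intro subspace_add subspace_scale subspace_sum subspace_T) (auto simp: M_iff)

text \<open>In row 0 the base point moves with velocity \<open>W j z\<close>, and the
  \<open>proj_deriv\<close> contained in \<open>christ\<close> is exactly the required correction;
  the other rows leave the base point fixed and only need to be tangent. This checks the tangency
  condition of \<open>state_space_retraction\<close> for every coefficient field separately.\<close>

lemma kp_tangent: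
  assumes z: "z \<in> M" and "i \<le> n" "j \<le> n"
  shows "kp i j z - proj_deriv Q (pos z) (if i = 0 then W j z else 0) (vel z) \<in> tangent_space Q (pos z)"
proof -
  have q: "pos z \<in> Q" using z M_iff by blast
  note S = subspace_T[OF q]
  have Wj: "W j z \<in> tangent_space Q (pos z)" by (rule W_in[OF z assms(3)])
  have Yi: "Y i (pos z) \<in> tangent_space Q (pos z)" by (rule vf_in[OF Y[OF assms(2)] q])
  show ?thesis
  proof (cases "i = 0")
    case True
    have "kp i j z - proj_deriv Q (pos z) (W j z) (vel z)
      = - (\<Sum>b\<in>Basis. (vel z \<bullet> b) *\<^sub>R cov (W j z) (E b) (pos z)) - R (pos z) (W j z) + (if j = 0 then drift z else 0)"
      unfolding kp_def christ_def using True by simp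
    also have "\<dots> \<in> tangent_space Q (pos z)"
      using drift_in[OF z] R_in[OF q Wj] subspace_0[OF S] cov_in[OF vf_E q]
      by (intro subspace_add[OF S] subspace_diff[OF S] subspace_neg[OF S] subspace_sum[OF S] subspace_scale[OF S]) auto
    finally show ?thesis using True by simp
  next
    case False
    have "proj_deriv Q (pos z) 0 (vel z) = 0"
      unfolding proj_deriv_def using linear_0[OF linear_deriv_within[OF vf_smooth[OF vf_E] q]] by simp
    moreover have "kp i j z \<in> tangent_space Q (pos z)"
      unfolding kp_def using False subspace_0[OF S] Yi cov_in[OF Y[OF assms(2)] q]
      by (auto intro!: subspace_add[OF S] subspace_diff[OF S] subspace_neg[OF S] subspace_scale[OF S])
    ultimately show ?thesis using False by simp
  qed
qed

lemma retraction:
  assumes "p \<in> M"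
  shows "\<exists>W \<rho>. open W \<and> p \<in> W \<and> C_inf_on W \<rho> \<and> \<rho> ` W \<subseteq> M \<and> (\<forall>x\<in>M \<inter> W. \<rho> x = x) \<and>
    (\<forall>l\<in>I. \<forall>x\<in>M \<inter> W. frechet_derivative \<rho> (at x) (k l x) = k l x)"
proof -
  obtain V \<rho> where V: "open V" "p \<in> V" "C_inf_on V \<rho>" "\<rho> ` V \<subseteq> M" "\<forall>x\<in>M \<inter> V. \<rho> x = x"
    and D: "\<forall>q p \<eta> v w e. ((q, p), \<eta>) \<in> M \<inter> V \<longrightarrow> v \<in> tangent_space Q q \<longrightarrow> w - proj_deriv Q q v p \<in> tangent_space Q q \<longrightarrow>
       frechet_derivative \<rho> (at ((q, p), \<eta>)) ((v, w), e :: real) = ((v, w), e)"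
    using state_space_retraction[OF Q assms] by (elim exE conjE)
  have "frechet_derivative \<rho> (at x) (k l x) = k l x" if lI: "l \<in> I" and xV: "x \<in> M \<inter> V" for l x
  proof -
    obtain q p \<eta> where x: "x = ((q, p), \<eta>)" by (metis prod.collapse)
    obtain i j where l: "l = (i, j)" "i \<le> n" "j \<le> n" using lI by auto
    have xM: "x \<in> M" using xV by auto
    have W: "(if i = 0 then W j x else 0) \<in> tangent_space Q q"
      using W_in[OF xM l(3)] subspace_0[OF subspace_T, of q] xM by (auto simp: x M_iff)
    have kp: "kp i j x - proj_deriv Q q (if i = 0 then W j x else 0) p \<in> tangent_space Q q"
      using kp_tangent[OF xM l(2,3)] by (simp add: x)
    have qV: "((q, p), \<eta>) \<in> M \<inter> V" using xV by (simp add: x)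
    note D[rule_format, OF qV W kp, of "if l = (0, 0) then filt x else 0", folded x]
    then show ?thesis unfolding k_def l fst_conv snd_conv .
  qed
  then show ?thesis using V by (intro exI[of _ V] exI[of _ \<rho>]) auto
qed

section \<open>The signals: regularity, periodicity and means\<close>

lemma U_integral: "i \<in> {1..n} \<Longrightarrow> s \<le> t \<Longrightarrow> (u i has_integral (U i t - U i s)) {s..t}"
  using U unfolding zero_mean_antiderivative_def by blast

lemma U_mean: "i \<in> {1..n} \<Longrightarrow> (U i has_integral 0) {0..T}"
  using U unfolding zero_mean_antiderivative_def by blast

lemma U_lipschitz:
  assumes "i \<in> {1..n}"
  shows "\<exists>B\<ge>0. \<forall>s t. \<bar>U i t - U i s\<bar> \<le> B * \<bar>t - s\<bar>"
proof -
  obtain B where B: "B > 0" "\<And>y. y \<in> range (u i) \<Longrightarrow> norm y \<le> B"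
    using u_bounded[OF assms] unfolding bounded_pos by metis
  have le: "\<bar>U i t - U i s\<bar> \<le> B * \<bar>t - s\<bar>" if "s \<le> t" for s t
  proof -
    have "norm (U i t - U i s) \<le> B * measure lborel {s..t}"
      by (rule has_integral_bound_real[of B "{}"]) (use B U_integral[OF assms that] in auto)
    then show ?thesis using that by simp
  qed
  have "\<bar>U i t - U i s\<bar> \<le> B * \<bar>t - s\<bar>" for s t
    using le[of s t] le[of t s] by (cases "s \<le> t") (auto simp: abs_minus_commute)
  then show ?thesis using B(1) by (intro exI[of _ B]) auto
qed

lemma U_continuous: "i \<in> {1..n} \<Longrightarrow> continuous_on S (U i)"
proof -
  assume "i \<in> {1..n}"
  then obtain B where B: "B \<ge> 0" "\<forall>s t. \<bar>U i t - U i s\<bar> \<le> B * \<bar>t - s\<bar>" using U_lipschitz by blast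
  then have "B-lipschitz_on S (U i)" by (intro lipschitz_onI) (auto simp: dist_real_def)
  then show ?thesis by (rule lipschitz_on_continuous_on)
qed

text \<open>Periodicity of \<open>u i\<close> makes \<open>U i (t + T) - U i t\<close> independent
  of \<open>t\<close>, and at \<open>t = 0\<close> it is the vanishing integral of
  \<open>u i\<close> over a period.\<close>

lemma U_periodic:
  assumes i: "i \<in> {1..n}"
  shows "U i (t + T) = U i t"
proof -
  have *: "U i (t + T) - U i t = U i (s + T) - U i s" if "s \<le> t" for s t
  proof -
    have "(u i \<circ> (+) T) = u i" using u_periodic[OF i] by (auto simp: add.commute)
    moreover have "(u i has_integral (U i (t + T) - U i (s + T))) {s + T..t + T}" using U_integral[OF i] that by simp
    ultimately have "(u i has_integral (U i (t + T) - U i (s + T))) {s..t}"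
      using has_integral_shift_Icc_real[of "u i" T _ s t] by simp
    from has_integral_unique[OF this U_integral[OF i that]] show ?thesis by linarith
  qed
  have "U i (0 + T) - U i 0 = 0"
    using integral_unique[OF U_integral[OF i, of 0 T]] u_mean[OF i] T by simp
  then show ?thesis using *[of 0 t] *[of t 0] by (cases "0 \<le> t") auto
qed

lemma sig_continuous: "i \<le> n \<Longrightarrow> continuous_on S (sig i)"
  unfolding sig_def using U_continuous[of i] by (cases "i = 0") auto

lemma sig_periodic: "i \<le> n \<Longrightarrow> sig i (t + T) = sig i t"
  unfolding sig_def using U_periodic[of i] by (cases "i = 0") auto

lemma c_continuous: "l \<in> I \<Longrightarrow> continuous_on S (c l)"
  unfolding c_def by (intro continuous_intros sig_continuous) auto

lemma c_periodic: "l \<in> I \<Longrightarrow> c l (t + T) = c l t"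
  unfolding c_def using sig_periodic by auto

lemma c_mean: "l \<in> I \<Longrightarrow> integral {0..T} (c l) = m l * T"
proof -
  assume "l \<in> I"
  then obtain i j where l: "l = (i, j)" "i \<le> n" "j \<le> n" by auto
  have U0: "integral {0..T} (U i) = 0" if "i \<noteq> 0" "i \<le> n" for i
    using U_mean[of i] that by (simp add: integral_unique)
  have cl: "c l = (\<lambda>\<tau>. sig i \<tau> * sig j \<tau>)" unfolding c_def l by auto
  consider "i = 0" "j = 0" | "i = 0" "j \<noteq> 0" | "i \<noteq> 0" "j = 0" | "i \<noteq> 0" "j \<noteq> 0" by blast
  then show ?thesis
  proof cases
    case 4
    then have "1 / T * integral {0..T} (\<lambda>\<tau>. U i \<tau> * U j \<tau>) = (if i = j then 1 else 0)"
      using U_orthonormal[of i j] l by auto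
    then have "integral {0..T} (\<lambda>\<tau>. U i \<tau> * U j \<tau>) = (if i = j then 1 else 0) * T"
      using T by (auto simp: field_simps split: if_splits)
    then show ?thesis using 4 unfolding cl unfolding m_def sig_def l by simp
  qed (unfold cl, use U0 l T in \<open>auto simp: m_def sig_def\<close>)
qed

section \<open>Averaging and summing the coefficient fields\<close>

lemma sum_k:
  "(\<Sum>l\<in>I. a l *\<^sub>R k l z) = (\<Sum>i\<in>{0..n}. \<Sum>j\<in>{0..n}. a (i, j) *\<^sub>R k (i, j) z)"
  by (subst sum.cartesian_product) simp

text \<open>Only the diagonal survives. The entry \<open>(0, 0)\<close> is the motion with damping
  and drift. In the entry \<open>(i, i)\<close> with positive \<open>i\<close>, the covariant
  derivative of \<open>Y i\<close> along itself is half of the symmetric product, and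
  differentiating the gain along \<open>Y i\<close> gives the Lie derivative term.\<close>

lemma average_field:
  assumes z: "z \<in> M"
  shows "(\<Sum>l\<in>I. m l *\<^sub>R k l z) =
    ((vel z, christ (pos z) (vel z) (vel z) + averaged_rhs Q nabla n Y R \<psi> \<alpha> lam mu z), filt z)"
proof -
  have q: "pos z \<in> Q" using z M_iff by blast
  have "(\<Sum>l\<in>I. m l *\<^sub>R k l z) = (\<Sum>i\<in>{0..n}. k (i, i) z)"
  proof -
    have "(\<Sum>j\<in>{0..n}. m (i, j) *\<^sub>R k (i, j) z) = k (i, i) z" if "i \<in> {0..n}" for i
    proof -
      have "(\<Sum>j\<in>{0..n}. m (i, j) *\<^sub>R k (i, j) z) = (\<Sum>j\<in>{0..n}. if j = i then k (i, j) z else 0)"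
        unfolding m_def by (intro sum.cong) auto
      then show ?thesis using that by simp
    qed
    then show ?thesis unfolding sum_k by (intro sum.cong) auto
  qed
  also have "\<dots> = k (0, 0) z + (\<Sum>i=1..n. k (i, i) z)"
    by (simp add: sum.atLeast_Suc_atMost)
  also have "(\<Sum>i=1..n. k (i, i) z) = ((0, \<Sum>i=1..n. kp i i z), 0)"
    by (intro prod_eqI) (simp_all add: fst_sum snd_sum k_def)
  also have "(\<Sum>i=1..n. kp i i z) = - ((1/2 * (gain z)\<^sup>2) *\<^sub>R (\<Sum>i=1..n. (lam i)\<^sup>2 *\<^sub>R symmetric_product nabla (Y i) (Y i) (pos z))
     + (gain z * dgain z) *\<^sub>R (\<Sum>i=1..n. ((lam i)\<^sup>2 * lie_derivative Q (Y i) \<psi> (pos z)) *\<^sub>R Y i (pos z)))"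
    unfolding scaleR_sum_right sum.distrib[symmetric] sum_negf[symmetric]
  proof (rule sum.cong[OF refl])
    fix i assume "i \<in> {1..n}"
    then have i: "i \<noteq> 0" "vector_field Q (Y i)" using Y by auto
    have l: "deriv_within Q \<psi> (pos z) (W i z) = (lam i * gain z) * lie_derivative Q (Y i) \<psi> (pos z)"
      unfolding W_def lie_derivative_def using i(1) linear_scale[OF linear_deriv_within[OF \<psi> q]] by simp
    have cv: "cov (W i z) (Y i) (pos z) = (lam i * gain z) *\<^sub>R cov (Y i (pos z)) (Y i) (pos z)"
      unfolding W_def using i(1) linear_scale[OF linear_cov] by simp
    have sp: "symmetric_product nabla (Y i) (Y i) (pos z) = 2 *\<^sub>R cov (Y i (pos z)) (Y i) (pos z)"
      unfolding symmetric_product_def nabla_eq_cov[OF i(2,2) q] by (simp add: scaleR_2)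
    show "kp i i z = - ((1/2 * (gain z)\<^sup>2) *\<^sub>R (lam i)\<^sup>2 *\<^sub>R symmetric_product nabla (Y i) (Y i) (pos z)
     + (gain z * dgain z) *\<^sub>R ((lam i)\<^sup>2 * lie_derivative Q (Y i) \<psi> (pos z)) *\<^sub>R Y i (pos z))"
      unfolding kp_def l cv sp using i(1) by (simp add: power2_eq_square algebra_simps)
  qed
  finally show ?thesis
    unfolding averaged_rhs_def case_prod_beta gain_def[symmetric] dgain_def[symmetric]
    by (simp add: k_def kp_def W_def drift_def algebra_simps)
qed

definition velo :: "real \<Rightarrow> ('a \<times> 'a) \<times> real \<Rightarrow> 'a" where
  "velo \<tau> z = (\<Sum>i\<in>{0..n}. sig i \<tau> *\<^sub>R W i z)"

lemma velo_eq: "velo \<tau> z = vel z + (\<Sum>i=1..n. (U i \<tau> * lam i * gain z) *\<^sub>R Y i (pos z))"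
proof -
  have "velo \<tau> z = sig 0 \<tau> *\<^sub>R W 0 z + (\<Sum>i=1..n. sig i \<tau> *\<^sub>R W i z)"
    unfolding velo_def by (simp add: sum.atLeast_Suc_atMost)
  also have "(\<Sum>i=1..n. sig i \<tau> *\<^sub>R W i z) = (\<Sum>i=1..n. (U i \<tau> * lam i * gain z) *\<^sub>R Y i (pos z))"
    by (intro sum.cong) (auto simp: sig_def W_def mult.assoc)
  finally show ?thesis by (simp add: sig_def W_def)
qed

text \<open>The coefficients factor as \<open>sig i * sig j\<close>, and \<open>kp i j\<close> is
  linear in \<open>W j\<close> apart from the terms placed in column 0. Summing over
  \<open>j\<close> therefore replaces \<open>W j\<close> by the full velocity
  \<open>velo\<close>.\<close>

lemma sum_c_k:
  assumes z: "z \<in> M"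
  shows "(\<Sum>l\<in>I. c l \<tau> *\<^sub>R k l z) = ((velo \<tau> z,
      christ (pos z) (velo \<tau> z) (vel z) - R (pos z) (velo \<tau> z) + drift z
      - (\<Sum>i=1..n. (U i \<tau> * lam i) *\<^sub>R ((dgain z * (deriv_within Q \<psi> (pos z) (velo \<tau> z) - filt z)) *\<^sub>R Y i (pos z)
           + gain z *\<^sub>R cov (velo \<tau> z) (Y i) (pos z)))), filt z)"
proof -
  have q: "pos z \<in> Q" using z M_iff by blast
  note lin = linear_sum linear_scale
  have delta: "(\<Sum>j\<in>{0..n}. sig j \<tau> *\<^sub>R (if j = 0 then v else 0)) = v" for v :: 'a
  proof -
    have "(\<Sum>j\<in>{0..n}. sig j \<tau> *\<^sub>R (if j = 0 then v else 0)) = (\<Sum>j\<in>{0..n}. if j = 0 then v else 0)"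
      by (intro sum.cong) (auto simp: sig_def)
    then show ?thesis by simp
  qed
  have c_ij: "c (i, j) \<tau> = sig i \<tau> * sig j \<tau>" for i j unfolding c_def by simp
  have row: "(\<Sum>j\<in>{0..n}. c (i, j) \<tau> *\<^sub>R k (i, j) z) = sig i \<tau> *\<^sub>R (\<Sum>j\<in>{0..n}. sig j \<tau> *\<^sub>R k (i, j) z)" for i
    by (simp add: c_ij scaleR_sum_right)
  have row0: "(\<Sum>j\<in>{0..n}. sig j \<tau> *\<^sub>R k (0, j) z) =
      ((velo \<tau> z, christ (pos z) (velo \<tau> z) (vel z) - R (pos z) (velo \<tau> z) + drift z), filt z)"
  proof (intro prod_eqI)
    have 1: "(\<Sum>j\<in>{0..n}. sig j \<tau> *\<^sub>R christ (pos z) (W j z) (vel z)) = christ (pos z) (velo \<tau> z) (vel z)"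
      unfolding velo_def by (simp add: linear_sum[OF linear_christ_left[OF q]] linear_scale[OF linear_christ_left[OF q]])
    have 2: "(\<Sum>j\<in>{0..n}. sig j \<tau> *\<^sub>R R (pos z) (W j z)) = R (pos z) (velo \<tau> z)"
      unfolding velo_def using R_sum[OF q, of "{0..n}" "\<lambda>j. W j z"] W_in[OF z] by simp
    have "(\<Sum>j\<in>{0..n}. sig j \<tau> *\<^sub>R kp 0 j z) = christ (pos z) (velo \<tau> z) (vel z) - R (pos z) (velo \<tau> z) + drift z"
      unfolding kp_def 1[symmetric] 2[symmetric]
      by (simp only: simp_thms if_True scaleR_add_right scaleR_diff_right sum.distrib sum_subtractf delta)
    then show "snd (fst (\<Sum>j\<in>{0..n}. sig j \<tau> *\<^sub>R k (0, j) z)) = snd (fst ((velo \<tau> z, christ (pos z) (velo \<tau> z) (vel z) - R (pos z) (velo \<tau> z) + drift z), filt z))"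
      by (simp add: fst_sum snd_sum k_def)
    have "(\<Sum>j\<in>{0..n}. sig j \<tau> * (if j = 0 then filt z else 0)) = filt z"
    proof -
      have "(\<Sum>j\<in>{0..n}. sig j \<tau> * (if j = 0 then filt z else 0)) = (\<Sum>j\<in>{0..n}. if j = 0 then filt z else 0)"
        by (intro sum.cong) (auto simp: sig_def)
      then show ?thesis by simp
    qed
    then show "snd (\<Sum>j\<in>{0..n}. sig j \<tau> *\<^sub>R k (0, j) z) = snd ((velo \<tau> z, christ (pos z) (velo \<tau> z) (vel z) - R (pos z) (velo \<tau> z) + drift z), filt z)"
      by (simp add: snd_sum k_def)
  qed (simp add: fst_sum k_def velo_def)
  have rowi: "(\<Sum>j\<in>{0..n}. sig j \<tau> *\<^sub>R k (i, j) z) = ((0, - (lam i *\<^sub>R ((dgain z * (deriv_within Q \<psi> (pos z) (velo \<tau> z) - filt z)) *\<^sub>R Y i (pos z)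
           + gain z *\<^sub>R cov (velo \<tau> z) (Y i) (pos z)))), 0)" if i: "i \<in> {1..n}" for i
  proof (intro prod_eqI)
    let ?L = "\<lambda>v. lam i *\<^sub>R ((dgain z * deriv_within Q \<psi> (pos z) v) *\<^sub>R Y i (pos z) + gain z *\<^sub>R cov v (Y i) (pos z))"
    have ld: "linear (deriv_within Q \<psi> (pos z))" by (rule linear_deriv_within[OF \<psi> q])
    have L: "linear ?L"
      by (rule linearI) (simp_all add: linear_add[OF ld] linear_scale[OF ld] linear_add[OF linear_cov] linear_scale[OF linear_cov] algebra_simps)
    have 1: "(\<Sum>j\<in>{0..n}. sig j \<tau> *\<^sub>R ?L (W j z)) = ?L (velo \<tau> z)"
      unfolding velo_def linear_sum[OF L] linear_scale[OF L] ..
    have "(\<Sum>j\<in>{0..n}. sig j \<tau> *\<^sub>R kp i j z) = (lam i * dgain z * filt z) *\<^sub>R Y i (pos z) - ?L (velo \<tau> z)"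
      unfolding 1[symmetric] kp_def using i
      by (simp only: if_False scaleR_diff_right sum_subtractf delta atLeastAtMost_iff not_one_le_zero simp_thms)
        (simp add: sum_subtractf scaleR_diff_right delta)
    then show "snd (fst (\<Sum>j\<in>{0..n}. sig j \<tau> *\<^sub>R k (i, j) z)) = snd (fst ((0, - (lam i *\<^sub>R ((dgain z * (deriv_within Q \<psi> (pos z) (velo \<tau> z) - filt z)) *\<^sub>R Y i (pos z)
           + gain z *\<^sub>R cov (velo \<tau> z) (Y i) (pos z)))), 0))"
      by (simp add: fst_sum snd_sum k_def algebra_simps)
  qed (use i in \<open>simp_all add: fst_sum snd_sum k_def\<close>)
  have "(\<Sum>l\<in>I. c l \<tau> *\<^sub>R k l z) = (\<Sum>i\<in>{0..n}. sig i \<tau> *\<^sub>R (\<Sum>j\<in>{0..n}. sig j \<tau> *\<^sub>R k (i, j) z))"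
    unfolding sum_k row ..
  also have "\<dots> = sig 0 \<tau> *\<^sub>R (\<Sum>j\<in>{0..n}. sig j \<tau> *\<^sub>R k (0, j) z) + (\<Sum>i=1..n. sig i \<tau> *\<^sub>R (\<Sum>j\<in>{0..n}. sig j \<tau> *\<^sub>R k (i, j) z))"
    by (simp add: sum.atLeast_Suc_atMost)
  also have "(\<Sum>i=1..n. sig i \<tau> *\<^sub>R (\<Sum>j\<in>{0..n}. sig j \<tau> *\<^sub>R k (i, j) z)) =
    ((0, - (\<Sum>i=1..n. (U i \<tau> * lam i) *\<^sub>R ((dgain z * (deriv_within Q \<psi> (pos z) (velo \<tau> z) - filt z)) *\<^sub>R Y i (pos z)
           + gain z *\<^sub>R cov (velo \<tau> z) (Y i) (pos z)))), 0)"
  proof -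
    have "(\<Sum>i=1..n. sig i \<tau> *\<^sub>R (\<Sum>j\<in>{0..n}. sig j \<tau> *\<^sub>R k (i, j) z)) = (\<Sum>i=1..n.
      ((0, - ((U i \<tau> * lam i) *\<^sub>R ((dgain z * (deriv_within Q \<psi> (pos z) (velo \<tau> z) - filt z)) *\<^sub>R Y i (pos z)
           + gain z *\<^sub>R cov (velo \<tau> z) (Y i) (pos z)))), 0))"
    proof (rule sum.cong[OF refl])
      fix i assume i: "i \<in> {1..n}"
      then have "sig i \<tau> = U i \<tau>" unfolding sig_def by simp
      then show "sig i \<tau> *\<^sub>R (\<Sum>j\<in>{0..n}. sig j \<tau> *\<^sub>R k (i, j) z) =
        ((0, - ((U i \<tau> * lam i) *\<^sub>R ((dgain z * (deriv_within Q \<psi> (pos z) (velo \<tau> z) - filt z)) *\<^sub>R Y i (pos z)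
           + gain z *\<^sub>R cov (velo \<tau> z) (Y i) (pos z)))), 0)"
        unfolding rowi[OF i] by (simp add: scaleR_scaleR)
    qed
    then show ?thesis by (simp add: prod_eq_iff fst_sum snd_sum sum_negf)
  qed
  finally show ?thesis unfolding row0 by (simp add: sig_def)
qed

end

section \<open>Equivalence of the closed-loop system with a classical equation\<close>

lemma has_vector_derivative_Pair_iff:
  "((\<lambda>s. (f s, g s)) has_vector_derivative (a, b)) (at t) \<longleftrightarrow> (f has_vector_derivative a) (at t) \<and> (g has_vector_derivative b) (at t)"
proof
  assume *: "((\<lambda>s. (f s, g s)) has_vector_derivative (a, b)) (at t)"
  show "(f has_vector_derivative a) (at t) \<and> (g has_vector_derivative b) (at t)"
    using bounded_linear.has_vector_derivative[OF bounded_linear_fst *]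
      bounded_linear.has_vector_derivative[OF bounded_linear_snd *] by simp
next
  assume "(f has_vector_derivative a) (at t) \<and> (g has_vector_derivative b) (at t)"
  then show "((\<lambda>s. (f s, g s)) has_vector_derivative (a, b)) (at t)"
    by (auto intro: has_vector_derivative_Pair)
qed

context oscillatory_control
begin

section \<open>The change of variables\<close>

definition shear :: "real \<Rightarrow> ('a \<times> 'a) \<times> real \<Rightarrow> 'a" where
  "shear \<tau> x = (\<Sum>i=1..n. U i \<tau> *\<^sub>R W i x)"

definition phi :: "real \<Rightarrow> real \<Rightarrow> ('a \<times> 'a) \<times> real \<Rightarrow> ('a \<times> 'a) \<times> real" where
  "phi \<omega> t x = ((pos x, vel x - shear (\<omega> * t) x), snd x)"

definition phinv :: "real \<Rightarrow> real \<Rightarrow> ('a \<times> 'a) \<times> real \<Rightarrow> ('a \<times> 'a) \<times> real" where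
  "phinv \<omega> t x = ((pos x, vel x + shear (\<omega> * t) x), snd x)"

abbreviation G :: "real \<Rightarrow> real \<Rightarrow> ('a \<times> 'a) \<times> real \<Rightarrow> ('a \<times> 'a) \<times> real" where
  "G \<omega> t z \<equiv> (\<Sum>l\<in>I. c l (\<omega> * t) *\<^sub>R k l z)"

abbreviation CL :: "real \<Rightarrow> real set \<Rightarrow> (real \<Rightarrow> ('a \<times> 'a) \<times> real) \<Rightarrow> bool" where
  "CL \<omega> \<equiv> closed_loop_solution Q nabla n Y R \<psi> \<alpha> u lam mu h \<omega>"

text \<open>Everything here ignores the velocity component. In particular the shear is the same
  before and after the change of variables, so adding it back inverts the change.\<close>

lemma pos_out_cong:
  assumes "pos x = pos y" "snd x = snd y"
  shows "gain x = gain y" "dgain x = dgain y" "filt x = filt y" "drift x = drift y" "shear \<tau> x = shear \<tau> y"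
proof -
  show g: "gain x = gain y" unfolding gain_def assms ..
  show "dgain x = dgain y" unfolding dgain_def assms ..
  show "filt x = filt y" unfolding filt_def assms ..
  show "drift x = drift y" unfolding drift_def assms g ..
  show "shear \<tau> x = shear \<tau> y" unfolding shear_def W_def assms g by (intro sum.cong) auto
qed

lemma change_of_variables_eq: "change_of_variables n Y \<psi> \<alpha> U lam \<omega> t = phi \<omega> t"
proof
  fix x
  have "shear (\<omega> * t) x = (\<Sum>i=1..n. (U i (\<omega> * t) * lam i * gain x) *\<^sub>R Y i (pos x))"
    unfolding shear_def by (intro sum.cong refl) (simp add: W_def mult.assoc)
  then show "change_of_variables n Y \<psi> \<alpha> U lam \<omega> t x = phi \<omega> t x"
    unfolding change_of_variables_def phi_def by (simp add: case_prod_beta gain_def)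
qed

lemma phi_simps [simp]: "pos (phi \<omega> t x) = pos x" "snd (phi \<omega> t x) = snd x" "vel (phi \<omega> t x) = vel x - shear (\<omega> * t) x"
  and phinv_simps [simp]: "pos (phinv \<omega> t x) = pos x" "snd (phinv \<omega> t x) = snd x" "vel (phinv \<omega> t x) = vel x + shear (\<omega> * t) x"
  unfolding phi_def phinv_def by auto

lemma phi_phinv [simp]: "phi \<omega> t (phinv \<omega> t x) = x" and phinv_phi [simp]: "phinv \<omega> t (phi \<omega> t x) = x"
proof -
  have 1: "shear (\<omega> * t) (phi \<omega> t x) = shear (\<omega> * t) x" and 2: "shear (\<omega> * t) (phinv \<omega> t x) = shear (\<omega> * t) x"
    by (rule pos_out_cong(5); simp)+
  show "phi \<omega> t (phinv \<omega> t x) = x" "phinv \<omega> t (phi \<omega> t x) = x"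
    by (intro prod_eqI; simp add: 1 2)+
qed

lemma shear_in: "pos x \<in> Q \<Longrightarrow> shear \<tau> x \<in> tangent_space Q (pos x)"
proof -
  assume q: "pos x \<in> Q"
  then have "((pos x, 0), snd x) \<in> M" unfolding M_iff using subspace_0[OF subspace_T] by simp
  then have "shear \<tau> ((pos x, 0), snd x) \<in> tangent_space Q (pos x)"
    unfolding shear_def using W_in[of "((pos x, 0), snd x)"] q by (intro subspace_sum subspace_scale subspace_T) auto
  then show ?thesis using pos_out_cong(5)[of x "((pos x, 0), snd x)"] by simp
qed

lemma phi_in [simp]: "phi \<omega> t x \<in> M \<longleftrightarrow> x \<in> M"
proof (cases "pos x \<in> Q")
  case True
  note S = subspace_T[OF True] and Z = shear_in[OF True, of "\<omega> * t"]
  have "vel x - shear (\<omega> * t) x \<in> tangent_space Q (pos x) \<longleftrightarrow> vel x \<in> tangent_space Q (pos x)"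
    using subspace_add[OF S _ Z, of "vel x - shear (\<omega> * t) x"] subspace_diff[OF S _ Z, of "vel x"] by auto
  then show ?thesis using True unfolding M_iff by simp
qed (simp add: M_iff)

lemma velo_phi: "velo (\<omega> * t) (phi \<omega> t x) = vel x"
proof -
  have "velo (\<omega> * t) (phi \<omega> t x) = vel (phi \<omega> t x) + shear (\<omega> * t) (phi \<omega> t x)"
    unfolding velo_eq shear_def by (intro arg_cong2[where f = plus] sum.cong refl) (simp add: W_def mult.assoc)
  also have "shear (\<omega> * t) (phi \<omega> t x) = shear (\<omega> * t) x" by (rule pos_out_cong) simp_all
  finally show ?thesis by simp
qed

text \<open>\<open>U i\<close> is Lipschitz in time because \<open>u i\<close> is bounded, and
  \<open>W i\<close> is Lipschitz and bounded on compact sets. The shear need not be differentiable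
  in time everywhere, but Lipschitz dependence is enough to preserve absolute continuity.\<close>

lemma shear_lipschitz:
  assumes K: "compact K" "K \<subseteq> M"
  shows "\<exists>C\<ge>0. \<forall>x\<in>K. \<forall>y\<in>K. \<forall>s t. norm (shear (\<omega> * t) x - shear (\<omega> * s) y) \<le> C * (norm (x - y) + \<bar>t - s\<bar>)"
proof -
  have "\<exists>C\<ge>0. \<forall>x\<in>K. \<forall>y\<in>K. \<forall>s t. norm (U i (\<omega> * t) *\<^sub>R W i x - U i (\<omega> * s) *\<^sub>R W i y) \<le> C * (norm (x - y) + \<bar>t - s\<bar>)"
    if i: "i \<in> {1..n}" for i
  proof -
    have sW: "smooth_on M (W i)" using smooth_W i by auto
    obtain L where L: "L \<ge> 0" "\<And>x y. x \<in> K \<Longrightarrow> y \<in> K \<Longrightarrow> norm (W i x - W i y) \<le> L * norm (x - y)"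
      using smooth_on_compact_lipschitz[OF sW K] by metis
    obtain B where B: "B \<ge> 0" "\<And>x. x \<in> K \<Longrightarrow> norm (W i x) \<le> B"
      using smooth_on_compact_bounded[OF sW K] by metis
    obtain A where A: "\<And>t. \<bar>U i t\<bar> \<le> A"
      using periodic_continuous_bounded[OF U_continuous[OF i] T U_periodic[OF i]] by metis
    obtain \<beta> where \<beta>: "\<beta> \<ge> 0" "\<And>s t. \<bar>U i t - U i s\<bar> \<le> \<beta> * \<bar>t - s\<bar>"
      using U_lipschitz[OF i] by metis
    have A0: "A \<ge> 0" using A[of 0] by linarith
    define C where "C = A * L + \<beta> * \<bar>\<omega>\<bar> * B"
    show ?thesis
    proof (intro exI[of _ C] conjI ballI allI)
      show "C \<ge> 0" unfolding C_def using A0 L(1) B(1) \<beta>(1) by simp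
      fix x y s t assume xy: "x \<in> K" "y \<in> K"
      have e: "U i (\<omega> * t) *\<^sub>R W i x - U i (\<omega> * s) *\<^sub>R W i y
          = U i (\<omega> * t) *\<^sub>R (W i x - W i y) + (U i (\<omega> * t) - U i (\<omega> * s)) *\<^sub>R W i y"
        by (simp add: algebra_simps)
      have w: "\<bar>\<omega> * t - \<omega> * s\<bar> = \<bar>\<omega>\<bar> * \<bar>t - s\<bar>"
        unfolding right_diff_distrib[symmetric] abs_mult ..
      have "norm (U i (\<omega> * t) *\<^sub>R W i x - U i (\<omega> * s) *\<^sub>R W i y)
          \<le> \<bar>U i (\<omega> * t)\<bar> * norm (W i x - W i y) + \<bar>U i (\<omega> * t) - U i (\<omega> * s)\<bar> * norm (W i y)"
        unfolding e by (rule order_trans[OF norm_triangle_ineq]) simp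
      also have "\<dots> \<le> A * (L * norm (x - y)) + (\<beta> * (\<bar>\<omega>\<bar> * \<bar>t - s\<bar>)) * B"
        using A[of "\<omega> * t"] A0 L(2)[OF xy] \<beta>(1) \<beta>(2)[of "\<omega> * t" "\<omega> * s", unfolded w] B(2)[OF xy(2)] B(1)
        by (intro add_mono mult_mono) auto
      also have "\<dots> \<le> C * (norm (x - y) + \<bar>t - s\<bar>)"
        unfolding C_def using A0 L(1) B(1) \<beta>(1) by (simp add: algebra_simps)
      finally show "norm (U i (\<omega> * t) *\<^sub>R W i x - U i (\<omega> * s) *\<^sub>R W i y) \<le> C * (norm (x - y) + \<bar>t - s\<bar>)" .
    qed
  qed
  then have "\<forall>i\<in>{1..n}. \<exists>C\<ge>0. \<forall>x\<in>K. \<forall>y\<in>K. \<forall>s t. norm (U i (\<omega> * t) *\<^sub>R W i x - U i (\<omega> * s) *\<^sub>R W i y) \<le> C * (norm (x - y) + \<bar>t - s\<bar>)"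
    by (rule ballI)
  then obtain C where C: "\<forall>i\<in>{1..n}. C i \<ge> 0 \<and> (\<forall>x\<in>K. \<forall>y\<in>K. \<forall>s t. norm (U i (\<omega> * t) *\<^sub>R W i x - U i (\<omega> * s) *\<^sub>R W i y) \<le> C i * (norm (x - y) + \<bar>t - s\<bar>))"
    by (rule bchoice[THEN exE])
  show ?thesis
  proof (intro exI[of _ "\<Sum>i=1..n. C i"] conjI ballI allI)
    show "(\<Sum>i=1..n. C i) \<ge> 0" using C by (intro sum_nonneg) blast
    fix x y s t assume xy: "x \<in> K" "y \<in> K"
    have "norm (shear (\<omega> * t) x - shear (\<omega> * s) y) = norm (\<Sum>i=1..n. U i (\<omega> * t) *\<^sub>R W i x - U i (\<omega> * s) *\<^sub>R W i y)"
      unfolding shear_def by (simp add: sum_subtractf)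
    also have "\<dots> \<le> (\<Sum>i=1..n. C i * (norm (x - y) + \<bar>t - s\<bar>))"
      using C xy by (intro sum_norm_le) blast
    finally show "norm (shear (\<omega> * t) x - shear (\<omega> * s) y) \<le> (\<Sum>i=1..n. C i) * (norm (x - y) + \<bar>t - s\<bar>)"
      by (simp add: sum_distrib_right)
  qed
qed

lemma absolutely_continuous_shear:
  assumes ac: "absolutely_continuous_on_interval a b x" and xM: "\<And>t. t \<in> {a..b} \<Longrightarrow> x t \<in> M"
  shows "absolutely_continuous_on_interval a b (\<lambda>t. phi \<omega> t (x t))"
    and "absolutely_continuous_on_interval a b (\<lambda>t. phinv \<omega> t (x t))"
proof -
  have "compact (x ` {a..b})"
    by (intro compact_continuous_image absolutely_continuous_imp_continuous_on[OF ac]) simp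
  moreover have "x ` {a..b} \<subseteq> M" using xM by blast
  ultimately obtain C where C: "C \<ge> 0" "\<And>p q s t. p \<in> x ` {a..b} \<Longrightarrow> q \<in> x ` {a..b} \<Longrightarrow>
      norm (shear (\<omega> * t) p - shear (\<omega> * s) q) \<le> C * (norm (p - q) + \<bar>t - s\<bar>)"
    using shear_lipschitz[of "x ` {a..b}" \<omega>] by metis
  have n: "norm ((0 :: 'a, w :: 'a), 0 :: real) = norm w" for w by (simp add: norm_Pair)
  have le: "norm ((p :: ('a \<times> 'a) \<times> real) + ((0, w), 0)) \<le> norm p + norm w" for p w
    using norm_triangle_ineq[of p "((0, w), 0)"] by (simp add: n)
  have 1: "norm (phi \<omega> t (x t) - phi \<omega> s (x s)) \<le> (1 + C) * (norm (x t - x s) + \<bar>t - s\<bar>)"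
    and 2: "norm (phinv \<omega> t (x t) - phinv \<omega> s (x s)) \<le> (1 + C) * (norm (x t - x s) + \<bar>t - s\<bar>)"
    if st: "s \<in> {a..b}" "t \<in> {a..b}" for s t
  proof -
    let ?D = "shear (\<omega> * t) (x t) - shear (\<omega> * s) (x s)"
    have D: "norm ?D \<le> C * (norm (x t - x s) + \<bar>t - s\<bar>)" using C(2) st by blast
    have "phi \<omega> t (x t) - phi \<omega> s (x s) = (x t - x s) + ((0, - ?D), 0)"
      "phinv \<omega> t (x t) - phinv \<omega> s (x s) = (x t - x s) + ((0, ?D), 0)"
      by (intro prod_eqI; simp)+
    then have "norm (phi \<omega> t (x t) - phi \<omega> s (x s)) \<le> norm (x t - x s) + norm ?D"
      "norm (phinv \<omega> t (x t) - phinv \<omega> s (x s)) \<le> norm (x t - x s) + norm ?D"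
      using le[of "x t - x s" "- ?D"] le[of "x t - x s" ?D] by (simp_all only: norm_minus_cancel)
    then show "norm (phi \<omega> t (x t) - phi \<omega> s (x s)) \<le> (1 + C) * (norm (x t - x s) + \<bar>t - s\<bar>)"
      "norm (phinv \<omega> t (x t) - phinv \<omega> s (x s)) \<le> (1 + C) * (norm (x t - x s) + \<bar>t - s\<bar>)"
      using D by (simp_all add: algebra_simps)
  qed
  have C1: "1 + C \<ge> 0" using C(1) by simp
  show "absolutely_continuous_on_interval a b (\<lambda>t. phi \<omega> t (x t))"
    by (rule absolutely_continuous_on_interval_le[OF ac 1 C1])
  show "absolutely_continuous_on_interval a b (\<lambda>t. phinv \<omega> t (x t))"
    by (rule absolutely_continuous_on_interval_le[OF ac 2 C1])
qed

lemma G_continuous: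
  assumes "continuous_on S z" "z ` S \<subseteq> M"
  shows "continuous_on S (\<lambda>t. G \<omega> t (z t))"
proof (intro continuous_on_sum continuous_on_scaleR)
  fix l assume l: "l \<in> I"
  show "continuous_on S (\<lambda>t. c l (\<omega> * t))"
    by (rule continuous_on_compose2[OF c_continuous[OF l, of UNIV]]) (auto intro!: continuous_intros)
  show "continuous_on S (\<lambda>t. k l (z t))"
    by (rule continuous_on_compose2[OF smooth_on_continuous[OF smooth_k[OF l]] assms])
qed

text \<open>The derivative \<open>D\<close> of the shear contains \<open>Us\<close>, which is the
  forcing of order \<omega>, and cancels it. What remains of \<open>D\<close> is
  \<open>christ\<close> applied to the shear, which by linearity replaces the last velocity in
  \<open>christ (q t) (v t) (v t)\<close> by the new one, and the derivatives of the gain and of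
  \<open>Y i\<close> along the motion.\<close>

lemma closed_loop_pointwise:
  assumes J: "open J" "t \<in> J" "\<And>s. s \<in> J \<Longrightarrow> x s \<in> M"
    and U': "\<And>i. i \<in> {1..n} \<Longrightarrow> (U i has_real_derivative u i (\<omega> * t)) (at (\<omega> * t))"
  shows "satisfies_system Q nabla \<psi> h (closed_loop_rhs n Y R \<psi> \<alpha> u lam mu \<omega>) x t \<longleftrightarrow>
    ((\<lambda>s. phi \<omega> s (x s)) has_vector_derivative G \<omega> t (phi \<omega> t (x t))) (at t)"
proof -
  define q v \<eta> where "q s = pos (x s)" and "v s = vel (x s)" and "\<eta> s = snd (x s)" for s
  have xt: "x t \<in> M" using J by blast
  have qt: "q t \<in> Q" and vt: "v t \<in> tangent_space Q (q t)" using xt unfolding M_iff q_def v_def by auto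
  have evJ: "\<forall>\<^sub>F s in nhds t. s \<in> J" using J(1,2) by (rule eventually_nhds_in_open)
  have evq: "\<forall>\<^sub>F s in nhds t. q s \<in> Q"
    using evJ by (rule eventually_mono) (use J(3) in \<open>auto simp: M_iff q_def\<close>)
  have evv: "\<forall>\<^sub>F s in nhds t. v s \<in> tangent_space Q (q s)"
    using evJ by (rule eventually_mono) (use J(3) in \<open>auto simp: M_iff q_def v_def\<close>)
  define F where "F = closed_loop_rhs n Y R \<psi> \<alpha> u lam mu \<omega> t (x t)"
  define Us where "Us = (\<Sum>i=1..n. (\<omega> * u i (\<omega> * t) * lam i * gain (x t)) *\<^sub>R Y i (q t))"
  have F: "F = drift (x t) - R (q t) (v t) + Us"
    unfolding F_def closed_loop_rhs_def drift_def gain_def q_def v_def Us_def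
    by (simp add: case_prod_beta scaleR_sum_right mult.commute)
  note S = subspace_T[OF qt]
  have Yin: "Y i (q t) \<in> tangent_space Q (q t)" if "i \<in> {1..n}" for i using vf_in[OF Y qt] that by auto
  have "F \<in> tangent_space Q (q t)"
    unfolding F Us_def using drift_in[OF xt] R_in[OF qt vt] Yin
    by (intro subspace_add[OF S] subspace_diff[OF S] subspace_sum[OF S] subspace_scale[OF S]) (auto simp: q_def)
  then have hcd: "has_covariant_derivative Q nabla q v F t \<longleftrightarrow> (v has_vector_derivative (christ (q t) (v t) (v t) + F)) (at t)"
    if "(q has_vector_derivative v t) (at t)"
    using has_covariant_derivative_iff[OF evq evv that vt] by blast
  have "filt (x t) = - h * \<eta> t + h * \<psi> (q t)" unfolding filt_def q_def \<eta>_def ..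
  then have "satisfies_system Q nabla \<psi> h (closed_loop_rhs n Y R \<psi> \<alpha> u lam mu \<omega>) x t \<longleftrightarrow>
    (q has_vector_derivative v t) (at t) \<and> has_covariant_derivative Q nabla q v F t \<and>
    (\<eta> has_vector_derivative filt (x t)) (at t)"
    unfolding satisfies_system_def Let_def F_def[symmetric] q_def[symmetric] v_def[symmetric] \<eta>_def[symmetric]
      has_real_derivative_iff_has_vector_derivative by simp
  then have sat: "satisfies_system Q nabla \<psi> h (closed_loop_rhs n Y R \<psi> \<alpha> u lam mu \<omega>) x t \<longleftrightarrow>
    (q has_vector_derivative v t) (at t) \<and> (v has_vector_derivative (christ (q t) (v t) (v t) + F)) (at t) \<and>
    (\<eta> has_vector_derivative filt (x t)) (at t)"
    using hcd by blast
  define e where "e = dgain (x t) * (deriv_within Q \<psi> (q t) (v t) - filt (x t))"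
  define D where "D = (\<Sum>i=1..n. (U i (\<omega> * t) * lam i * gain (x t)) *\<^sub>R deriv_within Q (Y i) (q t) (v t)
      + (U i (\<omega> * t) * lam i * e + \<omega> * u i (\<omega> * t) * lam i * gain (x t)) *\<^sub>R Y i (q t))"
  \<comment> \<open>The shear depends on position and filter only, so its derivative exists under
    conditions common to both sides of the equivalence.\<close>
  have D: "((\<lambda>s. shear (\<omega> * s) (x s)) has_vector_derivative D) (at t)"
    if q': "(q has_vector_derivative v t) (at t)" and \<eta>': "(\<eta> has_vector_derivative filt (x t)) (at t)"
    unfolding shear_def D_def
  proof (rule has_vector_derivative_sum)
    fix i assume i: "i \<in> {1..n}"
    have "((\<lambda>s. \<psi> (q s) - \<eta> s) has_vector_derivative (deriv_within Q \<psi> (q t) (v t) - filt (x t))) (at t)"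
      by (intro has_vector_derivative_diff smooth_on_vector_derivative_compose[OF \<psi> qt q' evq] \<eta>')
    then have "((\<lambda>s. \<psi> (q s) - \<eta> s) has_real_derivative (deriv_within Q \<psi> (q t) (v t) - filt (x t))) (at t)"
      by (simp only: has_real_derivative_iff_has_vector_derivative)
    from DERIV_chain2[OF \<alpha>_deriv this]
    have g': "((\<lambda>s. gain (x s)) has_real_derivative e) (at t)"
      unfolding gain_def e_def dgain_def q_def \<eta>_def .
    have "((\<lambda>s. \<omega> * s) has_real_derivative \<omega>) (at t)" by (auto intro!: derivative_eq_intros)
    from DERIV_chain2[OF U'[OF i] this]
    have "((\<lambda>s. U i (\<omega> * s)) has_real_derivative u i (\<omega> * t) * \<omega>) (at t)" .
    from DERIV_mult[OF DERIV_cmult_right[OF this, of "lam i"] g']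
    have "((\<lambda>s. U i (\<omega> * s) * lam i * gain (x s)) has_vector_derivative
        (u i (\<omega> * t) * \<omega> * lam i * gain (x t) + e * (U i (\<omega> * t) * lam i))) (at t)"
      unfolding has_real_derivative_iff_has_vector_derivative .
    from bounded_bilinear.has_vector_derivative[OF bounded_bilinear_scaleR this
        smooth_on_vector_derivative_compose[OF vf_smooth[OF Y] qt q' evq, of i]]
    have "((\<lambda>s. (U i (\<omega> * s) * lam i * gain (x s)) *\<^sub>R Y i (q s)) has_vector_derivative
      (U i (\<omega> * t) * lam i * gain (x t)) *\<^sub>R deriv_within Q (Y i) (q t) (v t)
      + (U i (\<omega> * t) * lam i * e + \<omega> * u i (\<omega> * t) * lam i * gain (x t)) *\<^sub>R Y i (q t)) (at t)"
      using i by (simp add: algebra_simps)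
    moreover have "(\<lambda>s. U i (\<omega> * s) *\<^sub>R W i (x s)) = (\<lambda>s. (U i (\<omega> * s) * lam i * gain (x s)) *\<^sub>R Y i (q s))"
      using i unfolding W_def q_def by (auto simp: mult.assoc)
    ultimately show "((\<lambda>s. U i (\<omega> * s) *\<^sub>R W i (x s)) has_vector_derivative
      (U i (\<omega> * t) * lam i * gain (x t)) *\<^sub>R deriv_within Q (Y i) (q t) (v t)
      + (U i (\<omega> * t) * lam i * e + \<omega> * u i (\<omega> * t) * lam i * gain (x t)) *\<^sub>R Y i (q t)) (at t)" by simp
  qed
  define P where "P = christ (q t) (v t) (v t) + F - D"
  have zM: "phi \<omega> t (x t) \<in> M" using xt by simp
  have Geq: "G \<omega> t (phi \<omega> t (x t)) = ((v t, P), filt (x t))"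
  proof -
    let ?Z = "shear (\<omega> * t) (x t)"
    have "christ (q t) (v t) ?Z = (\<Sum>i=1..n. (U i (\<omega> * t) * lam i * gain (x t)) *\<^sub>R christ (q t) (v t) (Y i (q t)))"
      unfolding shear_def linear_sum[OF linear_christ] linear_scale[OF linear_christ]
      by (intro sum.cong refl) (simp add: W_def linear_scale[OF linear_christ] q_def mult.assoc)
    moreover have "D - Us = (\<Sum>i=1..n. (U i (\<omega> * t) * lam i * gain (x t)) *\<^sub>R christ (q t) (v t) (Y i (q t))
        + (U i (\<omega> * t) * lam i) *\<^sub>R (e *\<^sub>R Y i (q t) + gain (x t) *\<^sub>R cov (v t) (Y i) (q t)))"
      unfolding D_def Us_def sum_subtractf[symmetric]
    proof (rule sum.cong[OF refl])
      fix i assume "i \<in> {1..n}"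
      then have "vector_field Q (Y i)" using Y by auto
      then have 1: "deriv_within Q (Y i) (q t) (v t) = christ (q t) (v t) (Y i (q t)) + cov (v t) (Y i) (q t)"
        by (rule deriv_within_vector_field[OF _ qt vt])
      show "(U i (\<omega> * t) * lam i * gain (x t)) *\<^sub>R deriv_within Q (Y i) (q t) (v t)
          + (U i (\<omega> * t) * lam i * e + \<omega> * u i (\<omega> * t) * lam i * gain (x t)) *\<^sub>R Y i (q t)
          - (\<omega> * u i (\<omega> * t) * lam i * gain (x t)) *\<^sub>R Y i (q t)
        = (U i (\<omega> * t) * lam i * gain (x t)) *\<^sub>R christ (q t) (v t) (Y i (q t))
        + (U i (\<omega> * t) * lam i) *\<^sub>R (e *\<^sub>R Y i (q t) + gain (x t) *\<^sub>R cov (v t) (Y i) (q t))"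
        unfolding 1 by (simp add: scaleR_add_right scaleR_add_left mult.assoc)
    qed
    ultimately have DU: "D - Us = christ (q t) (v t) ?Z +
        (\<Sum>i=1..n. (U i (\<omega> * t) * lam i) *\<^sub>R (e *\<^sub>R Y i (q t) + gain (x t) *\<^sub>R cov (v t) (Y i) (q t)))"
      by (simp add: sum.distrib)
    have g: "gain (phi \<omega> t (x t)) = gain (x t)" "dgain (phi \<omega> t (x t)) = dgain (x t)" "filt (phi \<omega> t (x t)) = filt (x t)"
      "drift (phi \<omega> t (x t)) = drift (x t)" by (rule pos_out_cong; simp)+
    have "P = christ (q t) (v t) (v t) + (drift (x t) - R (q t) (v t)) - (D - Us)"
      unfolding P_def F by simp
    also have "\<dots> = christ (q t) (v t) (v t - ?Z) - R (q t) (v t) + drift (x t)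
      - (\<Sum>i=1..n. (U i (\<omega> * t) * lam i) *\<^sub>R (e *\<^sub>R Y i (q t) + gain (x t) *\<^sub>R cov (v t) (Y i) (q t)))"
      unfolding DU linear_diff[OF linear_christ] by simp
    finally show ?thesis
      unfolding sum_c_k[OF zM] velo_phi g phi_simps by (simp only: q_def v_def e_def)
  qed
  have "(\<lambda>s. phi \<omega> s (x s)) = (\<lambda>s. ((q s, v s - shear (\<omega> * s) (x s)), \<eta> s))"
    unfolding phi_def q_def v_def \<eta>_def ..
  then have "((\<lambda>s. phi \<omega> s (x s)) has_vector_derivative G \<omega> t (phi \<omega> t (x t))) (at t) \<longleftrightarrow>
    (q has_vector_derivative v t) (at t) \<and> ((\<lambda>s. v s - shear (\<omega> * s) (x s)) has_vector_derivative P) (at t) \<and>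
    (\<eta> has_vector_derivative filt (x t)) (at t)"
    unfolding Geq by (simp add: has_vector_derivative_Pair_iff)
  also have "\<dots> \<longleftrightarrow> (q has_vector_derivative v t) (at t) \<and> (v has_vector_derivative (christ (q t) (v t) (v t) + F)) (at t) \<and>
    (\<eta> has_vector_derivative filt (x t)) (at t)"
  proof -
    have "((\<lambda>s. v s - shear (\<omega> * s) (x s)) has_vector_derivative P) (at t) \<longleftrightarrow> (v has_vector_derivative (christ (q t) (v t) (v t) + F)) (at t)"
      if "(q has_vector_derivative v t) (at t)" "(\<eta> has_vector_derivative filt (x t)) (at t)"
      using has_vector_derivative_add[OF _ D[OF that], of "\<lambda>s. v s - shear (\<omega> * s) (x s)" P]
        has_vector_derivative_diff[OF _ D[OF that], of v "christ (q t) (v t) (v t) + F"]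
      unfolding P_def by auto
    then show ?thesis by blast
  qed
  finally show ?thesis unfolding sat ..
qed

text \<open>Scaling time preserves negligible sets, and finitely many signals share one exceptional
  set.\<close>

lemma U_derivative_ae:
  assumes "\<omega> > 0"
  shows "\<exists>N. negligible N \<and> (\<forall>t i. t \<notin> N \<longrightarrow> i \<in> {1..n} \<longrightarrow> (U i has_real_derivative u i (\<omega> * t)) (at (\<omega> * t)))"
proof -
  have "\<forall>i\<in>{1..n}. \<exists>N. negligible N \<and> (\<forall>t. t \<notin> N \<longrightarrow> (U i has_real_derivative u i t) (at t))"
    using indefinite_integral_derivative_ae[OF U_integral] by blast
  then obtain N where N: "\<forall>i\<in>{1..n}. negligible (N i) \<and> (\<forall>t. t \<notin> N i \<longrightarrow> (U i has_real_derivative u i t) (at t))"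
    by (rule bchoice[THEN exE])
  show ?thesis
  proof (intro exI conjI allI impI)
    have "linear (\<lambda>t :: real. t / \<omega>)" by (rule linearI) (auto simp: add_divide_distrib)
    then have "negligible ((\<lambda>t. t / \<omega>) ` N i)" if "i \<in> {1..n}" for i
      using N that
      by (intro negligible_differentiable_image_negligible linear_imp_differentiable_on) auto
    then show "negligible (\<Union>i\<in>{1..n}. (\<lambda>t. t / \<omega>) ` N i)" by (intro negligible_Union) auto
    fix t i assume t: "t \<notin> (\<Union>i\<in>{1..n}. (\<lambda>t. t / \<omega>) ` N i)" and i: "i \<in> {1..n}"
    have "\<omega> * t \<notin> N i"
    proof
      assume "\<omega> * t \<in> N i"
      then have "t \<in> (\<lambda>t. t / \<omega>) ` N i" using \<open>\<omega> > 0\<close> by (intro image_eqI[of _ _ "\<omega> * t"]) auto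
      then show False using t i by blast
    qed
    then show "(U i has_real_derivative u i (\<omega> * t)) (at (\<omega> * t))" using N i by blast
  qed
qed

text \<open>From left to right, the equation off a negligible set is integrated, and differentiating
  the integral of a continuous function restores it at every time. From right to left, the velocity
  is bounded on compact intervals, so the transformed curve is Lipschitz there, and undoing the
  change keeps absolute continuity.\<close>

lemma closed_loop_solution_iff:
  assumes "\<omega> > 0"
  shows "CL \<omega> J x \<longleftrightarrow> ode_solution M (G \<omega>) J (\<lambda>t. phi \<omega> t (x t))"
proof
  let ?P = "satisfies_system Q nabla \<psi> h (closed_loop_rhs n Y R \<psi> \<alpha> u lam mu \<omega>)" and ?z = "\<lambda>t. phi \<omega> t (x t)"
  obtain N where N: "negligible N" "\<And>t i. t \<notin> N \<Longrightarrow> i \<in> {1..n} \<Longrightarrow> (U i has_real_derivative u i (\<omega> * t)) (at (\<omega> * t))"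
    using U_derivative_ae[OF assms] by blast
  {
    assume "CL \<omega> J x"
    then have J: "open J" "is_interval J" and xM: "\<And>t. t \<in> J \<Longrightarrow> x t \<in> M"
      and ac: "\<And>a b. {a..b} \<subseteq> J \<Longrightarrow> absolutely_continuous_on_interval a b x" and ae: "AE t in lebesgue. t \<in> J \<longrightarrow> ?P x t"
      unfolding closed_loop_solution_def caratheodory_solution_def by blast+
    obtain N' where N': "N' \<in> null_sets lebesgue" "{t \<in> space lebesgue. \<not> (t \<in> J \<longrightarrow> ?P x t)} \<subseteq> N'"
      using ae unfolding eventually_ae_filter by blast
    have neg: "negligible (N \<union> N')"
      using N(1) N'(1) by (intro negligible_Un) (simp_all only: negligible_iff_null_sets)
    have der: "(?z has_vector_derivative G \<omega> t (?z t)) (at t)" if "t \<in> J - (N \<union> N')" for t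
      using closed_loop_pointwise[OF J(1) _ xM N(2)] that N'(2) by auto
    have zac: "absolutely_continuous_on_interval a b ?z" if "{a..b} \<subseteq> J" for a b
      by (rule absolutely_continuous_shear(1)[OF ac[OF that]]) (use xM that in auto)
    show "ode_solution M (G \<omega>) J ?z"
      unfolding classical_solution_def
    proof (intro conjI ballI J)
      fix t assume t: "t \<in> J"
      show "?z t \<in> M" using xM[OF t] by simp
      obtain d where d: "d > 0" "cball t d \<subseteq> J" using J(1) t open_contains_cball by blast
      define a b where "a = t - d" and "b = t + d"
      have ab: "{a..b} \<subseteq> J" "a < t" "t < b" using d unfolding a_def b_def cball_eq_atLeastAtMost by auto
      have zc: "continuous_on {a..b} ?z" by (rule absolutely_continuous_imp_continuous_on[OF zac[OF ab(1)]])
      have zM: "?z ` {a..b} \<subseteq> M" using xM ab(1) by auto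
      have gc: "continuous_on {a..b} (\<lambda>t. G \<omega> t (?z t))" by (rule G_continuous[OF zc zM])
      have eq: "?z s = ?z a + integral {a..s} (\<lambda>t. G \<omega> t (?z t))" if s: "s \<in> {a..b}" for s
      proof -
        have sub: "{a..s} \<subseteq> J" using s ab(1) by (auto simp: subset_iff)
        have "((\<lambda>t. G \<omega> t (?z t)) has_integral (?z s - ?z a)) {a..s}"
          by (rule absolutely_continuous_has_integral[OF zac[OF sub] _ neg der]) (use s sub in auto)
        then show ?thesis by (simp add: integral_unique)
      qed
      have "((\<lambda>s. integral {a..s} (\<lambda>t. G \<omega> t (?z t))) has_vector_derivative G \<omega> t (?z t)) (at t within {a..b})"
        by (rule integral_has_vector_derivative[OF gc]) (use ab in auto)
      from has_vector_derivative_add[OF has_vector_derivative_const this, of "?z a"]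
      have "((\<lambda>s. ?z a + integral {a..s} (\<lambda>t. G \<omega> t (?z t))) has_vector_derivative G \<omega> t (?z t)) (at t within {a..b})" by simp
      then have "(?z has_vector_derivative G \<omega> t (?z t)) (at t within {a..b})"
        by (rule has_vector_derivative_transform[rotated 2]) (use eq ab in \<open>simp, blast\<close>)
      then show "(?z has_vector_derivative G \<omega> t (?z t)) (at t)" using ab by (simp add: at_within_Icc_at)
    qed
  }
  {
    assume "ode_solution M (G \<omega>) J ?z"
    then have J: "open J" "is_interval J" and zM: "\<And>t. t \<in> J \<Longrightarrow> ?z t \<in> M"
      and der: "\<And>t. t \<in> J \<Longrightarrow> (?z has_vector_derivative G \<omega> t (?z t)) (at t)"
      unfolding classical_solution_def by blast+
    have xM: "\<And>t. t \<in> J \<Longrightarrow> x t \<in> M" using zM by simp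
    have ac: "absolutely_continuous_on_interval a b x" if ab: "{a..b} \<subseteq> J" for a b
    proof -
      have zc: "continuous_on {a..b} ?z"
        using der ab has_vector_derivative_continuous by (blast intro: continuous_at_imp_continuous_on)
      have zM': "?z ` {a..b} \<subseteq> M" using zM ab by blast
      define g where "g t = G \<omega> t (?z t)" for t
      have "compact (g ` {a..b})"
        unfolding g_def by (intro compact_continuous_image G_continuous[OF zc zM']) simp
      then have "bounded (g ` {a..b})" by (rule compact_imp_bounded)
      then obtain B where B: "B > 0" "\<And>t. t \<in> {a..b} \<Longrightarrow> norm (g t) \<le> B"
        unfolding bounded_pos by (metis imageI)
      have g: "(?z has_vector_derivative g t) (at t within {a..b})" if "t \<in> {a..b}" for t
        unfolding g_def by (rule has_vector_derivative_at_within[OF der]) (rule subsetD[OF ab that])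
      have "absolutely_continuous_on_interval a b ?z"
      proof (rule lipschitz_imp_absolutely_continuous)
        show "norm (?z t - ?z s) \<le> B * \<bar>t - s\<bar>" if st: "s \<in> {a..b}" "t \<in> {a..b}" for s t
          by (rule has_vector_derivative_lipschitz[OF g convex_real_interval(5) B(2) st(2,1)])
      qed (use B(1) in simp)
      from absolutely_continuous_shear(2)[OF this zM[OF subsetD[OF ab]], of \<omega>] show ?thesis by simp
    qed
    have "AE t in lebesgue. t \<in> J \<longrightarrow> ?P x t"
    proof (rule AE_I')
      show "N \<in> null_sets lebesgue" using N(1) by (simp add: negligible_iff_null_sets)
      have "?P x t" if t: "t \<in> J" "t \<notin> N" for t
        by (rule iffD2[OF closed_loop_pointwise[where x = x and \<omega> = \<omega>, OF J(1) t(1) xM N(2)[OF t(2)]] der[OF t(1)]])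
      then show "{t \<in> space lebesgue. \<not> (t \<in> J \<longrightarrow> ?P x t)} \<subseteq> N" by blast
    qed
    then show "CL \<omega> J x"
      unfolding closed_loop_solution_def caratheodory_solution_def using J xM ac by blast
  }
qed

section \<open>Transfer of solutions and the approximation result\<close>

lemma averaged_solution_derivative:
  assumes sol: "averaged_solution Q nabla n Y R \<psi> \<alpha> lam mu h J x" and t: "t \<in> J"
  shows "(x has_vector_derivative (\<Sum>l\<in>I. m l *\<^sub>R k l (x t))) (at t)"
proof -
  have J: "open J" and xM: "\<And>t. t \<in> J \<Longrightarrow> x t \<in> M"
    and sat: "satisfies_system Q nabla \<psi> h (\<lambda>t. averaged_rhs Q nabla n Y R \<psi> \<alpha> lam mu) x t"
    using sol t unfolding averaged_solution_def classical_solution_def by blast+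
  define q v \<eta> where "q s = pos (x s)" and "v s = vel (x s)" and "\<eta> s = snd (x s)" for s
  have vt: "v t \<in> tangent_space Q (q t)" using xM[OF t] unfolding M_iff q_def v_def by auto
  have evJ: "\<forall>\<^sub>F s in nhds t. s \<in> J" using J t by (rule eventually_nhds_in_open)
  have evq: "\<forall>\<^sub>F s in nhds t. q s \<in> Q"
    using evJ by (rule eventually_mono) (use xM in \<open>auto simp: M_iff q_def\<close>)
  have evv: "\<forall>\<^sub>F s in nhds t. v s \<in> tangent_space Q (q s)"
    using evJ by (rule eventually_mono) (use xM in \<open>auto simp: M_iff q_def v_def\<close>)
  let ?F = "averaged_rhs Q nabla n Y R \<psi> \<alpha> lam mu (x t)"
  have s: "(q has_vector_derivative v t) (at t)" "has_covariant_derivative Q nabla q v ?F t"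
    "(\<eta> has_vector_derivative filt (x t)) (at t)"
    using sat unfolding satisfies_system_def Let_def q_def[symmetric] v_def[symmetric] \<eta>_def[symmetric]
      has_real_derivative_iff_has_vector_derivative by (simp_all add: filt_def q_def \<eta>_def)
  have "(v has_vector_derivative (christ (q t) (v t) (v t) + ?F)) (at t)"
    using has_covariant_derivative_iff[OF evq evv s(1) vt] s(2) by blast
  then have "((\<lambda>s. ((q s, v s), \<eta> s)) has_vector_derivative ((v t, christ (q t) (v t) (v t) + ?F), filt (x t))) (at t)"
    using s unfolding has_vector_derivative_Pair_iff by blast
  moreover have "(\<lambda>s. ((q s, v s), \<eta> s)) = x" unfolding q_def v_def \<eta>_def by simp
  ultimately show ?thesis unfolding average_field[OF xM[OF t]] q_def v_def by simp
qed

text \<open>An extension of the transformed curve is pulled back by \<open>phinv\<close> to an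
  extension of the original one, on the same interval.\<close>

lemma maximal_closed_loop_imp:
  assumes "\<omega> > 0" and max: "maximal_solution (CL \<omega>) t0 x0 J x"
  shows "maximal_solution (ode_solution M (G \<omega>)) t0 (phi \<omega> t0 x0) J (\<lambda>t. phi \<omega> t (x t))"
proof -
  note eq = closed_loop_solution_iff[OF assms(1)]
  have x: "CL \<omega> J x" "t0 \<in> J" "x t0 = x0"
    and mx: "\<And>J' y. CL \<omega> J' y \<Longrightarrow> J \<subseteq> J' \<Longrightarrow> \<forall>t\<in>J. y t = x t \<Longrightarrow> J' = J"
    using max unfolding maximal_solution_def by blast+
  show ?thesis
    unfolding maximal_solution_def
  proof (intro conjI allI impI; (elim conjE)?)
    show "ode_solution M (G \<omega>) J (\<lambda>t. phi \<omega> t (x t))" using x(1) eq by blast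
    fix J' y assume y: "ode_solution M (G \<omega>) J' y" "J \<subseteq> J'" "\<forall>t\<in>J. y t = phi \<omega> t (x t)"
    have "CL \<omega> J' (\<lambda>t. phinv \<omega> t (y t))"
      unfolding eq using y(1) by simp
    then show "J' = J" by (rule mx[OF _ y(2)]) (use y(3) in simp)
  qed (use x in auto)
qed

lemma maximal_closed_loop_exists:
  assumes "\<omega> > 0" and max: "maximal_solution (ode_solution M (G \<omega>)) t0 z0 J z"
  shows "maximal_solution (CL \<omega>) t0 (phinv \<omega> t0 z0) J (\<lambda>t. phinv \<omega> t (z t))"
proof -
  note eq = closed_loop_solution_iff[OF assms(1)]
  have z: "ode_solution M (G \<omega>) J z" "t0 \<in> J" "z t0 = z0"
    and mx: "\<And>J' y. ode_solution M (G \<omega>) J' y \<Longrightarrow> J \<subseteq> J' \<Longrightarrow> \<forall>t\<in>J. y t = z t \<Longrightarrow> J' = J"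
    using max unfolding maximal_solution_def by blast+
  show ?thesis
    unfolding maximal_solution_def
  proof (intro conjI allI impI; (elim conjE)?)
    show "CL \<omega> J (\<lambda>t. phinv \<omega> t (z t))"
      unfolding eq using z(1) by simp
    fix J' y assume y: "CL \<omega> J' y" "J \<subseteq> J'" "\<forall>t\<in>J. y t = phinv \<omega> t (z t)"
    have "ode_solution M (G \<omega>) J' (\<lambda>t. phi \<omega> t (y t))" using y(1) eq by blast
    then show "J' = J" by (rule mx[OF _ y(2)]) (use y(3) in simp)
  qed (use z in auto)
qed

lemma inv_change_of_variables:
  assumes "z \<in> M"
  shows "inv_into M (phi \<omega> t) z = phinv \<omega> t z"
proof (rule inv_into_f_eq)
  show "inj_on (phi \<omega> t) M" by (rule inj_on_inverseI[of _ "phinv \<omega> t"]) simp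
  show "phinv \<omega> t z \<in> M" using assms phi_in[of \<omega> t "phinv \<omega> t z"] by simp
qed simp

text \<open>The averaged solution satisfies the averaged equation for the coefficient fields
  \<open>k\<close>, so the averaging principle applies. Its existence part is carried back by
  \<open>phinv\<close>, and its estimate applies to the image under \<open>phi\<close> of any
  maximal closed-loop solution.\<close>

lemma closed_loop_approximates_average:
  assumes "closed Q" "compact C" "C \<subseteq> M" "\<nu> > 0" "\<Delta> > 0"
  shows "\<exists>\<omega>0>0. \<forall>t0. \<forall>xbar0\<in>C. \<forall>I xbar.
       maximal_solution (averaged_solution Q nabla n Y R \<psi> \<alpha> lam mu h) t0 xbar0 I xbar \<and>
       {t0..t0 + \<Delta>} \<subseteq> I \<and> (\<forall>t\<in>{t0..t0 + \<Delta>}. xbar t \<in> C) \<longrightarrow>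
       (\<forall>\<omega>\<ge>\<omega>0.
          let \<phi> = change_of_variables n Y \<psi> \<alpha> U lam \<omega>;
              x0 = inv_into M (\<phi> t0) xbar0;
              maximal = maximal_solution (CL \<omega>) t0 x0
          in (\<exists>J x. maximal J x) \<and>
             (\<forall>J x. maximal J x \<longrightarrow>
                {t0..t0 + \<Delta>} \<subseteq> J \<and>
                (\<forall>t\<in>{t0..t0 + \<Delta>}. norm (\<phi> t (x t) - xbar t) \<le> \<nu>)))"
    (is "\<exists>\<omega>0>0. \<forall>t0. \<forall>xbar0\<in>C. \<forall>I xbar. _ \<longrightarrow> (\<forall>\<omega>\<ge>\<omega>0. ?goal t0 xbar0 xbar \<omega>)")
proof -
  have "closed M" by (rule closed_state_space[OF Q assms(1)])
  have "finite I" by simp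
  have "\<exists>\<omega>0>0. \<forall>\<omega>\<ge>\<omega>0. \<forall>t0 x.
      (\<forall>t\<in>{t0..t0+\<Delta>}. x t \<in> C \<and> (x has_vector_derivative (\<Sum>l\<in>I. m l *\<^sub>R k l (x t))) (at t)) \<longrightarrow>
      (\<exists>J z. maximal_solution (ode_solution M (G \<omega>)) t0 (x t0) J z) \<and>
      (\<forall>J z. maximal_solution (ode_solution M (G \<omega>)) t0 (x t0) J z \<longrightarrow>
         {t0..t0+\<Delta>} \<subseteq> J \<and> (\<forall>t\<in>{t0..t0+\<Delta>}. norm (z t - x t) \<le> \<nu>))" (is "\<exists>\<omega>0>0. ?P \<omega>0")
    by (rule averaging_principle[OF \<open>finite I\<close> \<open>closed M\<close> T smooth_k c_continuous c_periodic c_mean retraction assms(2-5)])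
  then obtain \<omega>0 where \<omega>0: "\<omega>0 > 0" and main: "?P \<omega>0"
    by (elim exE conjE)
  show ?thesis
  proof (rule exI[of _ \<omega>0], rule conjI[OF \<omega>0], intro allI ballI impI, elim conjE)
    fix t0 xbar0 J0 xbar \<omega>
    assume x0: "xbar0 \<in> C" and max: "maximal_solution (averaged_solution Q nabla n Y R \<psi> \<alpha> lam mu h) t0 xbar0 J0 xbar"
      and sub: "{t0..t0 + \<Delta>} \<subseteq> J0" and C: "\<forall>t\<in>{t0..t0 + \<Delta>}. xbar t \<in> C" and \<omega>: "\<omega>0 \<le> \<omega>"
    have "\<omega> > 0" using \<omega>0 \<omega> by simp
    have sol: "averaged_solution Q nabla n Y R \<psi> \<alpha> lam mu h J0 xbar" "xbar t0 = xbar0"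
      using max unfolding maximal_solution_def by auto
    have "\<forall>t\<in>{t0..t0+\<Delta>}. xbar t \<in> C \<and> (xbar has_vector_derivative (\<Sum>l\<in>I. m l *\<^sub>R k l (xbar t))) (at t)"
      using averaged_solution_derivative[OF sol(1)] sub C by blast
    note * = main[THEN spec, THEN mp, OF \<omega>, THEN spec[of _ t0], THEN spec[of _ xbar], THEN mp, OF this, unfolded sol(2)]
    have M0: "xbar0 \<in> M" using x0 assms(3) by blast
    show "?goal t0 xbar0 xbar \<omega>"
      unfolding Let_def change_of_variables_eq inv_change_of_variables[OF M0]
    proof (rule conjI)
      obtain J z where "maximal_solution (ode_solution M (G \<omega>)) t0 xbar0 J z" using *[THEN conjunct1] by (elim exE)
      then show "\<exists>J x. maximal_solution (CL \<omega>) t0 (phinv \<omega> t0 xbar0) J x"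
        using maximal_closed_loop_exists[OF \<open>\<omega> > 0\<close>] by (intro exI)
      show "\<forall>J x. maximal_solution (CL \<omega>) t0 (phinv \<omega> t0 xbar0) J x \<longrightarrow>
          {t0..t0 + \<Delta>} \<subseteq> J \<and> (\<forall>t\<in>{t0..t0 + \<Delta>}. norm (phi \<omega> t (x t) - xbar t) \<le> \<nu>)"
      proof (intro allI impI)
        fix J x assume "maximal_solution (CL \<omega>) t0 (phinv \<omega> t0 xbar0) J x"
        from maximal_closed_loop_imp[OF \<open>\<omega> > 0\<close> this]
        have "maximal_solution (ode_solution M (G \<omega>)) t0 xbar0 J (\<lambda>t. phi \<omega> t (x t))" by simp
        then show "{t0..t0 + \<Delta>} \<subseteq> J \<and> (\<forall>t\<in>{t0..t0 + \<Delta>}. norm (phi \<omega> t (x t) - xbar t) \<le> \<nu>)"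
          using *[THEN conjunct2, THEN spec, THEN spec, THEN mp] by blast
      qed
    qed
  qed
qed

end

theorem proposition2:
  fixes Q :: "'a::euclidean_space set"
    and nabla :: "('a \<Rightarrow> 'a) \<Rightarrow> ('a \<Rightarrow> 'a) \<Rightarrow> 'a \<Rightarrow> 'a"
    and n :: nat
    and Y :: "nat \<Rightarrow> 'a \<Rightarrow> 'a"
    and R :: "'a \<Rightarrow> 'a \<Rightarrow> 'a"
    and \<psi> :: "'a \<Rightarrow> real"
    and \<alpha> :: "real \<Rightarrow> real"
    and u U :: "nat \<Rightarrow> real \<Rightarrow> real"
    and lam mu :: "nat \<Rightarrow> real"
    and T h :: real
  assumes "embedded_submanifold Q" and "closed Q"
    and "affine_connection Q nabla"
    and "\<forall>i\<in>{0..n}. vector_field Q (Y i)"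
    and "smooth_bundle_map Q R"
    and "smooth_on Q \<psi>"
    and "smooth_on UNIV \<alpha>"
    and "\<forall>y. \<alpha> y * deriv \<alpha> y > 0"
    and "strict_mono (\<lambda>y. \<alpha> y * deriv \<alpha> y)"
    and "T > 0"
    and "\<forall>i\<in>{1..n}. u i \<in> borel_measurable lebesgue"
    and "\<forall>i\<in>{1..n}. bounded (range (u i))"
    and "\<forall>i\<in>{1..n}. \<forall>t. u i (t + T) = u i t"
    and "\<forall>i\<in>{1..n}. integral {0..T} (u i) = 0"
    and "\<forall>i\<in>{1..n}. zero_mean_antiderivative T (u i) (U i)"
    and "\<forall>i\<in>{1..n}. \<forall>j\<in>{1..n}.
           1 / T * integral {0..T} (\<lambda>\<tau>. U i \<tau> * U j \<tau>) = (if i = j then 1 else 0)"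
    and "h > 0"
  shows "\<forall>C \<nu> \<Delta>. compact C \<and> C \<subseteq> state_space Q \<and> \<nu> > 0 \<and> \<Delta> > 0 \<longrightarrow>
    (\<exists>\<omega>0>0. \<forall>t0. \<forall>xbar0\<in>C. \<forall>I xbar.
       maximal_solution (averaged_solution Q nabla n Y R \<psi> \<alpha> lam mu h) t0 xbar0 I xbar \<and>
       {t0..t0 + \<Delta>} \<subseteq> I \<and> (\<forall>t\<in>{t0..t0 + \<Delta>}. xbar t \<in> C) \<longrightarrow>
       (\<forall>\<omega>\<ge>\<omega>0.
          let \<phi> = change_of_variables n Y \<psi> \<alpha> U lam \<omega>;
              x0 = inv_into (state_space Q) (\<phi> t0) xbar0;
              maximal = maximal_solution (closed_loop_solution Q nabla n Y R \<psi> \<alpha> u lam mu h \<omega>) t0 x0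
          in (\<exists>J x. maximal J x) \<and>
             (\<forall>J x. maximal J x \<longrightarrow>
                {t0..t0 + \<Delta>} \<subseteq> J \<and>
                (\<forall>t\<in>{t0..t0 + \<Delta>}. norm (\<phi> t (x t) - xbar t) \<le> \<nu>))))"
proof -
  interpret oscillatory_control Q nabla n Y R \<psi> \<alpha> u U lam mu T h
    by unfold_locales (use assms in \<open>simp_all\<close>)
  show ?thesis
    by (intro allI impI, elim conjE) (rule closed_loop_approximates_average[OF assms(2)]; assumption)
qed

end
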